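(* Let $M$ be a connected isoparametric hypersurface of $\mathbb{S}^2\times\mathbb{S}^2$. Then $M$ is congruent either to $\mathbb{S}^1(r)\times\mathbb{S}^2$ for some $r\in(0,1]$, or to $M_t$ for some $t\in(-1,1)$.
   Context: $\mathbb{S}^2\subset\mathbb{R}^3$ is the unit sphere and $\mathbb{S}^2\times\mathbb{S}^2$ carries the product metric. A smooth function $F:\mathbb{S}^2\times\mathbb{S}^2\to\mathbb{R}$ is isoparametric if its gradient and Laplacian satisfy $|\nabla F|^2=f(F)$ and $\Delta F=g(F)$ for some smooth functions $f,g:\mathbb{R}\to\mathbb{R}$. A hypersurface $M$ of $\mathbb{S}^2\times\mathbb{S}^2$ is isoparametric if there is an isoparametric function $F$ on $\mathbb{S}^2\times\mathbb{S}^2$ with $M=F^{-1}(t_0)$ for some regular value $t_0$ of $F$. Congruent means related by an isometry of $\mathbb{S}^2\times\mathbb{S}^2$. For $r\in(0,1]$, $\mathbb{S}^1(r)=\{(x,y,z)\in\mathbb{S}^2 : z=\sqrt{1-r^2}\}$. For $t\in(-1,1)$, $M_t=\{(p,q)\in\mathbb{S}^2\times\mathbb{S}^2 : \langle p,q\rangle=t\}$, where $\langle p,q\rangle$ is the inner product of $\mathbb{R}^3$. *)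

theory Defs
  imports "HOL-Analysis.Analysis"
begin

section \<open>Smooth maps\<close>

text \<open>Class $C^k$ on an open set: all partial derivatives up to order k exist and
  are continuous, and f is (Frechet) differentiable at every stage below k.\<close>

primrec C_k_on :: "nat \<Rightarrow> ('a::euclidean_space \<Rightarrow> 'b::real_normed_vector) \<Rightarrow> 'a set \<Rightarrow> bool" where
  "C_k_on 0 f U \<longleftrightarrow> continuous_on U f"
| "C_k_on (Suc k) f U \<longleftrightarrow>
     (\<forall>x\<in>U. f differentiable (at x)) \<and>
     (\<forall>b\<in>Basis. C_k_on k (\<lambda>x. frechet_derivative f (at x) b) U)"

text \<open>On an arbitrary subset S (in particular an embedded submanifold) smoothness means
  having smooth local extensions to the ambient space; values off S are irrelevant.\<close>

definition smooth_on :: "'a::euclidean_space set \<Rightarrow> ('a \<Rightarrow> 'b::real_normed_vector) \<Rightarrow> bool" where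
  "smooth_on S f \<longleftrightarrow>
     (\<forall>x\<in>S. \<exists>U G. open U \<and> x \<in> U \<and> (\<forall>k. C_k_on k G U) \<and> (\<forall>y\<in>U \<inter> S. G y = f y))"


section \<open>Riemannian geometry of \<open>S\<^sup>2 \<times> S\<^sup>2\<close>\<close>

abbreviation S2 :: "(real^3) set" where
  "S2 \<equiv> sphere 0 1"

abbreviation S2xS2 :: "((real^3) \<times> (real^3)) set" where
  "S2xS2 \<equiv> S2 \<times> S2"

text \<open>The product metric is the restriction of the inner product of
  \<open>(real^3) \<times> (real^3)\<close> to the tangent spaces.\<close>

definition tangent_space :: "(real^3) \<times> (real^3) \<Rightarrow> ((real^3) \<times> (real^3)) set" where
  "tangent_space x = {(u, v). u \<bullet> fst x = 0 \<and> v \<bullet> snd x = 0}"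

text \<open>Derivatives are taken \<open>at x within S2xS2\<close>. Such a derivative is a linear map on the
  ambient space that is determined only on the tangent space at x; there it is the
  differential of the map. All definitions below evaluate it on tangent vectors only.\<close>

definition differential ::
    "((real^3) \<times> (real^3) \<Rightarrow> 'b::real_normed_vector) \<Rightarrow> (real^3) \<times> (real^3) \<Rightarrow> (real^3) \<times> (real^3) \<Rightarrow> 'b" where
  "differential F x = frechet_derivative F (at x within S2xS2)"

definition gradient :: "((real^3) \<times> (real^3) \<Rightarrow> real) \<Rightarrow> (real^3) \<times> (real^3) \<Rightarrow> (real^3) \<times> (real^3)" where
  "gradient F x =
     (THE w. w \<in> tangent_space x \<and> (\<forall>v\<in>tangent_space x. w \<bullet> v = differential F x v))"

definition orthonormal_basis :: "'a::real_inner set \<Rightarrow> 'a set \<Rightarrow> bool" where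
  "orthonormal_basis V B \<longleftrightarrow> pairwise orthogonal B \<and> (\<forall>e\<in>B. norm e = 1) \<and> span B = V"

text \<open>The divergence of a tangent field X is the trace of its covariant derivative. The
  Levi-Civita derivative of X along e is the tangential part of \<open>differential X x e\<close>; the
  projection is omitted because e itself is tangent. The trace does not depend on the basis.\<close>

definition divergence :: "((real^3) \<times> (real^3) \<Rightarrow> (real^3) \<times> (real^3)) \<Rightarrow> (real^3) \<times> (real^3) \<Rightarrow> real" where
  "divergence X x =
     (\<Sum>e\<in>(SOME B. orthonormal_basis (tangent_space x) B). differential X x e \<bullet> e)"

definition laplacian :: "((real^3) \<times> (real^3) \<Rightarrow> real) \<Rightarrow> (real^3) \<times> (real^3) \<Rightarrow> real" where
  "laplacian F = divergence (gradient F)"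

definition isometry_S2xS2 :: "((real^3) \<times> (real^3) \<Rightarrow> (real^3) \<times> (real^3)) \<Rightarrow> bool" where
  "isometry_S2xS2 \<phi> \<longleftrightarrow>
     bij_betw \<phi> S2xS2 S2xS2 \<and> smooth_on S2xS2 \<phi> \<and> smooth_on S2xS2 (inv_into S2xS2 \<phi>) \<and>
     (\<forall>x\<in>S2xS2. \<forall>u\<in>tangent_space x. \<forall>v\<in>tangent_space x.
        differential \<phi> x u \<bullet> differential \<phi> x v = u \<bullet> v)"

definition congruent_S2xS2 :: "((real^3) \<times> (real^3)) set \<Rightarrow> ((real^3) \<times> (real^3)) set \<Rightarrow> bool" where
  "congruent_S2xS2 M M' \<longleftrightarrow> (\<exists>\<phi>. isometry_S2xS2 \<phi> \<and> \<phi> ` M = M')"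


section \<open>Isoparametric hypersurfaces\<close>

definition isoparametric_function :: "((real^3) \<times> (real^3) \<Rightarrow> real) \<Rightarrow> bool" where
  "isoparametric_function F \<longleftrightarrow>
     smooth_on S2xS2 F \<and>
     (\<exists>f g :: real \<Rightarrow> real. smooth_on UNIV f \<and> smooth_on UNIV g \<and>
        (\<forall>x\<in>S2xS2. (norm (gradient F x))\<^sup>2 = f (F x) \<and> laplacian F x = g (F x)))"

definition regular_value :: "((real^3) \<times> (real^3) \<Rightarrow> real) \<Rightarrow> real \<Rightarrow> bool" where
  "regular_value F t \<longleftrightarrow>
     (\<forall>x\<in>S2xS2. F x = t \<longrightarrow> differential F x ` tangent_space x = UNIV)"

text \<open>Values outside the range of F are vacuously regular, so non-emptiness, which is part
  of being a hypersurface, has to be required separately.\<close>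

definition isoparametric_hypersurface :: "((real^3) \<times> (real^3)) set \<Rightarrow> bool" where
  "isoparametric_hypersurface M \<longleftrightarrow>
     M \<noteq> {} \<and>
     (\<exists>F t. isoparametric_function F \<and> regular_value F t \<and> M = {x \<in> S2xS2. F x = t})"

definition S1 :: "real \<Rightarrow> (real^3) set" where
  "S1 r = {p \<in> S2. p $ 3 = sqrt (1 - r\<^sup>2)}"

definition M_level :: "real \<Rightarrow> ((real^3) \<times> (real^3)) set" where
  "M_level t = {(p, q) \<in> S2xS2. p \<bullet> q = t}"

end

theory Submission
  imports Defs "HOL-Computational_Algebra.Polynomial"
begin

text \<open>Let \<open>N = (N1, N2)\<close> be the unit normal of the level sets, \<open>r1 = |N1|\<^sup>2\<close>, \<open>r2 = |N2|\<^sup>2\<close>. The normal curves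
  are geodesics, along which \<open>r1\<close> and \<open>r2\<close> are constant and the shape operator solves a Riccati equation
  with curvature term \<open>diag(r1, r2, 0)\<close> in a parallel frame. The trace of the shape operator is a
  function of \<open>F\<close>, hence so are all its iterated normal derivatives; eliminating the shape operator
  shows that \<open>4 r1 r2\<close> takes finitely many values on \<open>M\<close>, so \<open>r1\<close> is constant on the connected set \<open>M\<close>.

  If \<open>r2 = 0\<close> (or \<open>r1 = 0\<close>), a fixed combination of \<open>fst x\<close> and \<open>N1\<close> is constant on \<open>M\<close>, so \<open>M\<close> is a circle
  times a sphere. Otherwise \<open>(r2 N1, - r1 N2)\<close> is in the kernel of the shape operator, and differentiating
  the invariants of the shape operator in this direction (Codazzi) forces \<open>r1 = r2 = 1/2\<close> and constant
  principal curvatures. Then the linear map taking the frame \<open>snd x\<close>, \<open>N2\<close>, \<open>snd x \<times> N2\<close> to suitable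
  combinations of \<open>fst x\<close>, \<open>N1\<close>, \<open>fst x \<times> N1\<close> is constant on \<open>M\<close>; it is a multiple of an orthogonal map \<open>R\<close>
  with \<open>fst x \<bullet> R (snd x)\<close> constant on \<open>M\<close>. In both cases \<open>M\<close> is open and closed in a connected level set.\<close>

section \<open>Calculus of smooth maps\<close>

text \<open>The obstacle is that on each level set only the trace of the shape operator is known:
  neither the principal curvatures nor the angle between the normal and the two factors is constant
  a priori. What helps is that all nearby level sets are available at once. In the parallel frame
  the Jacobi equation along a normal geodesic splits into curvature terms \<open>r1\<close>,
  \<open>r2\<close> and \<open>0\<close>, so the determinant of a Jacobi tensor combines the
  frequencies \<open>sqrt r1 + sqrt r2\<close> and \<open>sqrt r1 - sqrt r2\<close>, each doubled by
  the frequency zero. As \<open>r1 + r2 = 1\<close>, their squares are \<open>1 + s\<close> and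
  \<open>1 - s\<close> with \<open>s^2 = 4 r1 r2\<close>; this is the origin of the invariant that
  is shown to take finitely many values. No connection, curvature tensor or flow is introduced.
  \<open>F\<close> is extended constantly along radii, all derivatives are derivatives in R^6, and
  an identity that holds only on the product of spheres is differentiated only in tangent
  directions. The symmetry of the second derivative of \<open>N\<close> takes the place of the
  Codazzi equation.\<close>

lemma C_k_on_cong:
  assumes "open U" "\<And>x. x \<in> U \<Longrightarrow> f x = g x"
  shows "C_k_on k f U \<longleftrightarrow> C_k_on k g U"
  using assms(2)
proof (induction k arbitrary: f g)
  case 0
  then show ?case by (simp cong: continuous_on_cong)
next
  case (Suc k)
  have fr: "(f has_derivative L) (at x) \<longleftrightarrow> (g has_derivative L) (at x)" if "x \<in> U" for x L
    using has_derivative_transform_within_open[OF _ \<open>open U\<close> that, of f L UNIV g]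
      has_derivative_transform_within_open[OF _ \<open>open U\<close> that, of g L UNIV f] Suc.prems
    by auto
  then have "frechet_derivative f (at x) b = frechet_derivative g (at x) b" if "x \<in> U" for x b
    using that by (simp add: frechet_derivative_def)
  then have "C_k_on k (\<lambda>x. frechet_derivative f (at x) b) U \<longleftrightarrow>
      C_k_on k (\<lambda>x. frechet_derivative g (at x) b) U" for b
    by (intro Suc.IH)
  moreover have "f differentiable (at x) \<longleftrightarrow> g differentiable (at x)" if "x \<in> U" for x
    using fr[OF that] by (simp add: differentiable_def)
  ultimately show ?case by simp
qed

lemma C_k_on_subset: "C_k_on k f U \<Longrightarrow> V \<subseteq> U \<Longrightarrow> C_k_on k f V"
proof (induction k arbitrary: f)
  case 0
  then show ?case by (auto intro: continuous_on_subset)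
next
  case (Suc k)
  then show ?case by auto
qed

lemma C_k_on_locally:
  assumes "\<And>x. x \<in> U \<Longrightarrow> \<exists>V. open V \<and> x \<in> V \<and> C_k_on k f V"
  shows "C_k_on k f U"
  using assms
proof (induction k arbitrary: f)
  case 0
  then have "continuous (at x) f" if "x \<in> U" for x
    using that by (metis C_k_on.simps(1) continuous_on_eq_continuous_at)
  then show ?case by (simp add: continuous_at_imp_continuous_on)
next
  case (Suc k)
  have "f differentiable (at x)" if "x \<in> U" for x
    using Suc.prems[OF that] by auto
  moreover have "C_k_on k (\<lambda>x. frechet_derivative f (at x) b) U" if "b \<in> Basis" for b
    using Suc.prems that by (intro Suc.IH) fastforce
  ultimately show ?case by simp
qed

lemma C_k_on_SucD: "C_k_on (Suc k) f U \<Longrightarrow> C_k_on k f U"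
proof (induction k arbitrary: f)
  case 0
  then show ?case
    by (auto intro!: continuous_at_imp_continuous_on differentiable_imp_continuous_within)
next
  case (Suc k)
  have "C_k_on k (\<lambda>x. frechet_derivative f (at x) b) U" if "b \<in> Basis" for b
    using Suc.prems that by (intro Suc.IH) simp
  then show ?case using Suc.prems by simp
qed

lemma C_k_on_const: "C_k_on k (\<lambda>x. c) U"
  by (induction k arbitrary: c) simp_all

text \<open>Removes the choice hidden in \<open>frechet_derivative\<close>: any explicit formula for
  the derivative may be used in an induction on the order.\<close>

lemma C_k_on_SucI:
  assumes "open U" "\<And>x. x \<in> U \<Longrightarrow> (f has_derivative f' x) (at x)"
    and "\<And>b. b \<in> Basis \<Longrightarrow> C_k_on k (\<lambda>x. f' x b) U"
  shows "C_k_on (Suc k) f U"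
proof -
  have "C_k_on k (\<lambda>x. frechet_derivative f (at x) b) U" if "b \<in> Basis" for b
    using assms(3)[OF that] C_k_on_cong[OF \<open>open U\<close>, of "\<lambda>x. frechet_derivative f (at x) b" "\<lambda>x. f' x b"]
      frechet_derivative_at[OF assms(2)] by metis
  then show ?thesis using assms(2) by (auto simp: differentiable_def)
qed

lemma C_k_on_SucE:
  assumes "C_k_on (Suc k) f U"
  shows "\<And>x. x \<in> U \<Longrightarrow> (f has_derivative frechet_derivative f (at x)) (at x)"
    and "\<And>b. b \<in> Basis \<Longrightarrow> C_k_on k (\<lambda>x. frechet_derivative f (at x) b) U"
  using assms by (auto simp: frechet_derivative_works)

lemma C_k_on_linear: "bounded_linear L \<Longrightarrow> open U \<Longrightarrow> C_k_on k L U"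
proof (cases k)
  case 0
  then show "bounded_linear L \<Longrightarrow> open U \<Longrightarrow> ?thesis" by (simp add: linear_continuous_on)
next
  case (Suc n)
  show "bounded_linear L \<Longrightarrow> open U \<Longrightarrow> ?thesis" unfolding Suc
    by (rule C_k_on_SucI[OF _ bounded_linear.has_derivative[OF _ has_derivative_ident]])
      (auto intro: C_k_on_const)
qed

lemma C_k_on_add:
  assumes "open U" "C_k_on k f U" "C_k_on k g U"
  shows "C_k_on k (\<lambda>x. f x + g x) U"
  using assms(2,3)
proof (induction k arbitrary: f g)
  case 0
  then show ?case by (auto intro: continuous_on_add)
next
  case (Suc k)
  show ?case
    by (rule C_k_on_SucI[OF \<open>open U\<close> has_derivative_add[OF C_k_on_SucE(1)[OF Suc.prems(1)] C_k_on_SucE(1)[OF Suc.prems(2)]]])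
      (auto intro!: Suc.IH C_k_on_SucE(2)[OF Suc.prems(1)] C_k_on_SucE(2)[OF Suc.prems(2)])
qed

lemma C_k_on_bilinear:
  assumes "bounded_bilinear bop" "open U" "C_k_on k f U" "C_k_on k g U"
  shows "C_k_on k (\<lambda>x. bop (f x) (g x)) U"
  using assms(3,4)
proof (induction k arbitrary: f g)
  case 0
  then show ?case by (auto intro: bounded_bilinear.continuous_on[OF assms(1)])
next
  case (Suc k)
  show ?case
    by (rule C_k_on_SucI[OF \<open>open U\<close> bounded_bilinear.FDERIV[OF assms(1) C_k_on_SucE(1)[OF Suc.prems(1)] C_k_on_SucE(1)[OF Suc.prems(2)]]])
      (auto intro!: C_k_on_add[OF \<open>open U\<close>] Suc.IH C_k_on_SucD[OF Suc.prems(1)] C_k_on_SucD[OF Suc.prems(2)]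
          C_k_on_SucE(2)[OF Suc.prems(1)] C_k_on_SucE(2)[OF Suc.prems(2)])
qed

lemma C_k_on_bounded_linear:
  assumes "bounded_linear L" "open U" "C_k_on k f U"
  shows "C_k_on k (\<lambda>x. L (f x)) U"
  using assms(3)
proof (induction k arbitrary: f)
  case 0
  then show ?case by (auto intro: bounded_linear.continuous_on[OF assms(1)])
next
  case (Suc k)
  show ?case
    by (rule C_k_on_SucI[OF \<open>open U\<close> bounded_linear.has_derivative[OF assms(1) C_k_on_SucE(1)[OF Suc.prems(1)]]])
      (auto intro!: Suc.IH C_k_on_SucE(2)[OF Suc.prems(1)])
qed

lemma C_k_on_sum:
  assumes "open U" "finite I" "\<And>i. i \<in> I \<Longrightarrow> C_k_on k (f i) U"
  shows "C_k_on k (\<lambda>x. \<Sum>i\<in>I. f i x) U"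
  using assms(2,3)
  by (induction I rule: finite_induct) (auto intro: C_k_on_const C_k_on_add[OF \<open>open U\<close>])

lemma linear_euclidean_expansion:
  fixes L :: "'a::euclidean_space \<Rightarrow> 'b::real_vector"
  assumes "linear L"
  shows "L v = (\<Sum>b\<in>Basis. (v \<bullet> b) *\<^sub>R L b)"
proof -
  have "L v = L (\<Sum>b\<in>Basis. (v \<bullet> b) *\<^sub>R b)" by (simp add: euclidean_representation)
  then show ?thesis by (simp add: linear_sum[OF assms] linear_scale[OF assms])
qed

text \<open>Expanded in a basis, the derivative of the composite is a sum of products of components
  of the derivative of \<open>g\<close> with partial derivatives of \<open>f\<close> taken after
  \<open>g\<close>. The latter are composites with the same \<open>g\<close>, so the induction
  generalises \<open>f\<close> alone.\<close>

lemma C_k_on_compose: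
  fixes f :: "'b::euclidean_space \<Rightarrow> 'c::real_normed_vector" and g :: "'a::euclidean_space \<Rightarrow> 'b"
  assumes "open U" "open V" "g ` U \<subseteq> V" "C_k_on k f V" "C_k_on k g U"
  shows "C_k_on k (\<lambda>x. f (g x)) U"
  using assms(4,5)
proof (induction k arbitrary: f)
  case 0
  then show ?case using assms(3) by (auto intro: continuous_on_compose2)
next
  case (Suc k)
  let ?D = "\<lambda>x. frechet_derivative g (at x)"
  have f: "(f has_derivative frechet_derivative f (at (g x))) (at (g x))" if "x \<in> U" for x
    using C_k_on_SucE(1)[OF Suc.prems(1)] assms(3) that by auto
  have "((\<lambda>x. f (g x)) has_derivative (\<lambda>v. \<Sum>i\<in>Basis. (?D x v \<bullet> i) *\<^sub>R frechet_derivative f (at (g x)) i)) (at x)"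
    if "x \<in> U" for x
  proof -
    have "((\<lambda>x. f (g x)) has_derivative (\<lambda>v. frechet_derivative f (at (g x)) (?D x v))) (at x)"
      by (rule has_derivative_compose[OF C_k_on_SucE(1)[OF Suc.prems(2) that] f[OF that]])
    also have "(\<lambda>v. frechet_derivative f (at (g x)) (?D x v))
        = (\<lambda>v. \<Sum>i\<in>Basis. (?D x v \<bullet> i) *\<^sub>R frechet_derivative f (at (g x)) i)"
      by (rule ext, rule linear_euclidean_expansion[OF has_derivative_linear[OF f[OF that]]])
    finally show ?thesis .
  qed
  moreover have "C_k_on k (\<lambda>x. \<Sum>i\<in>Basis. (?D x b \<bullet> i) *\<^sub>R frechet_derivative f (at (g x)) i) U"
    if "b \<in> Basis" for b
    by (intro C_k_on_sum[OF \<open>open U\<close>] C_k_on_bilinear[OF bounded_bilinear_scaleR \<open>open U\<close>]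
        C_k_on_bounded_linear[OF bounded_linear_inner_left \<open>open U\<close>] Suc.IH
        C_k_on_SucD[OF Suc.prems(2)]) (use Suc.prems that in auto)
  ultimately show ?case by (rule C_k_on_SucI[OF \<open>open U\<close>])
qed

definition C_inf_on :: "'a::euclidean_space set \<Rightarrow> ('a \<Rightarrow> 'b::real_normed_vector) \<Rightarrow> bool" where
  "C_inf_on U f \<longleftrightarrow> open U \<and> (\<forall>k. C_k_on k f U)"

definition dderiv :: "('a::euclidean_space \<Rightarrow> 'b::real_normed_vector) \<Rightarrow> 'a \<Rightarrow> 'a \<Rightarrow> 'b" where
  "dderiv f x = frechet_derivative f (at x)"

lemma C_inf_on_has_derivative:
  "C_inf_on U f \<Longrightarrow> x \<in> U \<Longrightarrow> (f has_derivative dderiv f x) (at x)"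
  unfolding C_inf_on_def dderiv_def by (meson C_k_on_SucE(1))

lemma dderiv_eq: "(f has_derivative L) (at x) \<Longrightarrow> dderiv f x = L"
  unfolding dderiv_def by (metis frechet_derivative_at)

lemma C_inf_on_linear_dderiv: "C_inf_on U f \<Longrightarrow> x \<in> U \<Longrightarrow> linear (dderiv f x)"
  by (meson C_inf_on_has_derivative has_derivative_linear)

lemma C_inf_on_continuous_on: "C_inf_on U f \<Longrightarrow> continuous_on U f"
  unfolding C_inf_on_def by (metis C_k_on.simps(1))

lemma C_inf_on_cong:
  assumes "\<And>x. x \<in> U \<Longrightarrow> f x = g x" shows "C_inf_on U f \<longleftrightarrow> C_inf_on U g"
  unfolding C_inf_on_def using C_k_on_cong[of U f g] assms by metis

lemma C_inf_on_subset: "C_inf_on U f \<Longrightarrow> open V \<Longrightarrow> V \<subseteq> U \<Longrightarrow> C_inf_on V f"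
  unfolding C_inf_on_def by (meson C_k_on_subset)

lemma C_inf_on_const: "open U \<Longrightarrow> C_inf_on U (\<lambda>x. c)"
  unfolding C_inf_on_def by (simp add: C_k_on_const)

lemma C_inf_on_linear: "bounded_linear L \<Longrightarrow> open U \<Longrightarrow> C_inf_on U L"
  unfolding C_inf_on_def by (simp add: C_k_on_linear)

lemma C_inf_on_add: "C_inf_on U f \<Longrightarrow> C_inf_on U g \<Longrightarrow> C_inf_on U (\<lambda>x. f x + g x)"
  unfolding C_inf_on_def by (simp add: C_k_on_add)

lemma C_inf_on_bilinear:
  "bounded_bilinear bop \<Longrightarrow> C_inf_on U f \<Longrightarrow> C_inf_on U g \<Longrightarrow> C_inf_on U (\<lambda>x. bop (f x) (g x))"
  unfolding C_inf_on_def by (simp add: C_k_on_bilinear)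

lemma C_inf_on_bounded_linear:
  "bounded_linear L \<Longrightarrow> C_inf_on U f \<Longrightarrow> C_inf_on U (\<lambda>x. L (f x))"
  unfolding C_inf_on_def by (simp add: C_k_on_bounded_linear)

lemma C_inf_on_sum:
  "open U \<Longrightarrow> finite I \<Longrightarrow> (\<And>i. i \<in> I \<Longrightarrow> C_inf_on U (f i)) \<Longrightarrow> C_inf_on U (\<lambda>x. \<Sum>i\<in>I. f i x)"
  unfolding C_inf_on_def by (simp add: C_k_on_sum)

lemma C_inf_on_compose:
  fixes f :: "'b::euclidean_space \<Rightarrow> 'c::real_normed_vector" and g :: "'a::euclidean_space \<Rightarrow> 'b"
  shows "C_inf_on V f \<Longrightarrow> C_inf_on U g \<Longrightarrow> g ` U \<subseteq> V \<Longrightarrow> C_inf_on U (\<lambda>x. f (g x))"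
  unfolding C_inf_on_def by (auto intro: C_k_on_compose)

lemma C_inf_on_locally:
  assumes "open U" "\<And>x. x \<in> U \<Longrightarrow> \<exists>V. x \<in> V \<and> C_inf_on V f"
  shows "C_inf_on U f"
  using assms unfolding C_inf_on_def by (meson C_k_on_locally)

lemma C_inf_on_dderiv_const:
  assumes "C_inf_on U f" shows "C_inf_on U (\<lambda>x. dderiv f x v)"
proof -
  have b: "C_inf_on U (\<lambda>x. dderiv f x b)" if "b \<in> Basis" for b
    using assms that unfolding C_inf_on_def dderiv_def by (auto intro: C_k_on_SucE(2))
  have "C_inf_on U (\<lambda>x. \<Sum>b\<in>Basis. (v \<bullet> b) *\<^sub>R dderiv f x b)"
    using assms b by (intro C_inf_on_sum C_inf_on_bounded_linear[OF bounded_linear_scaleR_right])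
      (auto simp: C_inf_on_def)
  then show ?thesis
    by (rule iffD1[OF C_inf_on_cong, rotated])
      (rule linear_euclidean_expansion[OF C_inf_on_linear_dderiv[OF assms], symmetric])
qed

text \<open>Product rule for a derivative evaluated on a moving vector. It is what allows the shape
  operator to be differentiated on a frame that varies from point to point.\<close>

lemma has_derivative_dderiv_field:
  assumes f: "C_inf_on U f" and x: "x \<in> U" and Z: "(Z has_derivative Z') (at x)"
  shows "((\<lambda>y. dderiv f y (Z y)) has_derivative
      (\<lambda>u. dderiv (\<lambda>y. dderiv f y (Z x)) x u + dderiv f x (Z' u))) (at x)"
proof -
  have lin: "linear (dderiv f y)" if "y \<in> U" for y
    using f that by (rule C_inf_on_linear_dderiv)
  have b: "((\<lambda>y. dderiv f y b) has_derivative dderiv (\<lambda>y. dderiv f y b) x) (at x)" for b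
    by (rule C_inf_on_has_derivative[OF C_inf_on_dderiv_const[OF f] x])
  have "((\<lambda>y. \<Sum>b\<in>Basis. (Z y \<bullet> b) *\<^sub>R dderiv f y b) has_derivative
      (\<lambda>u. \<Sum>b\<in>Basis. (Z x \<bullet> b) *\<^sub>R dderiv (\<lambda>y. dderiv f y b) x u + (Z' u \<bullet> b) *\<^sub>R dderiv f x b)) (at x)"
    by (intro has_derivative_sum bounded_bilinear.FDERIV[OF bounded_bilinear_scaleR]
        bounded_linear.has_derivative[OF bounded_linear_inner_left] b Z)
  moreover have "(\<Sum>b\<in>Basis. (Z x \<bullet> b) *\<^sub>R dderiv (\<lambda>y. dderiv f y b) x u + (Z' u \<bullet> b) *\<^sub>R dderiv f x b)
      = dderiv (\<lambda>y. dderiv f y (Z x)) x u + dderiv f x (Z' u)" for u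
  proof -
    have "((\<lambda>y. \<Sum>b\<in>Basis. (Z x \<bullet> b) *\<^sub>R dderiv f y b) has_derivative
      (\<lambda>u. \<Sum>b\<in>Basis. (Z x \<bullet> b) *\<^sub>R dderiv (\<lambda>y. dderiv f y b) x u)) (at x)"
      by (intro has_derivative_sum has_derivative_scaleR_right b)
    then have "((\<lambda>y. dderiv f y (Z x)) has_derivative
      (\<lambda>u. \<Sum>b\<in>Basis. (Z x \<bullet> b) *\<^sub>R dderiv (\<lambda>y. dderiv f y b) x u)) (at x)"
      by (rule has_derivative_transform_within_open)
        (use f x linear_euclidean_expansion[OF lin] in \<open>auto simp: C_inf_on_def\<close>)
    then have "dderiv (\<lambda>y. dderiv f y (Z x)) x u = (\<Sum>b\<in>Basis. (Z x \<bullet> b) *\<^sub>R dderiv (\<lambda>y. dderiv f y b) x u)"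
      by (simp add: dderiv_eq)
    then show ?thesis
      by (simp add: sum.distrib linear_euclidean_expansion[OF lin[OF x], of "Z' u"])
  qed
  ultimately have "((\<lambda>y. \<Sum>b\<in>Basis. (Z y \<bullet> b) *\<^sub>R dderiv f y b) has_derivative
      (\<lambda>u. dderiv (\<lambda>y. dderiv f y (Z x)) x u + dderiv f x (Z' u))) (at x)"
    by simp
  then show ?thesis
    by (rule has_derivative_transform_within_open)
      (use f x linear_euclidean_expansion[OF lin] in \<open>auto simp: C_inf_on_def\<close>)
qed

text \<open>Second differences at scale \<open>t\<close> are, by the mean value theorem applied in either order,
  \<open>t\<^sup>2\<close> times a value of either mixed derivative near \<open>x\<close>.\<close>
lemma dderiv_symmetric_real:
  fixes f :: "'a::euclidean_space \<Rightarrow> real"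
  assumes f: "C_inf_on U f" and x: "x \<in> U"
  shows "dderiv (\<lambda>y. dderiv f y v) x u = dderiv (\<lambda>y. dderiv f y u) x v"
proof -
  have oU: "open U" using f by (simp add: C_inf_on_def)
  have key: "\<exists>y. norm (y - x) \<le> t * (norm a + norm b) \<and>
      f (x + t *\<^sub>R a + t *\<^sub>R b) - f (x + t *\<^sub>R a) - f (x + t *\<^sub>R b) + f x
        = t\<^sup>2 * dderiv (\<lambda>y. dderiv f y a) y b"
    if t: "0 < t" "cball x (t * (norm a + norm b)) \<subseteq> U" for t a b
  proof -
    have inU: "x + s *\<^sub>R a + r *\<^sub>R b \<in> U" and nrm: "norm (x + s *\<^sub>R a + r *\<^sub>R b - x) \<le> t * (norm a + norm b)"
      if "0 \<le> s" "s \<le> t" "0 \<le> r" "r \<le> t" for s r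
    proof -
      have "norm (s *\<^sub>R a + r *\<^sub>R b) \<le> s * norm a + r * norm b"
        using that norm_triangle_ineq[of "s *\<^sub>R a" "r *\<^sub>R b"] by simp
      also have "\<dots> \<le> t * norm a + t * norm b"
        using that by (intro add_mono mult_right_mono) auto
      finally show n: "norm (x + s *\<^sub>R a + r *\<^sub>R b - x) \<le> t * (norm a + norm b)"
        by (simp add: algebra_simps)
      then show "x + s *\<^sub>R a + r *\<^sub>R b \<in> U"
        using t(2) by (auto simp: dist_norm norm_minus_commute subset_iff)
    qed
    define h where "h s = f (x + s *\<^sub>R a + t *\<^sub>R b) - f (x + s *\<^sub>R a)" for s
    have "\<exists>\<xi>. 0 < \<xi> \<and> \<xi> < t \<and> h t - h 0 = (t - 0) * (dderiv f (x + \<xi> *\<^sub>R a + t *\<^sub>R b) a - dderiv f (x + \<xi> *\<^sub>R a) a)"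
    proof (rule MVT2[OF \<open>0 < t\<close>])
      fix s assume s: "0 \<le> s" "s \<le> t"
      have i1: "x + s *\<^sub>R a + t *\<^sub>R b \<in> U" using inU[OF s, of t] t by simp
      have i2: "x + s *\<^sub>R a \<in> U" using inU[OF s, of 0] t by simp
      have l: "((\<lambda>s. x + s *\<^sub>R a + t *\<^sub>R b) has_derivative (\<lambda>d. d *\<^sub>R a)) (at s)"
        "((\<lambda>s. x + s *\<^sub>R a) has_derivative (\<lambda>d. d *\<^sub>R a)) (at s)"
        by (auto intro!: derivative_eq_intros)
      have "(h has_derivative (\<lambda>d. dderiv f (x + s *\<^sub>R a + t *\<^sub>R b) (d *\<^sub>R a) - dderiv f (x + s *\<^sub>R a) (d *\<^sub>R a))) (at s)"
        unfolding h_def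
        by (intro has_derivative_diff has_derivative_compose[OF l(1) C_inf_on_has_derivative[OF f i1]]
            has_derivative_compose[OF l(2) C_inf_on_has_derivative[OF f i2]])
      moreover have "(\<lambda>d. dderiv f (x + s *\<^sub>R a + t *\<^sub>R b) (d *\<^sub>R a) - dderiv f (x + s *\<^sub>R a) (d *\<^sub>R a))
          = (*) (dderiv f (x + s *\<^sub>R a + t *\<^sub>R b) a - dderiv f (x + s *\<^sub>R a) a)"
        by (rule ext) (simp add: linear_scale[OF C_inf_on_linear_dderiv[OF f i1]]
            linear_scale[OF C_inf_on_linear_dderiv[OF f i2]] left_diff_distrib right_diff_distrib mult.commute)
      ultimately show "DERIV h s :> dderiv f (x + s *\<^sub>R a + t *\<^sub>R b) a - dderiv f (x + s *\<^sub>R a) a"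
        unfolding has_field_derivative_def by simp
    qed
    then obtain \<xi> where xi: "0 < \<xi>" "\<xi> < t"
      "h t - h 0 = t * (dderiv f (x + \<xi> *\<^sub>R a + t *\<^sub>R b) a - dderiv f (x + \<xi> *\<^sub>R a) a)" by auto
    define k where "k r = dderiv f (x + \<xi> *\<^sub>R a + r *\<^sub>R b) a" for r
    have "\<exists>\<eta>. 0 < \<eta> \<and> \<eta> < t \<and> k t - k 0 = (t - 0) * dderiv (\<lambda>y. dderiv f y a) (x + \<xi> *\<^sub>R a + \<eta> *\<^sub>R b) b"
    proof (rule MVT2[OF \<open>0 < t\<close>])
      fix r assume r: "0 \<le> r" "r \<le> t"
      have i: "x + \<xi> *\<^sub>R a + r *\<^sub>R b \<in> U" using inU[of \<xi> r] xi r by simp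
      have l: "((\<lambda>r. x + \<xi> *\<^sub>R a + r *\<^sub>R b) has_derivative (\<lambda>d. d *\<^sub>R b)) (at r)"
        by (auto intro!: derivative_eq_intros)
      note g = C_inf_on_dderiv_const[OF f, of a]
      have "(k has_derivative (\<lambda>d. dderiv (\<lambda>y. dderiv f y a) (x + \<xi> *\<^sub>R a + r *\<^sub>R b) (d *\<^sub>R b))) (at r)"
        unfolding k_def by (rule has_derivative_compose[OF l C_inf_on_has_derivative[OF g i]])
      moreover have "(\<lambda>d. dderiv (\<lambda>y. dderiv f y a) (x + \<xi> *\<^sub>R a + r *\<^sub>R b) (d *\<^sub>R b))
          = (*) (dderiv (\<lambda>y. dderiv f y a) (x + \<xi> *\<^sub>R a + r *\<^sub>R b) b)"
        by (rule ext) (simp add: linear_scale[OF C_inf_on_linear_dderiv[OF g i]] mult.commute)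
      ultimately show "DERIV k r :> dderiv (\<lambda>y. dderiv f y a) (x + \<xi> *\<^sub>R a + r *\<^sub>R b) b"
        unfolding has_field_derivative_def by simp
    qed
    then obtain \<eta> where eta: "0 < \<eta>" "\<eta> < t"
      "k t - k 0 = t * dderiv (\<lambda>y. dderiv f y a) (x + \<xi> *\<^sub>R a + \<eta> *\<^sub>R b) b" by auto
    have "h t - h 0 = t\<^sup>2 * dderiv (\<lambda>y. dderiv f y a) (x + \<xi> *\<^sub>R a + \<eta> *\<^sub>R b) b"
      using xi(3) eta(3) by (simp add: k_def power2_eq_square)
    then show ?thesis using nrm[of \<xi> \<eta>] xi eta
      by (intro exI[of _ "x + \<xi> *\<^sub>R a + \<eta> *\<^sub>R b"]) (simp add: h_def)
  qed
  obtain e where e: "e > 0" "cball x e \<subseteq> U" using oU x open_contains_cball by metis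
  let ?n = "norm u + norm v + 1"
  have lim: "(\<lambda>n. dderiv (\<lambda>y. dderiv f y a) (Y n) b) \<longlonglongrightarrow> dderiv (\<lambda>y. dderiv f y a) x b"
    if "Y \<longlonglongrightarrow> x" for Y and a b :: 'a
  proof -
    have "continuous_on U (\<lambda>y. dderiv (\<lambda>y. dderiv f y a) y b)"
      by (intro C_inf_on_continuous_on C_inf_on_dderiv_const f)
    then have "isCont (\<lambda>y. dderiv (\<lambda>y. dderiv f y a) y b) x"
      using continuous_on_eq_continuous_at[OF oU] x by blast
    then show ?thesis using isCont_tendsto_compose that by blast
  qed
  \<comment> \<open>These scales tend to zero while \<open>T n * (norm u + norm v) \<le> e\<close>
    keeps every parallelogram inside \<open>U\<close>; the summand 1 in \<open>?n\<close> keeps the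
    divisor positive when both vectors vanish.\<close>
  define T where "T n = e / ?n / real (Suc n)" for n
  have np: "?n > 0" by (smt (verit) norm_ge_zero)
  have T: "0 < T n" "T n * (norm u + norm v) \<le> e" for n
  proof -
    show "0 < T n" using e np by (simp add: T_def)
    have "T n * (norm u + norm v) \<le> T n * ?n" using \<open>0 < T n\<close> by (intro mult_left_mono) auto
    also have "\<dots> = e / real (Suc n)" using np by (simp add: T_def)
    also have "\<dots> \<le> e" using e by (simp add: field_simps)
    finally show "T n * (norm u + norm v) \<le> e" .
  qed
  have T0: "(\<lambda>n. T n * c) \<longlonglongrightarrow> 0" for c
    unfolding T_def using LIMSEQ_Suc[OF lim_const_over_n, of "e / ?n"]
    by (intro tendsto_mult_left_zero) simp
  have sub: "cball x (T n * (norm v + norm u)) \<subseteq> U" "cball x (T n * (norm u + norm v)) \<subseteq> U" for n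
    using e(2) T(2)[of n] by (auto simp: add.commute)
  obtain Y where Y: "\<And>n. norm (Y n - x) \<le> T n * (norm v + norm u)"
      "\<And>n. f (x + T n *\<^sub>R v + T n *\<^sub>R u) - f (x + T n *\<^sub>R v) - f (x + T n *\<^sub>R u) + f x
        = (T n)\<^sup>2 * dderiv (\<lambda>y. dderiv f y v) (Y n) u"
    using key[OF T(1) sub(1)] by metis
  obtain Z where Z: "\<And>n. norm (Z n - x) \<le> T n * (norm u + norm v)"
      "\<And>n. f (x + T n *\<^sub>R u + T n *\<^sub>R v) - f (x + T n *\<^sub>R u) - f (x + T n *\<^sub>R v) + f x
        = (T n)\<^sup>2 * dderiv (\<lambda>y. dderiv f y u) (Z n) v"
    using key[OF T(1) sub(2)] by metis
  have "Y' \<longlonglongrightarrow> x" if "\<And>n. norm (Y' n - x) \<le> T n * c" for Y' c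
    unfolding Lim_null[of Y' x] by (rule Lim_null_comparison[OF always_eventually T0[of c]]) (use that in auto)
  then have "Y \<longlonglongrightarrow> x" "Z \<longlonglongrightarrow> x" using Y(1) Z(1) by blast+
  moreover have "dderiv (\<lambda>y. dderiv f y v) (Y n) u = dderiv (\<lambda>y. dderiv f y u) (Z n) v" for n
  proof -
    have "(T n)\<^sup>2 * dderiv (\<lambda>y. dderiv f y v) (Y n) u = (T n)\<^sup>2 * dderiv (\<lambda>y. dderiv f y u) (Z n) v"
      using Y(2)[of n] Z(2)[of n] by (simp add: algebra_simps)
    then show ?thesis using T(1)[of n] by simp
  qed
  ultimately show ?thesis
    using lim[of Y v u] lim[of Z u v] LIMSEQ_unique by simp
qed

lemma dderiv_symmetric:
  fixes f :: "'a::euclidean_space \<Rightarrow> 'b::euclidean_space"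
  assumes f: "C_inf_on U f" and x: "x \<in> U"
  shows "dderiv (\<lambda>y. dderiv f y v) x u = dderiv (\<lambda>y. dderiv f y u) x v"
proof (rule euclidean_eqI)
  fix b :: 'b
  have fb: "C_inf_on U (\<lambda>y. f y \<bullet> b)"
    by (rule C_inf_on_bounded_linear[OF bounded_linear_inner_left f])
  have 1: "dderiv (\<lambda>y. f y \<bullet> b) y v = dderiv f y v \<bullet> b" if "y \<in> U" for y v
    using dderiv_eq[OF bounded_linear.has_derivative[OF bounded_linear_inner_left C_inf_on_has_derivative[OF f that]]]
    by metis
  have 2: "dderiv (\<lambda>y. dderiv f y v) x u \<bullet> b = dderiv (\<lambda>y. dderiv (\<lambda>y. f y \<bullet> b) y v) x u" for u v
  proof -
    have "((\<lambda>y. dderiv f y v \<bullet> b) has_derivative (\<lambda>u. dderiv (\<lambda>y. dderiv f y v) x u \<bullet> b)) (at x)"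
      by (rule bounded_linear.has_derivative[OF bounded_linear_inner_left
          C_inf_on_has_derivative[OF C_inf_on_dderiv_const[OF f] x]])
    then have "((\<lambda>y. dderiv (\<lambda>y. f y \<bullet> b) y v) has_derivative (\<lambda>u. dderiv (\<lambda>y. dderiv f y v) x u \<bullet> b)) (at x)"
      by (rule has_derivative_transform_within_open) (use f x 1 in \<open>auto simp: C_inf_on_def\<close>)
    then show ?thesis by (simp add: dderiv_eq)
  qed
  show "dderiv (\<lambda>y. dderiv f y v) x u \<bullet> b = dderiv (\<lambda>y. dderiv f y u) x v \<bullet> b"
    unfolding 2 by (rule dderiv_symmetric_real[OF fb x])
qed

lemma C_k_on_real_SucI:
  fixes f :: "real \<Rightarrow> real"
  assumes "open U" "\<And>x. x \<in> U \<Longrightarrow> DERIV f x :> f' x" "C_k_on k f' U"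
  shows "C_k_on (Suc k) f U"
  by (rule C_k_on_SucI[where f' = "\<lambda>x v. f' x * v"])
    (use assms in \<open>auto simp: has_field_derivative_def\<close>)

text \<open>The function \<open>y = x^(-1/2)\<close> satisfies \<open>y' = - y^3 / 2\<close>, so its
  derivative is a polynomial in \<open>y\<close> and one induction gives all orders.\<close>

lemma C_inf_on_inverse_sqrt: "C_inf_on {0<..} (\<lambda>x::real. inverse (sqrt x))"
proof -
  have "C_k_on k (\<lambda>x::real. inverse (sqrt x)) {0<..}" for k
  proof (induction k)
    case 0
    show ?case by (auto intro!: continuous_intros)
  next
    case (Suc k)
    have "C_k_on k (\<lambda>x::real. (- 1/2) * (inverse (sqrt x) * (inverse (sqrt x) * inverse (sqrt x)))) {0<..}"
      by (intro C_k_on_bounded_linear[OF bounded_linear_mult_right]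
          C_k_on_bilinear[OF bounded_bilinear_mult] Suc) auto
    then show ?case
      by (rule C_k_on_real_SucI[rotated 2]) (auto intro!: derivative_eq_intros simp: field_simps)
  qed
  then show ?thesis by (auto simp: C_inf_on_def)
qed

section \<open>Calculus on \<open>S\<^sup>2 \<times> S\<^sup>2\<close>\<close>

type_synonym r33 = "(real^3) \<times> (real^3)"

lemma bounded_bilinear_cross3: "bounded_bilinear cross3"
  using bilinear_conv_bounded_bilinear bilinear_cross by blast

lemma cross_frame_expansion:
  fixes p m v :: "real^3"
  assumes "norm p = 1" "norm m = 1" "p \<bullet> m = 0"
  shows "v = (v \<bullet> p) *\<^sub>R p + (v \<bullet> m) *\<^sub>R m + (v \<bullet> cross3 p m) *\<^sub>R cross3 p m"
proof -
  let ?c = "cross3 p m"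
  define w where "w = v - ((v \<bullet> p) *\<^sub>R p + (v \<bullet> m) *\<^sub>R m + (v \<bullet> ?c) *\<^sub>R ?c)"
  have pp: "p \<bullet> p = 1" "m \<bullet> m = 1" "m \<bullet> p = 0"
    using assms by (auto simp: dot_square_norm inner_commute)
  have c1: "(norm ?c)\<^sup>2 = 1" using norm_cross_dot[of p m] assms by simp
  then have cc: "?c \<bullet> ?c = 1" by (simp add: dot_square_norm)
  have "?c \<bullet> p = 0" "?c \<bullet> m = 0" by (simp_all add: dot_cross_self inner_commute)
  then have w: "w \<bullet> p = 0" "w \<bullet> m = 0" "w \<bullet> ?c = 0"
    using pp assms cc unfolding w_def by (simp_all add: inner_simps inner_commute)
  \<comment> \<open>The remainder \<open>w\<close> is orthogonal to all three vectors. By the triple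
    product its cross product with the unit vector \<open>?c\<close> vanishes too, and Lagrange's
    identity leaves \<open>w = 0\<close>.\<close>
  have "cross3 ?c w = (p \<bullet> w) *\<^sub>R m - (m \<bullet> w) *\<^sub>R p"
    by (simp add: cross3_simps forall_3)
  then have "cross3 ?c w = 0" using w by (simp add: inner_commute)
  then have "(norm w)\<^sup>2 = 0"
    using norm_cross_dot[of ?c w] w c1 by (simp add: inner_commute power_mult_distrib)
  then show ?thesis by (simp add: w_def)
qed

lemma exists_unit_orthogonal:
  fixes q :: "real^3" obtains k where "norm k = 1" "q \<bullet> k = 0"
proof -
  obtain y where "y \<noteq> 0" "q \<bullet> y = 0"
    using orthogonal_to_vector_exists[of q] by (auto simp: orthogonal_def)
  then show thesis using that[of "y /\<^sub>R norm y"] by simp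
qed

section \<open>The normalising retraction and derivatives within the product of spheres\<close>

definition sphere_retract :: "r33 \<Rightarrow> r33" where
  "sphere_retract x = (inverse (norm (fst x)) *\<^sub>R fst x, inverse (norm (snd x)) *\<^sub>R snd x)"

definition off_axes :: "r33 set" where
  "off_axes = {x. fst x \<noteq> 0 \<and> snd x \<noteq> 0}"

lemma S2xS2_iff: "x \<in> S2xS2 \<longleftrightarrow> norm (fst x) = 1 \<and> norm (snd x) = 1"
  by (cases x) auto

lemma tangent_space_iff: "v \<in> tangent_space x \<longleftrightarrow> fst v \<bullet> fst x = 0 \<and> snd v \<bullet> snd x = 0"
  by (cases v) (auto simp: tangent_space_def)

lemma subspace_tangent_space: "subspace (tangent_space x)"
  by (auto simp: subspace_def tangent_space_iff inner_add_left)

lemma open_off_axes: "open off_axes"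
proof -
  have eq: "off_axes = (- {0}) \<times> (- {0})" by (auto simp: off_axes_def)
  show ?thesis unfolding eq by (intro open_Times open_Compl closed_singleton)
qed

lemma S2xS2_subset_off_axes: "S2xS2 \<subseteq> off_axes"
  by (auto simp: off_axes_def)

lemma sphere_retract_in: "x \<in> off_axes \<Longrightarrow> sphere_retract x \<in> S2xS2"
  by (auto simp: off_axes_def sphere_retract_def)

lemma sphere_retract_id: "x \<in> S2xS2 \<Longrightarrow> sphere_retract x = x"
  by (cases x) (auto simp: sphere_retract_def)

lemma sphere_retract_scale:
  "a > 0 \<Longrightarrow> b > 0 \<Longrightarrow> sphere_retract (a *\<^sub>R fst x, b *\<^sub>R snd x) = sphere_retract x"
  by (simp add: sphere_retract_def)

lemma C_inf_on_Pair:
  assumes "C_inf_on U f" "C_inf_on U g" shows "C_inf_on U (\<lambda>x. (f x, g x))"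
proof -
  have "bounded_linear (\<lambda>u::'b. (u, 0::'c))" "bounded_linear (\<lambda>u::'c. (0::'b, u))"
    by (auto intro: bounded_linear_Pair bounded_linear_ident bounded_linear_zero)
  then have "C_inf_on U (\<lambda>x. (f x, 0) + (0, g x))"
    using assms by (intro C_inf_on_add C_inf_on_bounded_linear[of "\<lambda>u. (u, 0)"]
      C_inf_on_bounded_linear[of "\<lambda>u. (0, u)"])
  then show ?thesis by simp
qed

lemma C_inf_on_fst: "C_inf_on U f \<Longrightarrow> C_inf_on U (\<lambda>x. fst (f x))"
  by (rule C_inf_on_bounded_linear[OF bounded_linear_fst])

lemma C_inf_on_snd: "C_inf_on U f \<Longrightarrow> C_inf_on U (\<lambda>x. snd (f x))"
  by (rule C_inf_on_bounded_linear[OF bounded_linear_snd])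

lemma C_inf_on_ident: "open U \<Longrightarrow> C_inf_on U (\<lambda>x. x)"
  by (rule C_inf_on_linear[OF bounded_linear_ident])

lemma C_inf_on_normalize:
  fixes f :: "r33 \<Rightarrow> real^3"
  assumes f: "C_inf_on U f" and nz: "\<And>x. x \<in> U \<Longrightarrow> f x \<noteq> 0"
  shows "C_inf_on U (\<lambda>x. inverse (norm (f x)) *\<^sub>R f x)"
proof -
  have "C_inf_on U (\<lambda>x. inverse (sqrt (f x \<bullet> f x)))"
    by (rule C_inf_on_compose[OF C_inf_on_inverse_sqrt C_inf_on_bilinear[OF bounded_bilinear_inner f f]])
      (use nz in auto)
  then show ?thesis
    by (intro C_inf_on_bilinear[OF bounded_bilinear_scaleR] f) (simp add: norm_eq_sqrt_inner)
qed

lemma C_inf_on_sphere_retract: "C_inf_on off_axes sphere_retract"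
  unfolding sphere_retract_def
  by (intro C_inf_on_Pair C_inf_on_normalize C_inf_on_fst C_inf_on_snd C_inf_on_ident open_off_axes)
    (auto simp: off_axes_def)

lemma normalize_has_derivative:
  fixes f :: "'a::real_normed_vector \<Rightarrow> real^3"
  assumes f: "(f has_derivative f') (at x)" and n: "norm (f x) = 1"
  shows "((\<lambda>y. inverse (norm (f y)) *\<^sub>R f y) has_derivative (\<lambda>v. f' v - (f' v \<bullet> f x) *\<^sub>R f x)) (at x)"
proof -
  have "f x \<noteq> 0" using n by auto
  then have "((\<lambda>y. norm (f y)) has_derivative (\<lambda>v. f' v \<bullet> f x)) (at x)"
    using has_derivative_compose[OF f has_derivative_norm] n by (simp add: sgn_div_norm)
  from Deriv.has_derivative_inverse[OF _ this]
  have "((\<lambda>y. inverse (norm (f y))) has_derivative (\<lambda>v. - (f' v \<bullet> f x))) (at x)"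
    using n by simp
  from has_derivative_scaleR[OF this f] show ?thesis using n by (simp add: algebra_simps)
qed

lemma sphere_retract_has_derivative:
  assumes "x \<in> S2xS2"
  shows "(sphere_retract has_derivative (\<lambda>v. (fst v - (fst v \<bullet> fst x) *\<^sub>R fst x,
      snd v - (snd v \<bullet> snd x) *\<^sub>R snd x))) (at x)"
  unfolding sphere_retract_def using assms
  by (intro has_derivative_Pair normalize_has_derivative has_derivative_fst has_derivative_snd
      has_derivative_ident) (auto simp: S2xS2_iff)

lemma dderiv_sphere_retract_tangent:
  "x \<in> S2xS2 \<Longrightarrow> v \<in> tangent_space x \<Longrightarrow> dderiv sphere_retract x v = v"
  by (simp add: dderiv_eq[OF sphere_retract_has_derivative] tangent_space_iff)

lemma dderiv_sphere_retract_in_tangent_space: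
  assumes x: "x \<in> off_axes" shows "dderiv sphere_retract x v \<in> tangent_space (sphere_retract x)"
proof -
  note d = C_inf_on_has_derivative[OF C_inf_on_sphere_retract x]
  have "((\<lambda>y. fst (sphere_retract y) \<bullet> fst (sphere_retract y)) has_derivative (\<lambda>v. 0)) (at x)"
    "((\<lambda>y. snd (sphere_retract y) \<bullet> snd (sphere_retract y)) has_derivative (\<lambda>v. 0)) (at x)"
    by (rule has_derivative_transform_within_open[OF has_derivative_const[of 1] open_off_axes x],
      use sphere_retract_in in \<open>auto simp: S2xS2_iff dot_square_norm\<close>)+
  moreover have "((\<lambda>y. fst (sphere_retract y) \<bullet> fst (sphere_retract y)) has_derivative
      (\<lambda>v. fst (sphere_retract x) \<bullet> fst (dderiv sphere_retract x v) + fst (dderiv sphere_retract x v) \<bullet> fst (sphere_retract x))) (at x)"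
    "((\<lambda>y. snd (sphere_retract y) \<bullet> snd (sphere_retract y)) has_derivative
      (\<lambda>v. snd (sphere_retract x) \<bullet> snd (dderiv sphere_retract x v) + snd (dderiv sphere_retract x v) \<bullet> snd (sphere_retract x))) (at x)"
    by (intro has_derivative_inner has_derivative_fst has_derivative_snd d)+
  ultimately have "fst (sphere_retract x) \<bullet> fst (dderiv sphere_retract x v) + fst (dderiv sphere_retract x v) \<bullet> fst (sphere_retract x) = 0"
    "snd (sphere_retract x) \<bullet> snd (dderiv sphere_retract x v) + snd (dderiv sphere_retract x v) \<bullet> snd (sphere_retract x) = 0"
    by (metis (no_types, lifting) has_derivative_unique)+
  then show ?thesis by (simp add: tangent_space_iff inner_commute)
qed

text \<open>A derivative within the product of spheres is free in the normal directions. For tangent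
  \<open>v\<close> the curve obtained by retracting \<open>x + t *\<^sub>R v\<close> stays in the
  product and has velocity \<open>v\<close> at time 0, so the chain rule fixes the value on
  \<open>v\<close>.\<close>

lemma tangent_derivative_unique:
  assumes x: "x \<in> S2xS2" and v: "v \<in> tangent_space x"
    and A: "(f has_derivative A) (at x within S2xS2)"
    and B: "(f has_derivative B) (at x within S2xS2)"
  shows "A v = B v"
proof -
  let ?c = "\<lambda>t::real. sphere_retract (x + t *\<^sub>R v)"
  have l: "((\<lambda>t::real. x + t *\<^sub>R v) has_derivative (\<lambda>t. t *\<^sub>R v)) (at 0)"
    by (auto intro!: derivative_eq_intros)
  have "((\<lambda>t. sphere_retract (x + t *\<^sub>R v)) has_derivative (\<lambda>t. dderiv sphere_retract x (t *\<^sub>R v))) (at 0)"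
    using has_derivative_compose[OF l, of sphere_retract] C_inf_on_has_derivative[OF C_inf_on_sphere_retract, of x]
      x S2xS2_subset_off_axes by auto
  moreover have "dderiv sphere_retract x (t *\<^sub>R v) = t *\<^sub>R v" for t
    using dderiv_sphere_retract_tangent[OF x] v subspace_scale[OF subspace_tangent_space] by blast
  ultimately have c: "(?c has_derivative (\<lambda>t. t *\<^sub>R v)) (at 0 within UNIV)" by simp
  have "open ((\<lambda>t::real. x + t *\<^sub>R v) -` off_axes)"
    by (intro open_vimage open_off_axes continuous_intros)
  moreover have "0 \<in> (\<lambda>t::real. x + t *\<^sub>R v) -` off_axes"
    using x S2xS2_subset_off_axes by auto
  ultimately obtain T where T: "open T" "0 \<in> T" "\<And>t. t \<in> T \<Longrightarrow> ?c t \<in> S2xS2"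
    using sphere_retract_in by (metis vimage_eq)
  have c': "(?c has_derivative (\<lambda>t. t *\<^sub>R v)) (at 0 within T)"
    using c has_derivative_subset by blast
  have x0: "?c 0 = x" using sphere_retract_id[OF x] by simp
  have sub: "?c ` T \<subseteq> S2xS2" using T(3) by blast
  have "((f \<circ> ?c) has_derivative (A \<circ> (\<lambda>t. t *\<^sub>R v))) (at 0 within T)"
    by (rule diff_chain_within[OF c']) (use has_derivative_subset[OF A sub] x0 in simp)
  moreover have "((f \<circ> ?c) has_derivative (B \<circ> (\<lambda>t. t *\<^sub>R v))) (at 0 within T)"
    by (rule diff_chain_within[OF c']) (use has_derivative_subset[OF B sub] x0 in simp)
  ultimately have eq: "A \<circ> (\<lambda>t. t *\<^sub>R v) = B \<circ> (\<lambda>t. t *\<^sub>R v)"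
    unfolding at_within_open[OF T(2,1)] by (rule has_derivative_unique)
  show ?thesis using fun_cong[OF eq, of 1] by simp
qed

text \<open>The means of differentiating an identity that holds only at points of the product of
  spheres, and there only near \<open>x\<close>.\<close>

lemma tangent_derivative_eq:
  assumes W: "open W" and x: "x \<in> S2xS2" "x \<in> W" and v: "v \<in> tangent_space x"
    and eq: "\<And>y. y \<in> W \<Longrightarrow> y \<in> S2xS2 \<Longrightarrow> f y = g y"
    and A: "(f has_derivative A) (at x within S2xS2)"
    and B: "(g has_derivative B) (at x within S2xS2)"
  shows "A v = B v"
proof (rule tangent_derivative_unique[OF x(1) v A])
  obtain d where "d > 0" "ball x d \<subseteq> W" using W x(2) open_contains_ball by blast
  then show "(f has_derivative B) (at x within S2xS2)"
    using has_derivative_transform_within[OF B, of d f] eq x(1)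
    by (metis dist_commute mem_ball subset_iff)
qed

lemma differential_eq:
  assumes "x \<in> S2xS2" "v \<in> tangent_space x" "(f has_derivative A) (at x)"
    and "\<And>y. y \<in> S2xS2 \<Longrightarrow> F y = f y"
  shows "differential F x v = A v"
proof -
  have A: "(F has_derivative A) (at x within S2xS2)"
    by (rule has_derivative_transform[OF assms(1) _ has_derivative_at_withinI[OF assms(3)]])
      (use assms(4) in auto)
  then have "(F has_derivative differential F x) (at x within S2xS2)"
    unfolding differential_def using frechet_derivative_works differentiable_def by blast
  then show ?thesis using tangent_derivative_unique[OF assms(1,2)] A by blast
qed

lemma gradient_eqI:
  assumes "w \<in> tangent_space x" "\<And>v. v \<in> tangent_space x \<Longrightarrow> w \<bullet> v = differential F x v"
  shows "gradient F x = w"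
  unfolding gradient_def
proof (rule the_equality)
  show "w \<in> tangent_space x \<and> (\<forall>v\<in>tangent_space x. w \<bullet> v = differential F x v)"
    using assms by blast
  fix u assume u: "u \<in> tangent_space x \<and> (\<forall>v\<in>tangent_space x. u \<bullet> v = differential F x v)"
  then have "u - w \<in> tangent_space x" using assms(1) subspace_diff[OF subspace_tangent_space] by blast
  then have "(u - w) \<bullet> (u - w) = 0"
    using u assms(2) by (simp add: inner_diff_left)
  then show "u = w" by simp
qed

section \<open>Flat gradients, traces and explicit tangent frames\<close>

definition flat_grad :: "('a::euclidean_space \<Rightarrow> real) \<Rightarrow> 'a \<Rightarrow> 'a" where
  "flat_grad h x = (\<Sum>b\<in>Basis. dderiv h x b *\<^sub>R b)"

lemma flat_grad_inner: "linear (dderiv h x) \<Longrightarrow> flat_grad h x \<bullet> v = dderiv h x v"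
  using linear_euclidean_expansion[of "dderiv h x" v]
  by (simp add: flat_grad_def inner_sum_left inner_commute[of v] mult.commute)

lemma C_inf_on_flat_grad: "C_inf_on U h \<Longrightarrow> C_inf_on U (flat_grad h)"
  unfolding flat_grad_def
  by (intro C_inf_on_sum C_inf_on_bilinear[OF bounded_bilinear_scaleR] C_inf_on_dderiv_const
      C_inf_on_const) (auto simp: C_inf_on_def)

lemma orthonormal_basis_finite:
  fixes B :: "'a::euclidean_space set"
  assumes "orthonormal_basis V B" shows "finite B"
  using assms pairwise_orthogonal_independent[of B] independent_imp_finite
  unfolding orthonormal_basis_def by fastforce

text \<open>Needed because \<open>divergence\<close> takes an arbitrary basis through
  \<open>SOME\<close>. Each vector of one basis is expanded in the other and the two sums are
  exchanged; \<open>L\<close> may leave \<open>V\<close>, since only inner products with vectors of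
  \<open>V\<close> enter.\<close>

lemma trace_orthonormal_basis:
  fixes L :: "'a::euclidean_space \<Rightarrow> 'a"
  assumes L: "linear L" and B: "orthonormal_basis V B" and C: "orthonormal_basis V C"
  shows "(\<Sum>e\<in>B. L e \<bullet> e) = (\<Sum>e\<in>C. L e \<bullet> e)"
proof -
  have ex: "(\<Sum>b\<in>B. (b \<bullet> x) *\<^sub>R b) = x"
    if "orthonormal_basis V B" "x \<in> V" for B and x :: 'a
    using that orthonormal_basis_expand[of B x] orthonormal_basis_finite[OF that(1)]
    by (simp add: orthonormal_basis_def inner_commute)
  have sub: "B \<subseteq> V" "C \<subseteq> V"
    using B C span_superset unfolding orthonormal_basis_def by blast+
  have "(\<Sum>e\<in>B. L e \<bullet> e) = (\<Sum>e\<in>B. L e \<bullet> (\<Sum>a\<in>C. (a \<bullet> e) *\<^sub>R a))"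
    using ex[OF C] sub by (intro sum.cong) auto
  also have "\<dots> = (\<Sum>a\<in>C. \<Sum>e\<in>B. (a \<bullet> e) * (L e \<bullet> a))"
    by (simp add: inner_sum_right sum.swap[of _ C B])
  also have "\<dots> = (\<Sum>a\<in>C. L (\<Sum>e\<in>B. (e \<bullet> a) *\<^sub>R e) \<bullet> a)"
    by (simp add: linear_sum[OF L] linear_scale[OF L] inner_sum_left inner_commute[of "_ :: 'a" "_ :: 'a"] inner_sum_right mult.commute)
  also have "\<dots> = (\<Sum>a\<in>C. L a \<bullet> a)"
    using ex[OF B] sub by (intro sum.cong) auto
  finally show ?thesis .
qed

definition tangent_frame :: "r33 \<Rightarrow> real^3 \<Rightarrow> real^3 \<Rightarrow> r33 set" where
  "tangent_frame x m k = {(m, 0), (cross3 (fst x) m, 0), (0, k), (0, cross3 (snd x) k)}"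

lemma tangent_frame_facts:
  fixes m k :: "real^3"
  assumes x: "x \<in> S2xS2" and m: "norm m = 1" "fst x \<bullet> m = 0" and k: "norm k = 1" "snd x \<bullet> k = 0"
  shows "orthonormal_basis (tangent_space x) (tangent_frame x m k)"
    and "(\<Sum>e\<in>tangent_frame x m k. h e) =
      h (m, 0) + h (cross3 (fst x) m, 0) + h (0, k) + h (0, cross3 (snd x) k)"
proof -
  let ?c = "cross3 (fst x) m" and ?d = "cross3 (snd x) k"
  have c: "norm ?c = 1" "m \<bullet> ?c = 0" "?c \<bullet> fst x = 0" and d: "norm ?d = 1" "k \<bullet> ?d = 0" "?d \<bullet> snd x = 0"
    using norm_cross_dot[of "fst x" m] norm_cross_dot[of "snd x" k] x m k
    by (simp_all add: S2xS2_iff dot_cross_self inner_commute power2_eq_1_iff)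
      (metis norm_ge_zero zero_le_square not_one_le_zero neg_0_le_iff_le order.trans zero_le_one)+
  \<comment> \<open>The frame is a set, so its four members have to be distinct before a sum over it
    splits into four terms.\<close>
  have z: "m \<noteq> 0" "k \<noteq> 0" "?c \<noteq> 0" "?d \<noteq> 0" "m \<noteq> ?c" "k \<noteq> ?d"
    using c d m k by auto
  have "span (tangent_frame x m k) = tangent_space x"
  proof
    show "span (tangent_frame x m k) \<subseteq> tangent_space x"
      by (rule span_minimal[OF _ subspace_tangent_space])
        (use c d m k in \<open>auto simp: tangent_frame_def tangent_space_iff inner_commute\<close>)
    show "tangent_space x \<subseteq> span (tangent_frame x m k)"
    proof
      fix v assume v: "v \<in> tangent_space x"
      have "v = (fst v \<bullet> m) *\<^sub>R (m, 0) + (fst v \<bullet> ?c) *\<^sub>R (?c, 0) + ((snd v \<bullet> k) *\<^sub>R (0, k) + (snd v \<bullet> ?d) *\<^sub>R (0, ?d))"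
        using cross_frame_expansion[of "fst x" m "fst v"] cross_frame_expansion[of "snd x" k "snd v"]
          v x m k by (auto simp: prod_eq_iff tangent_space_iff S2xS2_iff)
      then show "v \<in> span (tangent_frame x m k)"
        by (metis (no_types, lifting) insertCI span_add span_base span_scale tangent_frame_def)
    qed
  qed
  then show "orthonormal_basis (tangent_space x) (tangent_frame x m k)"
    using c d m k
    by (auto simp: orthonormal_basis_def tangent_frame_def pairwise_def orthogonal_def inner_commute norm_Pair)
  show "(\<Sum>e\<in>tangent_frame x m k. h e) = h (m, 0) + h (?c, 0) + h (0, k) + h (0, ?d)"
    using z by (simp add: tangent_frame_def add.assoc)
qed

section \<open>Isoparametric functions\<close>

lemma orthonormal_basis_sum_squares:
  fixes y :: "'a::euclidean_space"
  assumes B: "orthonormal_basis V B" and y: "y \<in> V"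
  shows "(\<Sum>e\<in>B. (y \<bullet> e) * (y \<bullet> e)) = y \<bullet> y"
proof -
  have "(\<Sum>e\<in>B. (e \<bullet> y) *\<^sub>R e) = y"
    using B y orthonormal_basis_expand[of B y] orthonormal_basis_finite[OF B]
    by (simp add: orthonormal_basis_def inner_commute)
  then have "y \<bullet> (\<Sum>e\<in>B. (e \<bullet> y) *\<^sub>R e) = y \<bullet> y" by simp
  then show ?thesis by (simp add: inner_sum_right inner_commute)
qed

lemma smooth_on_UNIV_C_inf_on:
  assumes "smooth_on UNIV f" shows "C_inf_on UNIV f"
proof (rule C_inf_on_locally)
  fix x
  obtain U G where U: "open U" "x \<in> U" "\<forall>k. C_k_on k G U" "\<forall>y\<in>U. G y = f y"
    using assms unfolding smooth_on_def by (metis IntI UNIV_I)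
  then have "C_inf_on U f"
    using C_inf_on_cong[of U G f] by (simp add: C_inf_on_def)
  then show "\<exists>V. x \<in> V \<and> C_inf_on V f" using U by blast
qed simp

locale isoparametric =
  fixes F :: "r33 \<Rightarrow> real" and f g :: "real \<Rightarrow> real"
  assumes smooth_F: "smooth_on S2xS2 F"
    and smooth_f: "smooth_on UNIV f" and smooth_g: "smooth_on UNIV g"
    and gradient_sq: "\<And>x. x \<in> S2xS2 \<Longrightarrow> (norm (gradient F x))\<^sup>2 = f (F x)"
    and laplacian: "\<And>x. x \<in> S2xS2 \<Longrightarrow> laplacian F x = g (F x)"
begin

text \<open>The extension of \<open>F\<close> that is constant along radii: its flat gradient is tangent to the spheres, and
  its flat Hessian restricts to the Riemannian one.\<close>
definition Ft :: "r33 \<Rightarrow> real" where "Ft x = F (sphere_retract x)"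

definition G :: "r33 \<Rightarrow> r33" where "G = flat_grad Ft"

definition J :: "real set" where "J = {s. f s > 0}"

text \<open>An open set of R^6 containing the regular points, on which the normal field is a smooth
  map in the flat sense.\<close>

definition \<Omega> :: "r33 set" where "\<Omega> = {x \<in> off_axes. f (Ft x) > 0}"

definition reg :: "r33 set" where "reg = \<Omega> \<inter> S2xS2"

definition \<phi> :: "real \<Rightarrow> real" where "\<phi> s = inverse (sqrt (f s))"

text \<open>A unit field only on \<open>reg\<close>: away from the product of spheres the two
  components of \<open>G\<close> scale inversely to the two radii. Hence identities resting on the
  unit length are differentiated in tangent directions only.\<close>

definition N :: "r33 \<Rightarrow> r33" where "N x = \<phi> (Ft x) *\<^sub>R G x"

abbreviation "N1 x \<equiv> fst (N x)"

abbreviation "N2 x \<equiv> snd (N x)"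

abbreviation "W1 x \<equiv> cross3 (fst x) (N1 x)"

abbreviation "W2 x \<equiv> cross3 (snd x) (N2 x)"

definition DN :: "r33 \<Rightarrow> r33 \<Rightarrow> r33" where "DN x = dderiv N x"

lemma f_smooth: "C_inf_on UNIV f" and g_smooth: "C_inf_on UNIV g"
  using smooth_f smooth_g by (auto intro: smooth_on_UNIV_C_inf_on)

lemma Ft_eq: "x \<in> S2xS2 \<Longrightarrow> Ft x = F x"
  by (simp add: Ft_def sphere_retract_id)

lemma Ft_retract: "x \<in> off_axes \<Longrightarrow> Ft (sphere_retract x) = Ft x"
  using sphere_retract_id[OF sphere_retract_in] by (simp add: Ft_def)

lemma Ft_smooth: "C_inf_on off_axes Ft"
proof (rule C_inf_on_locally[OF open_off_axes])
  fix x assume x: "x \<in> off_axes"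
  obtain U h where U: "open U" "sphere_retract x \<in> U" "\<forall>k. C_k_on k h U" "\<forall>y\<in>U \<inter> S2xS2. h y = F y"
    using bspec[OF smooth_F[unfolded smooth_on_def] sphere_retract_in[OF x]] by auto
  define V where "V = off_axes \<inter> sphere_retract -` U"
  have "open V" unfolding V_def
    using C_inf_on_continuous_on[OF C_inf_on_sphere_retract] open_off_axes U(1)
    by (simp add: continuous_on_open_vimage Int_commute)
  then have r: "C_inf_on V sphere_retract"
    using C_inf_on_subset[OF C_inf_on_sphere_retract, of V] by (auto simp: V_def)
  have "C_inf_on V (\<lambda>y. h (sphere_retract y))"
    by (rule C_inf_on_compose[OF _ r, of U]) (use U in \<open>auto simp: C_inf_on_def V_def\<close>)
  then have "C_inf_on V Ft"
    by (rule iffD1[OF C_inf_on_cong, rotated])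
      (use U(4) sphere_retract_in in \<open>auto simp: V_def Ft_def\<close>)
  then show "\<exists>V. x \<in> V \<and> C_inf_on V Ft" using x U(2) by (intro exI[of _ V]) (auto simp: V_def)
qed

lemma open_J: "open J"
  unfolding J_def using C_inf_on_continuous_on[OF f_smooth]
  by (intro open_Collect_less) auto

lemma open_\<Omega>: "open \<Omega>"
proof -
  have "\<Omega> = Ft -` J \<inter> off_axes" by (auto simp: \<Omega>_def J_def)
  then show ?thesis
    using continuous_on_open_vimage[OF open_off_axes] C_inf_on_continuous_on[OF Ft_smooth] open_J
    by metis
qed

lemma \<Omega>_subset: "\<Omega> \<subseteq> off_axes"
  by (auto simp: \<Omega>_def)

lemma regD: "x \<in> reg \<Longrightarrow> x \<in> \<Omega>" "x \<in> reg \<Longrightarrow> x \<in> S2xS2" "x \<in> reg \<Longrightarrow> x \<in> off_axes"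
  by (auto simp: reg_def \<Omega>_def)

lemma Ft_derivative: "x \<in> off_axes \<Longrightarrow> (Ft has_derivative dderiv Ft x) (at x)"
  by (rule C_inf_on_has_derivative[OF Ft_smooth])

lemma G_smooth: "C_inf_on off_axes G"
  unfolding G_def by (rule C_inf_on_flat_grad[OF Ft_smooth])

lemma G_inner: "x \<in> off_axes \<Longrightarrow> G x \<bullet> v = dderiv Ft x v"
  unfolding G_def by (rule flat_grad_inner[OF C_inf_on_linear_dderiv[OF Ft_smooth]])

lemma DG_symmetric: "x \<in> off_axes \<Longrightarrow> dderiv G x u \<bullet> v = dderiv G x v \<bullet> u"
proof -
  assume x: "x \<in> off_axes"
  have "dderiv G x u \<bullet> v = dderiv (\<lambda>y. dderiv Ft y v) x u" for u v
  proof -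
    have "((\<lambda>y. G y \<bullet> v) has_derivative (\<lambda>u. dderiv G x u \<bullet> v)) (at x)"
      by (rule bounded_linear.has_derivative[OF bounded_linear_inner_left C_inf_on_has_derivative[OF G_smooth x]])
    then have "((\<lambda>y. dderiv Ft y v) has_derivative (\<lambda>u. dderiv G x u \<bullet> v)) (at x)"
      by (rule has_derivative_transform_within_open[OF _ open_off_axes x]) (rule G_inner)
    then show ?thesis by (simp add: dderiv_eq)
  qed
  then show ?thesis using dderiv_symmetric_real[OF Ft_smooth x] by simp
qed

lemma G_orthogonal_radial:
  assumes x: "x \<in> off_axes" shows "fst (G x) \<bullet> fst x = 0" "snd (G x) \<bullet> snd x = 0"
proof -
  note C = Ft_derivative[OF x]
  have l: "((\<lambda>t::real. (t *\<^sub>R fst x, snd x)) has_derivative (\<lambda>t. (t *\<^sub>R fst x, 0))) (at 1)"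
    "((\<lambda>t::real. (fst x, t *\<^sub>R snd x)) has_derivative (\<lambda>t. (0, t *\<^sub>R snd x))) (at 1)"
    by (auto intro!: derivative_eq_intros)
  have "((\<lambda>t::real. Ft (t *\<^sub>R fst x, snd x)) has_derivative (\<lambda>t. dderiv Ft x (t *\<^sub>R fst x, 0))) (at 1)"
    "((\<lambda>t::real. Ft (fst x, t *\<^sub>R snd x)) has_derivative (\<lambda>t. dderiv Ft x (0, t *\<^sub>R snd x))) (at 1)"
    using has_derivative_compose[OF l(1), of Ft] has_derivative_compose[OF l(2), of Ft] C by auto
  moreover have "((\<lambda>t::real. Ft (t *\<^sub>R fst x, snd x)) has_derivative (\<lambda>t. 0)) (at 1)"
    "((\<lambda>t::real. Ft (fst x, t *\<^sub>R snd x)) has_derivative (\<lambda>t. 0)) (at 1)"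
    by (rule has_derivative_transform_within_open[OF has_derivative_const[of "Ft x"], of "{0<..}"];
      use sphere_retract_scale[of _ 1 x] sphere_retract_scale[of 1 _ x] in \<open>simp add: Ft_def\<close>)+
  ultimately have "dderiv Ft x (1 *\<^sub>R fst x, 0) = 0" "dderiv Ft x (0, 1 *\<^sub>R snd x) = 0"
    by (metis (no_types, lifting) has_derivative_unique)+
  then show "fst (G x) \<bullet> fst x = 0" "snd (G x) \<bullet> snd x = 0"
    using G_inner[OF x, of "(fst x, 0)"] G_inner[OF x, of "(0, snd x)"] by (auto simp: inner_prod_def)
qed

lemma gradient_eq: assumes x: "x \<in> S2xS2" shows "gradient F x = G x"
proof (rule gradient_eqI)
  have o: "x \<in> off_axes" using x S2xS2_subset_off_axes by blast
  show "G x \<in> tangent_space x"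
    using G_orthogonal_radial[OF o] by (simp add: tangent_space_iff)
  fix v assume v: "v \<in> tangent_space x"
  show "G x \<bullet> v = differential F x v"
    using differential_eq[OF x v Ft_derivative[OF o]] G_inner[OF o] Ft_eq by simp
qed

lemma G_norm: "x \<in> S2xS2 \<Longrightarrow> G x \<bullet> G x = f (F x)"
  using gradient_sq[of x] gradient_eq[of x] by (simp add: dot_square_norm)

lemma G_trace:
  assumes x: "x \<in> S2xS2" and B: "orthonormal_basis (tangent_space x) B"
  shows "(\<Sum>e\<in>B. dderiv G x e \<bullet> e) = g (F x)"
proof -
  have o: "x \<in> off_axes" using x S2xS2_subset_off_axes by blast
  let ?C = "SOME B. orthonormal_basis (tangent_space x) B"
  have C: "orthonormal_basis (tangent_space x) ?C" using B by (rule someI)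
  then have sub: "?C \<subseteq> tangent_space x" unfolding orthonormal_basis_def using span_superset by blast
  have "g (F x) = (\<Sum>e\<in>?C. differential (gradient F) x e \<bullet> e)"
    using laplacian[OF x] by (simp add: laplacian_def divergence_def)
  also have "\<dots> = (\<Sum>e\<in>?C. dderiv G x e \<bullet> e)"
  proof (intro sum.cong refl)
    fix e assume "e \<in> ?C"
    then have "e \<in> tangent_space x" using sub by blast
    from differential_eq[OF x this C_inf_on_has_derivative[OF G_smooth o] gradient_eq]
    show "differential (gradient F) x e \<bullet> e = dderiv G x e \<bullet> e" by simp
  qed
  also have "\<dots> = (\<Sum>e\<in>B. dderiv G x e \<bullet> e)"
    by (rule trace_orthonormal_basis[OF C_inf_on_linear_dderiv[OF G_smooth o] C B])
  finally show ?thesis by simp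
qed

lemma \<phi>_smooth: "C_inf_on J \<phi>"
proof -
  have "C_inf_on J f" using C_inf_on_subset[OF f_smooth open_J] by simp
  then show ?thesis unfolding \<phi>_def
    by (rule C_inf_on_compose[OF C_inf_on_inverse_sqrt]) (auto simp: J_def)
qed

lemma Ft_smooth_\<Omega>: "C_inf_on \<Omega> Ft"
  by (rule C_inf_on_subset[OF Ft_smooth open_\<Omega> \<Omega>_subset])

lemma G_smooth_\<Omega>: "C_inf_on \<Omega> G"
  by (rule C_inf_on_subset[OF G_smooth open_\<Omega> \<Omega>_subset])

lemma Ft_J: "x \<in> \<Omega> \<Longrightarrow> Ft x \<in> J"
  by (simp add: \<Omega>_def J_def)

lemma N_smooth: "C_inf_on \<Omega> N"
  unfolding N_def
  by (intro C_inf_on_bilinear[OF bounded_bilinear_scaleR] C_inf_on_compose[OF \<phi>_smooth]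
      Ft_smooth_\<Omega> G_smooth_\<Omega>) (use Ft_J in auto)

lemma N_derivative: "x \<in> \<Omega> \<Longrightarrow> (N has_derivative DN x) (at x)"
  unfolding DN_def by (rule C_inf_on_has_derivative[OF N_smooth])

lemma DN_linear: "x \<in> \<Omega> \<Longrightarrow> linear (DN x)"
  using N_derivative has_derivative_linear by blast

text \<open>The derivative of the scalar factor contributes a rank one term along
  \<open>G x\<close>, which is symmetric; so \<open>DN x\<close> inherits the symmetry of the
  Hessian.\<close>

lemma DN_expand:
  assumes x: "x \<in> \<Omega>"
  shows "DN x v = \<phi> (Ft x) *\<^sub>R dderiv G x v + (dderiv \<phi> (Ft x) 1 * (G x \<bullet> v)) *\<^sub>R G x"
proof -
  have o: "x \<in> off_axes" using x \<Omega>_subset by blast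
  have d: "((\<lambda>y. \<phi> (Ft y)) has_derivative (\<lambda>v. dderiv \<phi> (Ft x) (dderiv Ft x v))) (at x)"
    by (rule has_derivative_compose[OF Ft_derivative[OF o] C_inf_on_has_derivative[OF \<phi>_smooth Ft_J[OF x]]])
  have "(\<lambda>v. dderiv \<phi> (Ft x) (dderiv Ft x v)) = (\<lambda>v. dderiv \<phi> (Ft x) 1 * dderiv Ft x v)"
  proof (rule ext)
    fix v show "dderiv \<phi> (Ft x) (dderiv Ft x v) = dderiv \<phi> (Ft x) 1 * dderiv Ft x v"
      using linear_scale[OF C_inf_on_linear_dderiv[OF \<phi>_smooth Ft_J[OF x]], of "dderiv Ft x v" 1] by simp
  qed
  from has_derivative_eq_rhs[OF d this]
  have "((\<lambda>y. \<phi> (Ft y)) has_derivative (\<lambda>v. dderiv \<phi> (Ft x) 1 * dderiv Ft x v)) (at x)" .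
  from has_derivative_scaleR[OF this C_inf_on_has_derivative[OF G_smooth o]]
  have "(N has_derivative (\<lambda>v. \<phi> (Ft x) *\<^sub>R dderiv G x v + (dderiv \<phi> (Ft x) 1 * dderiv Ft x v) *\<^sub>R G x)) (at x)"
    by (simp add: N_def[abs_def])
  then show ?thesis unfolding DN_def by (simp add: dderiv_eq G_inner[OF o])
qed

lemma DN_symmetric: "x \<in> \<Omega> \<Longrightarrow> DN x u \<bullet> v = DN x v \<bullet> u"
  using DG_symmetric[of x u v] \<Omega>_subset by (auto simp: DN_expand inner_add_left)

lemma N_orthogonal_radial: "x \<in> \<Omega> \<Longrightarrow> N1 x \<bullet> fst x = 0" "x \<in> \<Omega> \<Longrightarrow> N2 x \<bullet> snd x = 0"
  using G_orthogonal_radial[of x] \<Omega>_subset by (auto simp: N_def)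

lemma N_tangent: "x \<in> \<Omega> \<Longrightarrow> N x \<in> tangent_space x"
  by (simp add: tangent_space_iff N_orthogonal_radial)

lemma \<phi>_square: "s \<in> J \<Longrightarrow> \<phi> s * \<phi> s * f s = 1"
  by (auto simp: \<phi>_def J_def field_simps)

lemma N_unit: "x \<in> reg \<Longrightarrow> N x \<bullet> N x = 1"
  using \<phi>_square[OF Ft_J[of x]] G_norm[of x] regD[of x] by (simp add: N_def Ft_eq)

lemma dFt: "x \<in> \<Omega> \<Longrightarrow> dderiv Ft x v = sqrt (f (Ft x)) * (N x \<bullet> v)"
  using G_inner[of x v] \<Omega>_subset Ft_J[of x] by (auto simp: N_def \<phi>_def J_def)

text \<open>The divergence of the unit normal as a function of the level: \<open>\<phi>\<close>
  times the Laplacian plus \<open>\<phi>'\<close> times the squared length of the gradient.\<close>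

definition \<eta> :: "real \<Rightarrow> real" where "\<eta> s = \<phi> s * g s + dderiv \<phi> s 1 * f s"

lemma \<eta>_smooth: "C_inf_on J \<eta>"
  unfolding \<eta>_def
  by (intro C_inf_on_add C_inf_on_bilinear[OF bounded_bilinear_mult] \<phi>_smooth C_inf_on_dderiv_const
      C_inf_on_subset[OF f_smooth open_J] C_inf_on_subset[OF g_smooth open_J]) auto

lemma N_trace:
  assumes x: "x \<in> reg" and m: "norm m = 1" "fst x \<bullet> m = 0" and k: "norm k = 1" "snd x \<bullet> k = 0"
  shows "DN x (m, 0) \<bullet> (m, 0) + DN x (cross3 (fst x) m, 0) \<bullet> (cross3 (fst x) m, 0)
    + DN x (0, k) \<bullet> (0, k) + DN x (0, cross3 (snd x) k) \<bullet> (0, cross3 (snd x) k) = \<eta> (F x)"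
proof -
  let ?B = "tangent_frame x m k"
  note t = tangent_frame_facts[OF regD(2)[OF x] m k]
  have Gt: "G x \<in> tangent_space x"
    using G_orthogonal_radial[OF regD(3)[OF x]] by (simp add: tangent_space_iff)
  have "(\<Sum>e\<in>?B. DN x e \<bullet> e) = (\<Sum>e\<in>?B. \<phi> (F x) * (dderiv G x e \<bullet> e) + dderiv \<phi> (F x) 1 * ((G x \<bullet> e) * (G x \<bullet> e)))"
    using DN_expand[OF regD(1)[OF x]] by (simp add: inner_add_left Ft_eq[OF regD(2)[OF x]] mult.assoc)
  also have "\<dots> = \<phi> (F x) * (\<Sum>e\<in>?B. dderiv G x e \<bullet> e) + dderiv \<phi> (F x) 1 * (\<Sum>e\<in>?B. (G x \<bullet> e) * (G x \<bullet> e))"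
    by (simp add: sum.distrib sum_distrib_left)
  also have "\<dots> = \<eta> (F x)"
    unfolding G_trace[OF regD(2)[OF x] t(1)] orthonormal_basis_sum_squares[OF t(1) Gt]
      G_norm[OF regD(2)[OF x]] \<eta>_def ..
  finally show ?thesis by (simp add: t(2))
qed

section \<open>The two components of the normal and the geodesic property\<close>

definition r1 :: "r33 \<Rightarrow> real" where "r1 x = N1 x \<bullet> N1 x"

definition r2 :: "r33 \<Rightarrow> real" where "r2 x = N2 x \<bullet> N2 x"

lemma r_sum: "x \<in> reg \<Longrightarrow> r1 x + r2 x = 1"
  using N_unit[of x] by (simp add: r1_def r2_def inner_prod_def)

lemma N_fst_derivative: "x \<in> \<Omega> \<Longrightarrow> ((\<lambda>y. N1 y) has_derivative (\<lambda>v. fst (DN x v))) (at x)"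
  and N_snd_derivative: "x \<in> \<Omega> \<Longrightarrow> ((\<lambda>y. N2 y) has_derivative (\<lambda>v. snd (DN x v))) (at x)"
  by (auto intro: has_derivative_fst has_derivative_snd N_derivative)

lemma r1_derivative: "x \<in> \<Omega> \<Longrightarrow> (r1 has_derivative (\<lambda>v. 2 * (fst (DN x v) \<bullet> N1 x))) (at x)"
  and r2_derivative: "x \<in> \<Omega> \<Longrightarrow> (r2 has_derivative (\<lambda>v. 2 * (snd (DN x v) \<bullet> N2 x))) (at x)"
  unfolding r1_def[abs_def] r2_def[abs_def]
  by (rule has_derivative_eq_rhs[OF has_derivative_inner[OF N_fst_derivative N_fst_derivative]]
      has_derivative_eq_rhs[OF has_derivative_inner[OF N_snd_derivative N_snd_derivative]];
      simp add: fun_eq_iff inner_commute)+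

lemma DN_radial:
  assumes x: "x \<in> \<Omega>"
  shows "fst (DN x v) \<bullet> fst x = - (N1 x \<bullet> fst v)" "snd (DN x v) \<bullet> snd x = - (N2 x \<bullet> snd v)"
proof -
  have d: "((\<lambda>y. N1 y \<bullet> fst y) has_derivative (\<lambda>v. N1 x \<bullet> fst v + fst (DN x v) \<bullet> fst x)) (at x)"
    "((\<lambda>y. N2 y \<bullet> snd y) has_derivative (\<lambda>v. N2 x \<bullet> snd v + snd (DN x v) \<bullet> snd x)) (at x)"
    by (intro has_derivative_inner N_fst_derivative N_snd_derivative x has_derivative_fst has_derivative_snd
        has_derivative_ident)+
  have "((\<lambda>y. N1 y \<bullet> fst y) has_derivative (\<lambda>v. 0)) (at x)"
    "((\<lambda>y. N2 y \<bullet> snd y) has_derivative (\<lambda>v. 0)) (at x)"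
    by (rule has_derivative_transform_within_open[OF has_derivative_const[of 0] open_\<Omega> x],
      use N_orthogonal_radial in auto)+
  then have "N1 x \<bullet> fst v + fst (DN x v) \<bullet> fst x = 0" "N2 x \<bullet> snd v + snd (DN x v) \<bullet> snd x = 0"
    using d by (metis (no_types, lifting) has_derivative_unique)+
  then show "fst (DN x v) \<bullet> fst x = - (N1 x \<bullet> fst v)" "snd (DN x v) \<bullet> snd x = - (N2 x \<bullet> snd v)"
    by linarith+
qed

lemma N_DN:
  assumes x: "x \<in> reg" and v: "v \<in> tangent_space x" shows "N x \<bullet> DN x v = 0"
proof -
  have "((\<lambda>y. N y \<bullet> N y) has_derivative (\<lambda>v. N x \<bullet> DN x v + DN x v \<bullet> N x)) (at x)"
    by (intro has_derivative_inner N_derivative regD x)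
  from tangent_derivative_eq[OF open_\<Omega> regD(2)[OF x] regD(1)[OF x] v _ has_derivative_at_withinI[OF this]
      has_derivative_const[of 1]]
  have "N x \<bullet> DN x v + DN x v \<bullet> N x = 0" using N_unit by (auto simp: reg_def)
  then show ?thesis by (simp add: inner_commute)
qed

text \<open>The integral curves of \<open>N\<close> are geodesics: their acceleration is radial in
  each factor. For the tangential part \<open>w\<close>, symmetry of \<open>DN x\<close> gives
  \<open>DN x (N x) \<bullet> w = N x \<bullet> DN x w\<close>, and this vanishes because
  \<open>N\<close> has constant length on \<open>reg\<close>.\<close>

lemma DN_N: assumes x: "x \<in> reg" shows "DN x (N x) = (- r1 x *\<^sub>R fst x, - r2 x *\<^sub>R snd x)"
proof -
  note xx = regD[OF x]
  define w where "w = DN x (N x) + (r1 x *\<^sub>R fst x, r2 x *\<^sub>R snd x)"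
  have "w \<in> tangent_space x"
    using DN_radial[OF xx(1), of "N x"] xx(2)
    by (simp add: w_def tangent_space_iff inner_add_left dot_square_norm S2xS2_iff r1_def r2_def)
  moreover from this have "DN x (N x) \<bullet> w = 0"
    using N_DN[OF x, of w] DN_symmetric[OF xx(1), of "N x" w] by (simp add: inner_commute)
  moreover have "(r1 x *\<^sub>R fst x, r2 x *\<^sub>R snd x) \<bullet> w = 0"
    using \<open>w \<in> tangent_space x\<close> by (simp add: tangent_space_iff inner_prod_def inner_commute)
  ultimately have "w \<bullet> w = 0" by (simp add: w_def inner_add_left)
  then have "w = 0" by simp
  then show ?thesis by (simp add: w_def prod_eq_iff eq_neg_iff_add_eq_0)
qed

end

section \<open>The Riccati equation along the normal direction\<close>

context isoparametric
begin

text \<open>\<open>fr 1, fr 2, fr 3\<close> is an orthogonal frame of the level sets where both components of \<open>N\<close> are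
  nonzero, parallel along the normal geodesics; \<open>frn i\<close> is the squared length of \<open>fr i\<close> there.\<close>
definition fr :: "nat \<Rightarrow> r33 \<Rightarrow> r33" where
  "fr i x = (if i = 1 then (W1 x, 0)
     else if i = 2 then (0, W2 x)
     else (r2 x *\<^sub>R N1 x, - r1 x *\<^sub>R N2 x))"

definition frn :: "nat \<Rightarrow> r33 \<Rightarrow> real" where
  "frn i x = (if i = 1 then r1 x else if i = 2 then r2 x else r1 x * r2 x)"

lemma fr_simps:
  "fr 1 x = (W1 x, 0)" "fr (Suc 0) x = (W1 x, 0)"
  "fr 2 x = (0, W2 x)"
  "fr 3 x = (r2 x *\<^sub>R N1 x, - r1 x *\<^sub>R N2 x)"
  by (simp_all add: fr_def)

lemma frn_simps: "frn 1 x = r1 x" "frn (Suc 0) x = r1 x" "frn 2 x = r2 x" "frn 3 x = r1 x * r2 x"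
  by (simp_all add: frn_def)

definition reg' :: "r33 set" where "reg' = {x \<in> reg. r1 x \<noteq> 0 \<and> r2 x \<noteq> 0}"

lemma reg'D: "x \<in> reg' \<Longrightarrow> x \<in> reg" "x \<in> reg' \<Longrightarrow> r1 x \<noteq> 0" "x \<in> reg' \<Longrightarrow> r2 x \<noteq> 0"
  by (auto simp: reg'_def)

lemma r_nonneg: "0 \<le> r1 x" "0 \<le> r2 x"
  by (simp_all add: r1_def r2_def)

lemma cross_inner_self:
  assumes "x \<in> reg"
  shows "W1 x \<bullet> W1 x = r1 x"
    and "W2 x \<bullet> W2 x = r2 x"
  using norm_cross_dot[of "fst x" "N1 x"] norm_cross_dot[of "snd x" "N2 x"]
    N_orthogonal_radial[of x] regD[OF assms]
  by (simp_all add: S2xS2_iff inner_commute r1_def r2_def dot_square_norm)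

lemma fr_tangent: "x \<in> reg \<Longrightarrow> fr i x \<in> tangent_space x"
  using N_orthogonal_radial[of x] regD[of x]
  by (auto simp: fr_def tangent_space_iff dot_cross_self inner_commute)

lemma tangent_expansion:
  assumes x: "x \<in> reg'" and v: "v \<in> tangent_space x" "N x \<bullet> v = 0"
  shows "v = (v \<bullet> fr 1 x / frn 1 x) *\<^sub>R fr 1 x + (v \<bullet> fr 2 x / frn 2 x) *\<^sub>R fr 2 x
    + (v \<bullet> fr 3 x / frn 3 x) *\<^sub>R fr 3 x"
proof -
  note xx = regD[OF reg'D(1)[OF x]] and nz = reg'D(2,3)[OF x]
  have pos: "r1 x > 0" "r2 x > 0" using nz r_nonneg[of x] by linarith+
  define c1 c2 where "c1 = sqrt (r1 x)" and "c2 = sqrt (r2 x)"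
  have c: "c1 * c1 = r1 x" "c2 * c2 = r2 x" "c1 \<noteq> 0" "c2 \<noteq> 0" using pos by (auto simp: c1_def c2_def)
  have ex1: "fst v = (fst v \<bullet> N1 x / r1 x) *\<^sub>R N1 x + (fst v \<bullet> W1 x / r1 x) *\<^sub>R W1 x"
    using cross_frame_expansion[of "fst x" "(1/c1) *\<^sub>R N1 x" "fst v"] xx v N_orthogonal_radial(1)[OF xx(1)] c nz
    by (simp add: S2xS2_iff cross_mult_right inner_commute tangent_space_iff norm_eq_sqrt_inner r1_def[symmetric] c1_def[symmetric])
  have ex2: "snd v = (snd v \<bullet> N2 x / r2 x) *\<^sub>R N2 x + (snd v \<bullet> W2 x / r2 x) *\<^sub>R W2 x"
    using cross_frame_expansion[of "snd x" "(1/c2) *\<^sub>R N2 x" "snd v"] xx v N_orthogonal_radial(2)[OF xx(1)] c nz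
    by (simp add: S2xS2_iff cross_mult_right inner_commute tangent_space_iff norm_eq_sqrt_inner r2_def[symmetric] c2_def[symmetric])
  \<comment> \<open>Orthogonality to \<open>N\<close> makes the two inner products with
    \<open>N1\<close> and \<open>N2\<close> opposite, so one number \<open>a\<close> remains; by
    \<open>r1 + r2 = 1\<close> it is the inner product with \<open>fr 3\<close>.\<close>
  define a where "a = fst v \<bullet> N1 x"
  have s: "snd v \<bullet> N2 x = - a" using v(2) by (simp add: a_def inner_prod_def inner_commute)
  have v3: "v \<bullet> fr 3 x = a"
    using s r_sum[OF reg'D(1)[OF x]] by (simp add: fr_simps inner_prod_def a_def[symmetric] flip: distrib_right)
  show ?thesis
    unfolding v3 using trans[OF ex1 add.commute] ex2 nz
    by (simp add: prod_eq_iff fr_simps frn_simps inner_prod_def a_def[symmetric] s)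
qed

text \<open>Covariant derivative of \<open>N\<close>.\<close>
definition DNt :: "r33 \<Rightarrow> r33 \<Rightarrow> r33" where
  "DNt x w = DN x w + ((N1 x \<bullet> fst w) *\<^sub>R fst x, (N2 x \<bullet> snd w) *\<^sub>R snd x)"

lemma DNt_tangent: "x \<in> reg \<Longrightarrow> DNt x w \<in> tangent_space x"
  using DN_radial[of x w] regD[of x]
  by (simp add: DNt_def tangent_space_iff inner_add_left S2xS2_iff dot_square_norm)

lemma DNt_inner: "v \<in> tangent_space x \<Longrightarrow> DNt x w \<bullet> v = DN x w \<bullet> v"
  by (simp add: DNt_def tangent_space_iff inner_prod_def inner_add_left inner_add_right inner_commute)

lemma N_DNt: "x \<in> reg \<Longrightarrow> w \<in> tangent_space x \<Longrightarrow> N x \<bullet> DNt x w = 0"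
  using N_DN[of x w] DNt_inner[OF N_tangent, of x w] regD[of x] by (simp add: inner_commute)

lemma r_derivative_N:
  assumes x: "x \<in> reg" shows "fst (DN x (N x)) \<bullet> N1 x = 0" "snd (DN x (N x)) \<bullet> N2 x = 0"
  using DN_N[OF x] N_orthogonal_radial[OF regD(1)[OF x]] by (simp_all add: inner_commute)

text \<open>The vector \<open>w\<close> is held fixed while the point moves along \<open>u\<close>.
  Symmetry in \<open>u\<close> and \<open>w\<close> yields both the Riccati equation and, on
  \<open>M\<close>, the Codazzi equation.\<close>

definition D2N :: "r33 \<Rightarrow> r33 \<Rightarrow> r33 \<Rightarrow> r33" where
  "D2N x u w = dderiv (\<lambda>y. DN y w) x u"

lemma DN_field_derivative:
  assumes x: "x \<in> \<Omega>" and Z: "(Z has_derivative Z') (at x)"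
  shows "((\<lambda>y. DN y (Z y)) has_derivative (\<lambda>u. D2N x u (Z x) + DN x (Z' u))) (at x)"
  using has_derivative_dderiv_field[OF N_smooth x Z] unfolding DN_def D2N_def .

lemma D2N_symmetric: "x \<in> \<Omega> \<Longrightarrow> D2N x u w = D2N x w u"
  unfolding DN_def D2N_def by (rule dderiv_symmetric[OF N_smooth])

text \<open>Obtained by differentiating the geodesic equation \<open>DN_N\<close> in a tangent
  direction. The first term becomes the square of the shape operator, the second is radial, and the
  last is the origin of the curvature term: it comes from moving the position vectors in
  \<open>DN_N\<close>.\<close>

lemma D2N_N:
  assumes x: "x \<in> reg" and w: "w \<in> tangent_space x"
  shows "D2N x w (N x) = - DN x (DN x w)
    - ((2 * (fst (DN x w) \<bullet> N1 x)) *\<^sub>R fst x, (2 * (snd (DN x w) \<bullet> N2 x)) *\<^sub>R snd x)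
    - (r1 x *\<^sub>R fst w, r2 x *\<^sub>R snd w)"
proof -
  note xx = regD[OF x]
  have "((\<lambda>y. (- r1 y *\<^sub>R fst y, - r2 y *\<^sub>R snd y)) has_derivative
     (\<lambda>u. (- r1 x *\<^sub>R fst u + (- (2 * (fst (DN x u) \<bullet> N1 x))) *\<^sub>R fst x,
       - r2 x *\<^sub>R snd u + (- (2 * (snd (DN x u) \<bullet> N2 x))) *\<^sub>R snd x))) (at x)"
    by (intro has_derivative_Pair has_derivative_scaleR has_derivative_minus r1_derivative r2_derivative
        xx has_derivative_fst has_derivative_snd has_derivative_ident)
  from tangent_derivative_eq[OF open_\<Omega> xx(2,1) w _
      has_derivative_at_withinI[OF DN_field_derivative[OF xx(1) N_derivative[OF xx(1)]]]
      has_derivative_at_withinI[OF this]]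
  have "D2N x w (N x) + DN x (DN x w) = (- r1 x *\<^sub>R fst w + (- (2 * (fst (DN x w) \<bullet> N1 x))) *\<^sub>R fst x,
       - r2 x *\<^sub>R snd w + (- (2 * (snd (DN x w) \<bullet> N2 x))) *\<^sub>R snd x)"
    using DN_N by (auto simp: reg_def)
  then have "D2N x w (N x) = (- r1 x *\<^sub>R fst w + (- (2 * (fst (DN x w) \<bullet> N1 x))) *\<^sub>R fst x,
       - r2 x *\<^sub>R snd w + (- (2 * (snd (DN x w) \<bullet> N2 x))) *\<^sub>R snd x) - DN x (DN x w)"
    by (simp only: eq_diff_eq)
  then show ?thesis by (simp add: prod_eq_iff)
qed

text \<open>A field with \<open>Z' (N x)\<close> radial is one whose covariant derivative along the normal
  geodesic vanishes; the coefficients of the radial part are forced by tangency.\<close>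
lemma riccati:
  assumes x: "x \<in> reg"
    and Z: "(Z has_derivative Z') (at x)" "Z x \<in> tangent_space x"
      "Z' (N x) = (- (N1 x \<bullet> fst (Z x)) *\<^sub>R fst x, - (N2 x \<bullet> snd (Z x)) *\<^sub>R snd x)"
    and Y: "(Y has_derivative Y') (at x)" "Y x \<in> tangent_space x"
      "Y' (N x) = (- (N1 x \<bullet> fst (Y x)) *\<^sub>R fst x, - (N2 x \<bullet> snd (Y x)) *\<^sub>R snd x)"
  shows "\<exists>L. ((\<lambda>y. DN y (Z y) \<bullet> Y y) has_derivative L) (at x) \<and>
    L (N x) = - (DNt x (Z x) \<bullet> DNt x (Y x)) - r1 x * (fst (Z x) \<bullet> fst (Y x)) - r2 x * (snd (Z x) \<bullet> snd (Y x))
      + (N1 x \<bullet> fst (Z x)) * (N1 x \<bullet> fst (Y x)) + (N2 x \<bullet> snd (Z x)) * (N2 x \<bullet> snd (Y x))"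
proof (intro exI conjI)
  note xx = regD[OF x]
  note lin = DN_linear[OF xx(1)]
  let ?z = "Z x" and ?y = "Y x"
  show "((\<lambda>y. DN y (Z y) \<bullet> Y y) has_derivative
     (\<lambda>u. DN x ?z \<bullet> Y' u + (D2N x u ?z + DN x (Z' u)) \<bullet> ?y)) (at x)"
    by (intro has_derivative_inner DN_field_derivative xx Z Y)
  have rad: "DN x ?z \<bullet> Y' (N x) = (N1 x \<bullet> fst ?z) * (N1 x \<bullet> fst ?y) + (N2 x \<bullet> snd ?z) * (N2 x \<bullet> snd ?y)"
    using DN_radial[OF xx(1), of ?z] by (simp add: Y(3) inner_prod_def)
  \<comment> \<open>The radial derivative required of \<open>Z\<close> is exactly the gap between
    the flat and the covariant derivative of \<open>N\<close>; it turns the flat square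
    \<open>DN x (DN x ?z)\<close> into \<open>DN x (DNt x ?z)\<close>.\<close>
  have Z'N: "Z' (N x) = DN x ?z - DNt x ?z"
    by (simp add: Z(3) DNt_def)
  have "(D2N x (N x) ?z + DN x (Z' (N x))) \<bullet> ?y = - (DN x (DNt x ?z) \<bullet> ?y)
      - r1 x * (fst ?z \<bullet> fst ?y) - r2 x * (snd ?z \<bullet> snd ?y)"
    using Y(2) unfolding D2N_symmetric[OF xx(1), of "N x"] D2N_N[OF x Z(2)] Z'N linear_diff[OF lin]
    by (simp add: inner_simps inner_prod_def tangent_space_iff inner_commute)
  also have "DN x (DNt x ?z) \<bullet> ?y = DNt x ?z \<bullet> DNt x ?y"
    using DN_symmetric[OF xx(1), of "DNt x ?z" ?y] DNt_inner[OF DNt_tangent[OF x], of ?y ?z]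
    by (simp add: inner_commute)
  finally show "DN x ?z \<bullet> Y' (N x) + (D2N x (N x) ?z + DN x (Z' (N x))) \<bullet> ?y =
     - (DNt x ?z \<bullet> DNt x ?y) - r1 x * (fst ?z \<bullet> fst ?y) - r2 x * (snd ?z \<bullet> snd ?y)
      + (N1 x \<bullet> fst ?z) * (N1 x \<bullet> fst ?y) + (N2 x \<bullet> snd ?z) * (N2 x \<bullet> snd ?y)"
    using rad by simp
qed

lemma fr_derivative:
  assumes x: "x \<in> \<Omega>"
  shows "(fr 1 has_derivative (\<lambda>u. (cross3 (fst x) (fst (DN x u)) + cross3 (fst u) (N1 x), 0))) (at x)"
    "(fr 2 has_derivative (\<lambda>u. (0, cross3 (snd x) (snd (DN x u)) + cross3 (snd u) (N2 x)))) (at x)"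
    "(fr 3 has_derivative (\<lambda>u. (r2 x *\<^sub>R fst (DN x u) + (2 * (snd (DN x u) \<bullet> N2 x)) *\<^sub>R N1 x,
        - r1 x *\<^sub>R snd (DN x u) + (- (2 * (fst (DN x u) \<bullet> N1 x))) *\<^sub>R N2 x))) (at x)"
  unfolding fr_def[abs_def]
  by (auto intro!: has_derivative_Pair bounded_bilinear.FDERIV[OF bounded_bilinear_cross3]
      has_derivative_scaleR has_derivative_minus r1_derivative r2_derivative
      N_derivative x has_derivative_fst has_derivative_snd has_derivative_ident
      simp del: scaleR_minus_left)

text \<open>Along a normal geodesic the position in each factor moves by that component of
  \<open>N\<close>, and the component moves back along the position, by \<open>DN_N\<close>. Both
  contributions to the derivative of a cross product therefore vanish; for \<open>fr 3\<close> the
  constancy of \<open>r1\<close> and \<open>r2\<close> along the geodesic is used as well.\<close>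

lemma fr_parallel:
  assumes x: "x \<in> reg" and i: "i \<in> {1, 2, 3}"
  shows "\<exists>Z'. (fr i has_derivative Z') (at x) \<and>
    Z' (N x) = (- (N1 x \<bullet> fst (fr i x)) *\<^sub>R fst x, - (N2 x \<bullet> snd (fr i x)) *\<^sub>R snd x)"
proof -
  note d = fr_derivative[OF regD(1)[OF x]]
  note simps = fr_simps cross_mult_right dot_cross_self r1_def[symmetric] r2_def[symmetric] mult.commute
  have "?thesis" if "i = 1" unfolding that
    by (intro exI conjI, rule d(1)) (use DN_N[OF x] in \<open>simp add: simps\<close>)
  moreover have "?thesis" if "i = 2" unfolding that
    by (intro exI conjI, rule d(2)) (use DN_N[OF x] in \<open>simp add: simps\<close>)
  moreover have "?thesis" if "i = 3" unfolding that
    by (intro exI conjI, rule d(3)) (use DN_N[OF x] r_derivative_N[OF x] in \<open>simp add: simps\<close>)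
  ultimately show ?thesis using i by blast
qed

text \<open>The matrix of the shape operator in the unnormalised frame: not symmetric, but free of square
  roots and with the same principal minors as in an orthonormal frame.\<close>
definition m :: "nat \<Rightarrow> nat \<Rightarrow> r33 \<Rightarrow> real" where
  "m i j x = DN x (fr i x) \<bullet> fr j x / frn j x"

text \<open>A relation, so that each rule carries the existence of the derivative together with its
  value in the normal direction.\<close>

definition along :: "(r33 \<Rightarrow> real) \<Rightarrow> r33 \<Rightarrow> real \<Rightarrow> bool" where
  "along h x d \<longleftrightarrow> (\<exists>L. (h has_derivative L) (at x) \<and> L (N x) = d)"

lemma along_const: "along (\<lambda>y. c) x 0"
  unfolding along_def by (rule exI[of _ "\<lambda>v. 0"]) simp

lemma along_add: "along h x a \<Longrightarrow> along k x b \<Longrightarrow> along (\<lambda>y. h y + k y) x (a + b)"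
  unfolding along_def by (elim exE conjE, intro exI conjI, erule (1) has_derivative_add) simp

lemma along_diff: "along h x a \<Longrightarrow> along k x b \<Longrightarrow> along (\<lambda>y. h y - k y) x (a - b)"
  unfolding along_def by (elim exE conjE, intro exI conjI, erule (1) has_derivative_diff) simp

lemma along_mult: "along h x a \<Longrightarrow> along k x b \<Longrightarrow> along (\<lambda>y. h y * k y) x (h x * b + a * k x)"
  unfolding along_def by (elim exE conjE, intro exI conjI, erule (1) has_derivative_mult) simp

lemma along_divide:
  assumes "along h x a" "along k x 0" "k x \<noteq> 0" shows "along (\<lambda>y. h y / k y) x (a / k x)"
proof -
  obtain L K where L: "(h has_derivative L) (at x)" "L (N x) = a" and K: "(k has_derivative K) (at x)" "K (N x) = 0"
    using assms by (auto simp: along_def)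
  show ?thesis unfolding along_def
    by (intro exI conjI, rule has_derivative_divide[OF L(1) K(1) assms(3)]) (simp add: L K field_simps)
qed

lemma along_r: "x \<in> reg \<Longrightarrow> along r1 x 0" "x \<in> reg \<Longrightarrow> along r2 x 0"
  unfolding along_def
  by (intro exI conjI, rule r1_derivative r2_derivative, erule regD, simp add: r_derivative_N)+

lemma along_frn: "x \<in> reg \<Longrightarrow> along (frn i) x 0"
proof -
  have "frn i = (if i = 1 then r1 else if i = 2 then r2 else (\<lambda>x. r1 x * r2 x))"
    by (auto simp: frn_def)
  then show "x \<in> reg \<Longrightarrow> along (frn i) x 0"
    using along_r[of x] along_mult[of r1 x 0 r2 0] by simp
qed

lemma DNt_inner_DNt:
  assumes x: "x \<in> reg'" and w: "w \<in> tangent_space x" "z \<in> tangent_space x"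
  shows "DNt x z \<bullet> DNt x w = (DN x z \<bullet> fr 1 x) * (DN x (fr 1 x) \<bullet> w) / frn 1 x
     + (DN x z \<bullet> fr 2 x) * (DN x (fr 2 x) \<bullet> w) / frn 2 x + (DN x z \<bullet> fr 3 x) * (DN x (fr 3 x) \<bullet> w) / frn 3 x"
proof -
  note xr = reg'D(1)[OF x] and xx = regD[OF reg'D(1)[OF x]]
  have e: "DNt x u \<bullet> fr i x = DN x u \<bullet> fr i x" for u i by (rule DNt_inner[OF fr_tangent[OF xr]])
  have "DNt x z \<bullet> DNt x w = DNt x z \<bullet> ((DNt x w \<bullet> fr 1 x / frn 1 x) *\<^sub>R fr 1 x
      + (DNt x w \<bullet> fr 2 x / frn 2 x) *\<^sub>R fr 2 x + (DNt x w \<bullet> fr 3 x / frn 3 x) *\<^sub>R fr 3 x)"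
    by (rule arg_cong[OF tangent_expansion[OF x DNt_tangent[OF xr] N_DNt[OF xr w(1)]]])
  then show ?thesis
    unfolding e DN_symmetric[OF xx(1), of w] by (simp add: e inner_add_right mult.commute)
qed

text \<open>This is the curvature term of \<open>riccati\<close> evaluated on the frame. The entry
  for \<open>fr 3\<close> vanishes because in each factor \<open>fr 3\<close> is parallel to
  \<open>N\<close>, so the two span a flat plane.\<close>

lemma fr_inner_terms:
  assumes x: "x \<in> reg" and "i \<in> {1, 2, 3}" "j \<in> {1, 2, 3}"
  shows "r1 x * (fst (fr i x) \<bullet> fst (fr j x)) + r2 x * (snd (fr i x) \<bullet> snd (fr j x))
      - (N1 x \<bullet> fst (fr i x)) * (N1 x \<bullet> fst (fr j x)) - (N2 x \<bullet> snd (fr i x)) * (N2 x \<bullet> snd (fr j x))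
    = (if i = j \<and> i \<noteq> 3 then frn i x * frn i x else 0)"
  using assms(2,3) cross_inner_self[OF x]
  by (auto simp: fr_simps frn_simps dot_cross_self r1_def[symmetric] r2_def[symmetric])

lemma along_m:
  assumes x: "x \<in> reg'" and i: "i \<in> {1, 2, 3}" and j: "j \<in> {1, 2, 3}"
  shows "along (m i j) x (- (m i 1 x * m 1 j x + m i 2 x * m 2 j x + m i 3 x * m 3 j x)
    - (if i = j \<and> i \<noteq> 3 then frn i x else 0))"
proof -
  note xr = reg'D(1)[OF x]
  have nz: "frn j x \<noteq> 0" using reg'D[OF x] by (simp add: frn_def)
  obtain Z Y where Z: "(fr i has_derivative Z) (at x)"
      "Z (N x) = (- (N1 x \<bullet> fst (fr i x)) *\<^sub>R fst x, - (N2 x \<bullet> snd (fr i x)) *\<^sub>R snd x)"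
    and Y: "(fr j has_derivative Y) (at x)"
      "Y (N x) = (- (N1 x \<bullet> fst (fr j x)) *\<^sub>R fst x, - (N2 x \<bullet> snd (fr j x)) *\<^sub>R snd x)"
    using fr_parallel[OF xr i] fr_parallel[OF xr j] by blast
  have "along (\<lambda>y. DN y (fr i y) \<bullet> fr j y) x
     (- (DNt x (fr i x) \<bullet> DNt x (fr j x)) - (if i = j \<and> i \<noteq> 3 then frn i x * frn i x else 0))"
    using riccati[OF xr Z(1) fr_tangent[OF xr] Z(2) Y(1) fr_tangent[OF xr] Y(2)]
    unfolding along_def fr_inner_terms[OF xr i j, symmetric] by (simp add: algebra_simps)
  from along_divide[OF this along_frn[OF xr] nz]
  have "along (m i j) x ((- (DNt x (fr i x) \<bullet> DNt x (fr j x)) - (if i = j \<and> i \<noteq> 3 then frn i x * frn i x else 0)) / frn j x)"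
    by (simp add: m_def[abs_def])
  moreover have "(- (DNt x (fr i x) \<bullet> DNt x (fr j x)) - (if i = j \<and> i \<noteq> 3 then frn i x * frn i x else 0)) / frn j x
     = - (m i 1 x * m 1 j x + m i 2 x * m 2 j x + m i 3 x * m 3 j x)
    - (if i = j \<and> i \<noteq> 3 then frn i x else 0)"
    unfolding DNt_inner_DNt[OF x fr_tangent[OF xr] fr_tangent[OF xr]] m_def using nz
    by (simp add: diff_divide_distrib add_divide_distrib)
  ultimately show ?thesis by simp
qed

lemma H_eq:
  assumes x: "x \<in> reg'" shows "m 1 1 x + m 2 2 x + m 3 3 x = \<eta> (F x)"
proof -
  note xr = reg'D(1)[OF x] and xx = regD[OF reg'D(1)[OF x]]
  note lin = DN_linear[OF xx(1)] and nz = reg'D(2,3)[OF x]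
  have pos: "r1 x > 0" "r2 x > 0" using nz r_nonneg[of x] by linarith+
  define c1 c2 where "c1 = sqrt (r1 x)" and "c2 = sqrt (r2 x)"
  have c: "c1 * c1 = r1 x" "c2 * c2 = r2 x" "c1 \<noteq> 0" "c2 \<noteq> 0" using pos by (auto simp: c1_def c2_def)
  let ?X = "(N1 x, 0) :: r33" and ?Y = "(0, N2 x) :: r33"
  have t: "?X \<in> tangent_space x" "?Y \<in> tangent_space x"
    using N_orthogonal_radial[OF xx(1)] by (auto simp: tangent_space_iff)
  have sc: "DN x (a *\<^sub>R v) \<bullet> (a *\<^sub>R v) = (a * a) * (DN x v \<bullet> v)" for a v
    by (simp add: linear_scale[OF lin])
  have n: "norm ((1/c1) *\<^sub>R N1 x) = 1" "norm ((1/c2) *\<^sub>R N2 x) = 1"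
    using pos by (simp_all add: c1_def c2_def r1_def r2_def norm_eq_sqrt_inner)
  have ort: "fst x \<bullet> ((1/c1) *\<^sub>R N1 x) = 0" "snd x \<bullet> ((1/c2) *\<^sub>R N2 x) = 0"
    using N_orthogonal_radial[OF xx(1)] by (simp_all add: inner_commute)
  \<comment> \<open>The sum of \<open>?X\<close> and \<open>?Y\<close> is \<open>N x\<close>, which
    is orthogonal to all values of \<open>DN x\<close> on tangent vectors. With symmetry, the form
    \<open>DN x\<close> on their span is determined by \<open>B\<close>; its share
    \<open>B / r1 x + B / r2 x\<close> of the trace equals \<open>m 3 3 x\<close> since
    \<open>r1 + r2 = 1\<close>.\<close>
  define B where "B = DN x ?X \<bullet> ?X"
  have "DN x ?X \<bullet> ?X + DN x ?X \<bullet> ?Y = 0" "DN x ?Y \<bullet> ?X + DN x ?Y \<bullet> ?Y = 0"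
    using N_DN[OF xr t(1)] N_DN[OF xr t(2)] by (simp_all add: inner_prod_def inner_commute)
  then have XY: "DN x ?X \<bullet> ?Y = - B" "DN x ?Y \<bullet> ?X = - B" "DN x ?Y \<bullet> ?Y = B"
    using DN_symmetric[OF xx(1), of ?X ?Y] unfolding B_def by linarith+
  have "fr 3 x = r2 x *\<^sub>R ?X - r1 x *\<^sub>R ?Y" by (simp add: fr_simps)
  then have "DN x (fr 3 x) \<bullet> fr 3 x = (r1 x + r2 x) * (r1 x + r2 x) * B"
    by (simp only: linear_diff[OF lin] linear_scale[OF lin] inner_diff_left inner_diff_right
        inner_scaleR_left inner_scaleR_right XY B_def[symmetric]) (simp add: algebra_simps)
  then have m33: "m 3 3 x = B / (r1 x * r2 x)" by (simp add: m_def frn_simps r_sum[OF xr])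
  have "\<eta> (F x) = (1/c1) * (1/c1) * B + (1/c1) * (1/c1) * (DN x (fr 1 x) \<bullet> fr 1 x)
     + (1/c2) * (1/c2) * B + (1/c2) * (1/c2) * (DN x (fr 2 x) \<bullet> fr 2 x)"
    using N_trace[OF xr n(1) ort(1) n(2) ort(2)] sc[of "1/c1" ?X] sc[of "1/c2" ?Y]
      sc[of "1/c1" "fr 1 x"] sc[of "1/c2" "fr 2 x"]
    by (simp add: XY B_def fr_simps cross_mult_right)
  also have "\<dots> = B / r1 x + m 1 1 x + B / r2 x + m 2 2 x"
    using c by (simp add: m_def frn_simps)
  finally have "\<eta> (F x) = B / r1 x + m 1 1 x + B / r2 x + m 2 2 x" .
  moreover have "B / r1 x + B / r2 x = m 3 3 x"
    using nz r_sum[OF xr] unfolding m33 by (simp add: field_simps) (metis distrib_left mult.right_neutral add.commute)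
  ultimately show ?thesis by linarith
qed

section \<open>Functions of \<open>F\<close> alone and the quadratic equation for
  \<open>kap\<close>\<close>

definition isF :: "(r33 \<Rightarrow> real) \<Rightarrow> bool" where
  "isF h \<longleftrightarrow> (\<exists>\<psi>. C_inf_on J \<psi> \<and> (\<forall>x\<in>reg'. h x = \<psi> (F x)))"

lemma isF_const: "isF (\<lambda>x. c)"
  unfolding isF_def using C_inf_on_const[OF open_J] by (intro exI[of _ "\<lambda>s. c"]) auto

lemma isF_H: "isF (\<lambda>x. m 1 1 x + m 2 2 x + m 3 3 x)"
  unfolding isF_def using H_eq \<eta>_smooth by blast

lemma isF_add: assumes "isF h" "isF k" shows "isF (\<lambda>x. h x + k x)"
proof -
  obtain a b where "C_inf_on J a" "\<forall>x\<in>reg'. h x = a (F x)" "C_inf_on J b" "\<forall>x\<in>reg'. k x = b (F x)"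
    using assms unfolding isF_def by blast
  then show ?thesis unfolding isF_def by (intro exI[of _ "\<lambda>s. a s + b s"]) (auto intro: C_inf_on_add)
qed

lemma isF_mult: assumes "isF h" "isF k" shows "isF (\<lambda>x. h x * k x)"
proof -
  obtain a b where "C_inf_on J a" "\<forall>x\<in>reg'. h x = a (F x)" "C_inf_on J b" "\<forall>x\<in>reg'. k x = b (F x)"
    using assms unfolding isF_def by blast
  then show ?thesis unfolding isF_def
    by (intro exI[of _ "\<lambda>s. a s * b s"]) (auto intro: C_inf_on_bilinear[OF bounded_bilinear_mult])
qed

lemma isF_cong: "isF h \<Longrightarrow> (\<And>x. x \<in> reg' \<Longrightarrow> h x = k x) \<Longrightarrow> isF k"
  unfolding isF_def by metis

text \<open>The normal derivative of \<open>\<psi> (F x)\<close> is \<open>\<psi>' (F x)\<close>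
  times the length of the gradient, again a function of \<open>F\<close>. That length is written
  \<open>\<phi> s * f s\<close>, a product of functions known to be smooth on \<open>J\<close>, so
  that the class is closed under repeated differentiation.\<close>

lemma isF_along:
  assumes h: "isF h" and d: "\<And>x. x \<in> reg' \<Longrightarrow> along h x (d x)" shows "isF d"
proof -
  obtain \<psi> where psi: "C_inf_on J \<psi>" "\<And>x. x \<in> reg' \<Longrightarrow> h x = \<psi> (F x)"
    using h unfolding isF_def by blast
  \<comment> \<open>The identity for \<open>h\<close> holds on \<open>reg'\<close> only;
    \<open>W\<close> is an ambient open set cutting out \<open>reg'\<close>, as comparing
    derivatives requires.\<close>
  define W where "W = \<Omega> \<inter> {x. r1 x \<noteq> 0 \<and> r2 x \<noteq> 0}"
  have "continuous_on \<Omega> r1" "continuous_on \<Omega> r2"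
    unfolding r1_def r2_def by (intro continuous_intros C_inf_on_continuous_on[OF N_smooth])+
  then have "open (\<Omega> \<inter> r1 -` (- {0}))" "open (\<Omega> \<inter> r2 -` (- {0}))"
    using continuous_on_open_vimage[OF open_\<Omega>] by (metis Int_commute open_Compl closed_singleton)+
  then have "open ((\<Omega> \<inter> r1 -` (- {0})) \<inter> (\<Omega> \<inter> r2 -` (- {0})))" by (rule open_Int)
  also have "(\<Omega> \<inter> r1 -` (- {0})) \<inter> (\<Omega> \<inter> r2 -` (- {0})) = W" by (auto simp: W_def)
  finally have oW: "open W" .
  have reg': "reg' = W \<inter> S2xS2" by (auto simp: reg'_def reg_def W_def)
  have "d x = dderiv \<psi> (F x) 1 * (\<phi> (F x) * f (F x))" if x: "x \<in> reg'" for x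
  proof -
    note xr = reg'D(1)[OF x] and xx = regD[OF reg'D(1)[OF x]]
    obtain L where L: "(h has_derivative L) (at x)" "L (N x) = d x"
      using d[OF x] by (auto simp: along_def)
    have "((\<lambda>y. \<psi> (Ft y)) has_derivative (\<lambda>v. dderiv \<psi> (Ft x) (dderiv Ft x v))) (at x)"
      by (rule has_derivative_compose[OF Ft_derivative[OF xx(3)] C_inf_on_has_derivative[OF psi(1) Ft_J[OF xx(1)]]])
    from tangent_derivative_eq[OF oW xx(2) _ N_tangent[OF xx(1)] _ has_derivative_at_withinI[OF L(1)]
        has_derivative_at_withinI[OF this]]
    have "d x = dderiv \<psi> (Ft x) (dderiv Ft x (N x))"
      using x psi(2) Ft_eq L(2) by (auto simp: reg')
    also have "dderiv Ft x (N x) = sqrt (f (F x)) *\<^sub>R 1"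
      using dFt[OF xx(1)] N_unit[OF xr] Ft_eq[OF xx(2)] by simp
    also have "dderiv \<psi> (Ft x) \<dots> = sqrt (f (F x)) * dderiv \<psi> (F x) 1"
      using linear_scale[OF C_inf_on_linear_dderiv[OF psi(1) Ft_J[OF xx(1)]], of "sqrt (f (F x))" 1]
        Ft_eq[OF xx(2)] by simp
    also have "sqrt (f (F x)) = \<phi> (F x) * f (F x)"
      using Ft_J[OF xx(1)] Ft_eq[OF xx(2)] by (simp add: \<phi>_def J_def field_simps)
    finally show ?thesis by simp
  qed
  moreover have "C_inf_on J (\<lambda>s. dderiv \<psi> s 1 * (\<phi> s * f s))"
    by (intro C_inf_on_bilinear[OF bounded_bilinear_mult] C_inf_on_dderiv_const psi \<phi>_smooth
        C_inf_on_subset[OF f_smooth open_J]) auto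
  ultimately show ?thesis unfolding isF_def by (intro exI[of _ "\<lambda>s. dderiv \<psi> s 1 * (\<phi> s * f s)"]) auto
qed

abbreviation "H x \<equiv> m 1 1 x + m 2 2 x + m 3 3 x"

definition m12 :: "r33 \<Rightarrow> real" where "m12 x = m 1 1 x * m 2 2 x - m 1 2 x * m 2 1 x"
definition m13 :: "r33 \<Rightarrow> real" where "m13 x = m 1 1 x * m 3 3 x - m 1 3 x * m 3 1 x"
definition m23 :: "r33 \<Rightarrow> real" where "m23 x = m 2 2 x * m 3 3 x - m 2 3 x * m 3 2 x"
definition m123 :: "r33 \<Rightarrow> real" where
  "m123 x = m 1 1 x * m 2 2 x * m 3 3 x + m 1 2 x * m 2 3 x * m 3 1 x + m 1 3 x * m 2 1 x * m 3 2 x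
    - m 1 1 x * m 2 3 x * m 3 2 x - m 2 2 x * m 1 3 x * m 3 1 x - m 3 3 x * m 1 2 x * m 2 1 x"

text \<open>Let \<open>L h = N h + H h\<close>, so that \<open>L\<close> acts on \<open>h / D\<close> as the derivative of \<open>h\<close> along a
  normal geodesic, where \<open>D\<close> is the Jacobian of the normal flow. On the principal minors of
  the shape operator \<open>L\<close> is linear: a sum of three oscillators with squared frequencies
  \<open>r1\<close>, \<open>r2\<close> and \<open>0\<close>.\<close>
definition Lop :: "(r33 \<Rightarrow> real) \<Rightarrow> (r33 \<Rightarrow> real) \<Rightarrow> bool" where
  "Lop h k \<longleftrightarrow> (\<forall>x\<in>reg'. along h x (k x - H x * h x))"

lemma isF_Lop: assumes "isF h" "Lop h k" shows "isF k"
proof -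
  have "isF (\<lambda>x. k x - H x * h x)"
    using assms by (intro isF_along[OF assms(1)]) (auto simp: Lop_def)
  from isF_add[OF this isF_mult[OF isF_H assms(1)]] show ?thesis
    by (rule isF_cong) simp
qed

lemma Lop_add: "Lop h h' \<Longrightarrow> Lop k k' \<Longrightarrow> Lop (\<lambda>x. h x + k x) (\<lambda>x. h' x + k' x)"
  unfolding Lop_def using along_add by (fastforce simp: algebra_simps)

lemma Lop_mult:
  assumes "\<And>x. x \<in> reg \<Longrightarrow> along c x 0" "Lop h h'" shows "Lop (\<lambda>x. c x * h x) (\<lambda>x. c x * h' x)"
proof (unfold Lop_def, intro ballI)
  fix x assume x: "x \<in> reg'"
  from along_mult[OF assms(1)[OF reg'D(1)[OF x]] assms(2)[unfolded Lop_def, rule_format, OF x]]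
  show "along (\<lambda>x. c x * h x) x (c x * h' x - H x * (c x * h x))"
    by (simp add: right_diff_distrib mult.left_commute)
qed

lemma Lop_cong: "Lop h k \<Longrightarrow> (\<And>x. x \<in> reg' \<Longrightarrow> k x = k' x) \<Longrightarrow> Lop h k'"
  unfolding Lop_def by metis

lemma along_eq: "along h x d \<Longrightarrow> d = d' \<Longrightarrow> along h x d'" by simp

lemmas along_intros = along_add along_diff along_mult along_const along_m along_r insertI1 insertI2

text \<open>Differentiating a minor by the Riccati equation produces \<open>- H\<close> times that
  minor, which the definition of \<open>Lop\<close> cancels. What is left adds one index to the
  minor in every possible way and, with weights \<open>- r1\<close>, \<open>- r2\<close> and 0,
  removes one index in every possible way.\<close>

lemma Lop_minors:
  shows "Lop (\<lambda>x. 1) (\<lambda>x. H x)"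
    and "Lop (\<lambda>x. m 1 1 x) (\<lambda>x. m12 x + m13 x - r1 x)"
    and "Lop (\<lambda>x. m 2 2 x) (\<lambda>x. m12 x + m23 x - r2 x)"
    and "Lop (\<lambda>x. m 3 3 x) (\<lambda>x. m13 x + m23 x)"
    and "Lop m12 (\<lambda>x. m123 x - r1 x * m 2 2 x - r2 x * m 1 1 x)"
    and "Lop m13 (\<lambda>x. m123 x - r1 x * m 3 3 x)"
    and "Lop m23 (\<lambda>x. m123 x - r2 x * m 3 3 x)"
    and "Lop m123 (\<lambda>x. - r1 x * m23 x - r2 x * m13 x)"
  unfolding Lop_def m12_def[abs_def] m13_def[abs_def] m23_def[abs_def] m123_def[abs_def]
  by (intro ballI, rule along_eq, (rule along_intros | assumption)+, simp add: frn_simps algebra_simps)+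

text \<open>\<open>(L\<^sup>2 + 1)\<^sup>2 - kap\<close> is nilpotent of order two on the span of the minors, because
  \<open>r1 + r2 = 1\<close>. Applied to \<open>1\<close> this is a monic quadratic equation for \<open>kap\<close> whose coefficients
  are functions of \<open>F\<close>.\<close>
definition kap :: "r33 \<Rightarrow> real" where "kap x = 4 * r1 x * r2 x"

text \<open>Up to factors, \<open>L^2 + 1\<close> exchanges \<open>wm\<close> and \<open>vm\<close>:
  it sends \<open>wm\<close> to \<open>- kap / 2\<close> times \<open>vm\<close> and
  \<open>vm\<close> to \<open>- 2\<close> times \<open>wm\<close>. On both, therefore,
  \<open>(L^2 + 1)^2\<close> is multiplication by \<open>kap\<close>.\<close>

definition wm :: "r33 \<Rightarrow> real" where "wm x = r1 x * m23 x + r2 x * m13 x"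

definition vm :: "r33 \<Rightarrow> real" where "vm x = m13 x + m23 x"

text \<open>This is \<open>(L^2 + 1)\<close> applied to the constant 1, and \<open>pm\<close> is
  \<open>L\<close> applied to \<open>qm\<close>.\<close>

definition qm :: "r33 \<Rightarrow> real" where "qm x = 2 * (m12 x + m13 x + m23 x)"

definition pm :: "r33 \<Rightarrow> real" where
  "pm x = 2 * (3 * m123 x - r1 x * m 2 2 x - r2 x * m 1 1 x - m 3 3 x)"

lemma along_kap: "x \<in> reg \<Longrightarrow> along kap x 0"
  unfolding kap_def[abs_def] by (rule along_eq, (rule along_intros | assumption)+) simp

lemma Lop_cmult: "Lop h h' \<Longrightarrow> Lop (\<lambda>x. c * h x) (\<lambda>x. c * h' x)"
  by (rule Lop_mult[OF along_const])

lemma r2_eq: "x \<in> reg' \<Longrightarrow> r2 x = 1 - r1 x"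
  using r_sum reg'D(1) by fastforce

lemma Lop_qm: "Lop qm pm"
  unfolding qm_def[abs_def]
  by (rule Lop_cong, (rule Lop_cmult Lop_add Lop_minors)+) (simp add: pm_def r2_eq algebra_simps)

lemma Lop_H: "Lop (\<lambda>x. H x) (\<lambda>x. qm x - 1)"
  by (rule Lop_cong, (rule Lop_add Lop_minors)+) (simp add: qm_def r2_eq algebra_simps)

lemma Lop_pm: "Lop pm (\<lambda>x. kap x - 8 * wm x - qm x)"
proof -
  \<comment> \<open>Differences are written with the factor -1, to match the rules for sums and
    multiples.\<close>
  have "Lop (\<lambda>x. 2 * (3 * m123 x + (-1) * (r1 x * m 2 2 x) + (-1) * (r2 x * m 1 1 x) + (-1) * m 3 3 x)) (\<lambda>x. kap x - 8 * wm x - qm x)"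
    by (rule Lop_cong, (rule Lop_cmult Lop_add Lop_minors Lop_mult[OF along_r(1)] Lop_mult[OF along_r(2)] | assumption)+)
      (simp add: kap_def wm_def qm_def r2_eq algebra_simps)
  then show ?thesis by (simp add: pm_def[abs_def])
qed

lemma Lop_wm: "Lop wm (\<lambda>x. m123 x - kap x / 2 * m 3 3 x)"
  unfolding wm_def[abs_def]
  by (rule Lop_cong, (rule Lop_add Lop_minors Lop_mult[OF along_r(1)] Lop_mult[OF along_r(2)] | assumption)+)
    (simp add: kap_def r2_eq field_simps)

lemma Lop_wm2: "Lop (\<lambda>x. m123 x - kap x / 2 * m 3 3 x) (\<lambda>x. - wm x - kap x / 2 * vm x)"
proof -
  have "Lop (\<lambda>x. m123 x + (-1/2) * (kap x * m 3 3 x)) (\<lambda>x. - wm x - kap x / 2 * vm x)"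
    by (rule Lop_cong, (rule Lop_cmult Lop_add Lop_minors Lop_mult[OF along_kap] | assumption)+)
      (simp add: wm_def vm_def algebra_simps)
  then show ?thesis by simp
qed

lemma Lop_vm: "Lop vm (\<lambda>x. 2 * m123 x - m 3 3 x)"
  unfolding vm_def[abs_def]
  by (rule Lop_cong, (rule Lop_cmult Lop_add Lop_minors)+) (simp add: r2_eq algebra_simps)

lemma Lop_vm2: "Lop (\<lambda>x. 2 * m123 x - m 3 3 x) (\<lambda>x. - 2 * wm x - vm x)"
proof -
  have "Lop (\<lambda>x. 2 * m123 x + (-1) * m 3 3 x) (\<lambda>x. - 2 * wm x - vm x)"
    by (rule Lop_cong, (rule Lop_cmult Lop_add Lop_minors)+) (simp add: wm_def vm_def algebra_simps)
  then show ?thesis by simp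
qed

definition psi1 :: "r33 \<Rightarrow> real" where "psi1 x = kap x - 8 * wm x"

text \<open>Functions of \<open>F\<close> are closed under \<open>L\<close>, so
  \<open>psi1 = (L^2 + 1)^2 1\<close> is one. In the proof \<open>A\<close> is
  \<open>L psi1\<close>, \<open>B\<close> is \<open>L A\<close>, and \<open>C = B + psi1\<close> is
  \<open>(L^2 + 1) psi1\<close>; likewise \<open>D\<close> is \<open>L C\<close>, \<open>E\<close>
  is \<open>L D\<close>, and \<open>E + C\<close> is
  \<open>(L^2 + 1) C = kap * (psi1 - 8 * wm)\<close>. Eliminating \<open>wm\<close> by
  \<open>8 * wm = kap - psi1\<close> gives the last claim, which involves no minor except through
  \<open>psi1\<close>.\<close>

lemma isF_facts:
  shows "isF qm" "isF pm" "isF psi1" "isF (\<lambda>x. 2 * kap x * psi1 x - kap x * kap x)"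
proof -
  have "isF (\<lambda>x. qm x - 1)" by (rule isF_Lop[OF isF_H Lop_H])
  from isF_add[OF this isF_const[of 1]] show q: "isF qm" by simp
  show p: "isF pm" by (rule isF_Lop[OF q Lop_qm])
  have "isF (\<lambda>x. kap x - 8 * wm x - qm x)" by (rule isF_Lop[OF p Lop_pm])
  from isF_add[OF this q] show psi: "isF psi1" by (simp add: psi1_def[abs_def])
  define A where "A x = kap x * H x + (-8) * (m123 x - kap x / 2 * m 3 3 x)" for x
  have "Lop (\<lambda>x. kap x * 1 + (-8) * wm x) A" unfolding A_def[abs_def]
    by (intro Lop_add Lop_mult[OF along_kap] Lop_minors Lop_cmult Lop_wm)
  then have "Lop psi1 A" by (simp add: psi1_def[abs_def])
  then have A: "isF A" by (rule isF_Lop[OF psi])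
  define B where "B x = kap x * (qm x - 1) + (-8) * (- wm x - kap x / 2 * vm x)" for x
  have "Lop A B" unfolding A_def[abs_def] B_def[abs_def]
    by (intro Lop_add Lop_mult[OF along_kap] Lop_H Lop_cmult Lop_wm2)
  then have B: "isF B" by (rule isF_Lop[OF A])
  define C where "C x = kap x * qm x + 4 * (kap x * vm x)" for x
  have C: "isF C"
    by (rule isF_cong[OF isF_add[OF B psi]]) (simp add: B_def C_def psi1_def algebra_simps)
  define D where "D x = kap x * pm x + 4 * (kap x * (2 * m123 x - m 3 3 x))" for x
  have "Lop C D" unfolding C_def[abs_def] D_def[abs_def]
    by (intro Lop_add Lop_mult[OF along_kap] Lop_qm Lop_cmult Lop_vm)
  then have D: "isF D" by (rule isF_Lop[OF C])
  define E where "E x = kap x * (kap x - 8 * wm x - qm x) + 4 * (kap x * (- 2 * wm x - vm x))" for x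
  have "Lop D E" unfolding D_def[abs_def] E_def[abs_def]
    by (intro Lop_add Lop_mult[OF along_kap] Lop_pm Lop_cmult Lop_vm2)
  then have E: "isF E" by (rule isF_Lop[OF D])
  show "isF (\<lambda>x. 2 * kap x * psi1 x - kap x * kap x)"
    by (rule isF_cong[OF isF_add[OF E C]]) (simp add: E_def C_def psi1_def algebra_simps)
qed

text \<open>On \<open>reg'\<close> the value \<open>kap x\<close> is a root of a monic quadratic
  whose coefficients depend only on the level. At the other regular points one component of the
  normal is zero and \<open>kap\<close> vanishes, which accounts for the inserted 0.\<close>

lemma kap_finite: "finite (kap ` {x \<in> reg. F x = t})"
proof -
  obtain a b where ab: "\<And>x. x \<in> reg' \<Longrightarrow> psi1 x = a (F x)"
      "\<And>x. x \<in> reg' \<Longrightarrow> 2 * kap x * psi1 x - kap x * kap x = b (F x)"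
    using isF_facts unfolding isF_def by metis
  let ?P = "[:b t, - 2 * a t, 1:] :: real poly"
  have "kap ` {x \<in> reg. F x = t} \<subseteq> insert 0 {s. poly ?P s = 0}"
  proof
    fix s assume "s \<in> kap ` {x \<in> reg. F x = t}"
    then obtain x where x: "x \<in> reg" "F x = t" "s = kap x" by auto
    show "s \<in> insert 0 {s. poly ?P s = 0}"
    proof (cases "x \<in> reg'")
      case True
      then show ?thesis using ab[OF True] x by (simp add: algebra_simps)
    next
      case False
      then show ?thesis using x by (auto simp: reg'_def kap_def)
    qed
  qed
  moreover have "finite {s. poly ?P s = 0}" by (rule poly_roots_finite) simp
  ultimately show ?thesis by (meson finite_insert finite_subset)
qed

end

section \<open>Functions on level sets\<close>

text \<open>The chart \<open>\<theta> z = z + (h z - h x0 - a \<bullet> (z - x0)) *\<^sub>R e\<close> with \<open>a \<bullet> e = 1\<close> flattens the level set,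
  and its derivative at \<open>x0\<close> is the identity.\<close>
lemma level_set_chart:
  fixes h :: "'a::euclidean_space \<Rightarrow> real"
  assumes h: "C_inf_on U h" and x0: "x0 \<in> U" and a: "flat_grad h x0 \<noteq> 0"
  obtains W \<delta> \<theta> g g' where "open W" "x0 \<in> W" "W \<subseteq> U" "\<delta> > 0"
    "\<And>y. y \<in> ball x0 \<delta> \<Longrightarrow> g y \<in> W \<and> h (g y) = h x0 + flat_grad h x0 \<bullet> (y - x0)"
    "\<And>z. z \<in> W \<Longrightarrow> \<theta> z \<in> ball x0 \<delta> \<and> g (\<theta> z) = z"
    "\<And>y. y \<in> ball x0 \<delta> \<Longrightarrow> (g has_derivative g' y) (at y)"
    "g x0 = x0" "g' x0 = id"
proof -
  have oU: "open U" using h by (simp add: C_inf_on_def)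
  define a where "a = flat_grad h x0"
  have aa: "a \<bullet> a \<noteq> 0" using assms(3) by (simp add: a_def)
  define e where "e = (1 / (a \<bullet> a)) *\<^sub>R a"
  have ae: "a \<bullet> e = 1" using aa by (simp add: e_def)
  define \<theta> where "\<theta> z = z + (h z - h x0 - a \<bullet> (z - x0)) *\<^sub>R e" for z
  define T where "T z v = v + (dderiv h z v - a \<bullet> v) *\<^sub>R e" for z v
  have d: "(\<theta> has_derivative T z) (at z)" if "z \<in> U" for z
    unfolding \<theta>_def[abs_def] T_def[abs_def]
    by (auto intro!: derivative_eq_intros C_inf_on_has_derivative[OF h that])
  have bl: "bounded_linear (T z)" if "z \<in> U" for z using d[OF that] by (rule has_derivative_bounded_linear)
  have T0: "T x0 = id"
    using flat_grad_inner[OF C_inf_on_linear_dderiv[OF h x0]] by (simp add: T_def[abs_def] a_def id_def)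
  have "continuous_on U (\<lambda>z. Blinfun (T z))"
  proof (rule continuous_on_blinfun_componentwise)
    fix i :: 'a
    have "continuous_on U (\<lambda>z. T z i)"
      unfolding T_def by (intro continuous_intros C_inf_on_continuous_on C_inf_on_dderiv_const h)
    then show "continuous_on U (\<lambda>z. blinfun_apply (Blinfun (T z)) i)"
      by (rule continuous_on_eq) (simp add: bounded_linear_Blinfun_apply bl)
  qed
  moreover have "id_blinfun o\<^sub>L Blinfun (T x0) = id_blinfun"
    by (rule blinfun_eqI) (simp add: T0 bounded_linear_Blinfun_apply bl x0 id_def)
  moreover have "(\<theta> has_derivative blinfun_apply (Blinfun (T z))) (at z)" if "z \<in> U" for z
    using d[OF that] by (simp add: bounded_linear_Blinfun_apply bl[OF that])
  ultimately obtain U' V g g' where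
    1: "open U'" "U' \<subseteq> U" "x0 \<in> U'" "open V" "\<theta> x0 \<in> V" "homeomorphism U' V \<theta> g"
    "\<And>y. y \<in> V \<Longrightarrow> (g has_derivative g' y) (at y)"
    "\<And>y. y \<in> V \<Longrightarrow> g' y = inv (blinfun_apply (Blinfun (T (g y))))"
    using inverse_function_theorem[OF oU _ _ x0] by metis
  have th0: "\<theta> x0 = x0" by (simp add: \<theta>_def)
  have g0: "g x0 = x0" using homeomorphism_apply1[OF 1(6,3)] by (simp add: th0)
  have "blinfun_apply (Blinfun (T x0)) = id"
    using bounded_linear_Blinfun_apply[OF bl[OF x0]] T0 by simp
  then have g'0: "g' x0 = id"
    using 1(8)[OF 1(5)] by (simp add: th0 g0)
  obtain \<delta> where \<delta>: "\<delta> > 0" "ball x0 \<delta> \<subseteq> V" using 1(4,5) th0 open_contains_ball by metis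
  define W where "W = U' \<inter> \<theta> -` ball x0 \<delta>"
  have "continuous_on U' \<theta>" using 1(6) by (simp add: homeomorphism_def)
  then have "open W" unfolding W_def using continuous_on_open_vimage[OF 1(1)] by (metis Int_commute open_ball)
  have gW: "g y \<in> W \<and> \<theta> (g y) = y" if "y \<in> ball x0 \<delta>" for y
  proof -
    have y: "y \<in> V" using that \<delta> by blast
    have "\<theta> (g y) = y" "g y \<in> U'" using 1(6) y by (auto simp: homeomorphism_def)
    then show ?thesis using that by (simp add: W_def)
  qed
  \<comment> \<open>In the chart \<open>h\<close> becomes affine because
    \<open>a \<bullet> e = 1\<close>; its level set is a piece of a hyperplane orthogonal to
    \<open>a\<close>.\<close>
  have hg: "h z = h x0 + a \<bullet> (\<theta> z - x0)" for z
  proof -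
    have "a \<bullet> (\<theta> z - x0) = a \<bullet> (z - x0) + (h z - h x0 - a \<bullet> (z - x0)) * (a \<bullet> e)"
      by (simp add: \<theta>_def inner_diff_right inner_add_right)
    then show ?thesis by (simp add: ae)
  qed
  show thesis
  proof (rule that[of W \<delta> g \<theta> g'])
    show "x0 \<in> W" using 1(3) \<delta>(1) th0 by (simp add: W_def)
    show "g y \<in> W \<and> h (g y) = h x0 + flat_grad h x0 \<bullet> (y - x0)" if "y \<in> ball x0 \<delta>" for y
      using gW[OF that] hg[of "g y"] by (simp add: a_def)
    show "\<theta> z \<in> ball x0 \<delta> \<and> g (\<theta> z) = z" if "z \<in> W" for z
      using that homeomorphism_apply1[OF 1(6)] by (auto simp: W_def)
  qed (use \<open>open W\<close> 1 \<delta> g0 g'0 in \<open>auto simp: W_def\<close>)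
qed

text \<open>The chart carries the straight line through \<open>x0\<close> in direction
  \<open>v\<close> to a curve in the level set with velocity \<open>v\<close>, and \<open>K\<close>
  is constant along that curve.\<close>

lemma level_set_constant_derivative:
  fixes h :: "'a::euclidean_space \<Rightarrow> real" and K :: "'a \<Rightarrow> 'b::real_normed_vector"
  assumes h: "C_inf_on U h" "x0 \<in> U" "flat_grad h x0 \<noteq> 0"
    and K: "(K has_derivative K') (at x0)" "\<And>z. z \<in> U \<Longrightarrow> h z = h x0 \<Longrightarrow> K z = K x0"
    and v: "dderiv h x0 v = 0"
  shows "K' v = 0"
proof -
  obtain W \<delta> \<theta> g g' where c: "W \<subseteq> U" "\<delta> > 0"
    "\<And>y. y \<in> ball x0 \<delta> \<Longrightarrow> g y \<in> W \<and> h (g y) = h x0 + flat_grad h x0 \<bullet> (y - x0)"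
    "\<And>y. y \<in> ball x0 \<delta> \<Longrightarrow> (g has_derivative g' y) (at y)" "g x0 = x0" "g' x0 = id"
    using level_set_chart[OF h] by metis
  have av: "flat_grad h x0 \<bullet> v = 0"
    using flat_grad_inner[OF C_inf_on_linear_dderiv[OF h(1,2)]] v by simp
  let ?l = "\<lambda>s::real. x0 + s *\<^sub>R v"
  have l: "(?l has_derivative (\<lambda>s. s *\<^sub>R v)) (at 0)" by (auto intro!: derivative_eq_intros)
  have "(g has_derivative id) (at (?l 0))" using c(4)[of x0] c(2,6) by simp
  from has_derivative_compose[OF l this]
  have "((\<lambda>s. g (?l s)) has_derivative (\<lambda>s. s *\<^sub>R v)) (at 0)" by simp
  from has_derivative_compose[OF this] K(1)
  have "((\<lambda>s. K (g (?l s))) has_derivative (\<lambda>s. K' (s *\<^sub>R v))) (at 0)" by (simp add: c(5))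
  moreover have "((\<lambda>s. K (g (?l s))) has_derivative (\<lambda>s. 0)) (at 0)"
  proof (rule has_derivative_transform_within_open[OF has_derivative_const[of "K x0"]])
    show "open (?l -` ball x0 \<delta>)" by (intro open_vimage open_ball continuous_intros)
    show "0 \<in> ?l -` ball x0 \<delta>" using c(2) by simp
    fix s assume "s \<in> ?l -` ball x0 \<delta>"
    then have "g (?l s) \<in> U" "h (g (?l s)) = h x0" using c(3)[of "?l s"] c(1) av by auto
    then show "K x0 = K (g (?l s))" using K(2) by simp
  qed
  ultimately have "(\<lambda>s. K' (s *\<^sub>R v)) = (\<lambda>s. 0)" by (rule has_derivative_unique)
  from fun_cong[OF this, of 1] show ?thesis by simp
qed

text \<open>In the chart the level set is a flat disc, so any of its points is joined to
  \<open>x0\<close> by a segment. As \<open>h\<close> is affine in the chart, the image of the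
  segment has velocity in the kernel of the derivative of \<open>h\<close>, where the derivative of
  \<open>K\<close> vanishes.\<close>

lemma level_set_locally_constant:
  fixes h :: "'a::euclidean_space \<Rightarrow> real" and K :: "'a \<Rightarrow> 'b::real_normed_vector"
  assumes h: "C_inf_on U h" "x0 \<in> U" "flat_grad h x0 \<noteq> 0"
    and K: "\<And>z. z \<in> U \<Longrightarrow> h z = h x0 \<Longrightarrow>
      \<exists>L. (K has_derivative L) (at z) \<and> (\<forall>v. dderiv h z v = 0 \<longrightarrow> L v = 0)"
  obtains W where "open W" "x0 \<in> W" "\<And>z. z \<in> W \<Longrightarrow> h z = h x0 \<Longrightarrow> K z = K x0"
proof -
  obtain W \<delta> \<theta> g g' where c: "open W" "x0 \<in> W" "W \<subseteq> U" "\<delta> > 0"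
    "\<And>y. y \<in> ball x0 \<delta> \<Longrightarrow> g y \<in> W \<and> h (g y) = h x0 + flat_grad h x0 \<bullet> (y - x0)"
    "\<And>z. z \<in> W \<Longrightarrow> \<theta> z \<in> ball x0 \<delta> \<and> g (\<theta> z) = z"
    "\<And>y. y \<in> ball x0 \<delta> \<Longrightarrow> (g has_derivative g' y) (at y)" "g x0 = x0"
    using level_set_chart[OF h] by metis
  let ?a = "flat_grad h x0"
  have "K z = K x0" if z: "z \<in> W" "h z = h x0" for z
  proof -
    define y where "y = \<theta> z"
    have y: "y \<in> ball x0 \<delta>" "g y = z" using c(6)[OF z(1)] by (auto simp: y_def)
    then have ay: "?a \<bullet> (y - x0) = 0" using c(5)[OF y(1)] z(2) by simp
    let ?l = "\<lambda>s::real. x0 + s *\<^sub>R (y - x0)"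
    have lb: "?l s \<in> ball x0 \<delta>" if "s \<in> {0..1}" for s
    proof -
      have "norm (s *\<^sub>R (y - x0)) \<le> 1 * norm (y - x0)"
        using that by (simp only: norm_scaleR) (intro mult_right_mono; auto)
      then show ?thesis using y(1) by (simp add: dist_norm norm_minus_commute)
    qed
    have "((\<lambda>s. K (g (?l s))) has_derivative (\<lambda>s. 0)) (at s within {0..1})" if s: "s \<in> {0..1}" for s
    proof -
      have l: "(?l has_derivative (\<lambda>s. s *\<^sub>R (y - x0))) (at s)" by (auto intro!: derivative_eq_intros)
      note gl = has_derivative_compose[OF l c(7)[OF lb[OF s]]]
      have gU: "g (?l s) \<in> U" "h (g (?l s)) = h x0" using c(5)[OF lb[OF s]] c(3) ay by auto
      obtain L where L: "(K has_derivative L) (at (g (?l s)))" "\<And>v. dderiv h (g (?l s)) v = 0 \<Longrightarrow> L v = 0"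
        using K[OF gU] by blast
      have "((\<lambda>y. h (g y)) has_derivative (\<lambda>v. dderiv h (g (?l s)) (g' (?l s) v))) (at (?l s))"
        by (rule has_derivative_compose[OF c(7)[OF lb[OF s]] C_inf_on_has_derivative[OF h(1) gU(1)]])
      moreover have "((\<lambda>y. h (g y)) has_derivative (\<lambda>v. ?a \<bullet> v)) (at (?l s))"
      proof (rule has_derivative_transform_within_open[OF _ open_ball lb[OF s]])
        show "((\<lambda>y. h x0 + ?a \<bullet> (y - x0)) has_derivative (\<lambda>v. ?a \<bullet> v)) (at (?l s))"
          by (auto intro!: derivative_eq_intros)
      qed (use c(5) in simp)
      ultimately have "(\<lambda>v. dderiv h (g (?l s)) (g' (?l s) v)) = (\<lambda>v. ?a \<bullet> v)"
        by (rule has_derivative_unique)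
      then have "dderiv h (g (?l s)) (g' (?l s) (r *\<^sub>R (y - x0))) = 0" for r
        using ay by (metis inner_scaleR_right mult_zero_right)
      then have "L (g' (?l s) (r *\<^sub>R (y - x0))) = 0" for r by (rule L(2))
      then show ?thesis
        using has_derivative_at_withinI[OF has_derivative_compose[OF gl L(1)]] by simp
    qed
    from has_derivative_zero_constant[OF _ this]
    obtain k where "\<And>s. s \<in> {0..1} \<Longrightarrow> K (g (?l s)) = k" by auto
    from this[of 0] this[of 1] show ?thesis by (simp add: y c(8))
  qed
  then show thesis using that c(1,2) by blast
qed

text \<open>Both functions are strictly monotone along \<open>n\<close>, so each line in direction \<open>n\<close> near
  \<open>x0\<close> meets either level set exactly once.\<close>
lemma level_set_contains:
  fixes h k :: "'a::euclidean_space \<Rightarrow> real"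
  assumes h: "C_inf_on U h" and k: "C_inf_on U k" and x0: "x0 \<in> U"
    and nh: "dderiv h x0 n \<noteq> 0" and nk: "dderiv k x0 n \<noteq> 0"
    and hk: "\<And>z. z \<in> U \<Longrightarrow> h z = h x0 \<Longrightarrow> k z = k x0"
  obtains W where "open W" "x0 \<in> W" "\<And>z. z \<in> W \<Longrightarrow> k z = k x0 \<Longrightarrow> h z = h x0"
proof -
  have oU: "open U" using h by (simp add: C_inf_on_def)
  \<comment> \<open>The sign makes \<open>h\<close> increase along \<open>p\<close>; for
    \<open>k\<close> a derivative without zeros will be enough.\<close>
  define p where "p = sgn (dderiv h x0 n) *\<^sub>R n"
  have ph: "dderiv h x0 p > 0" and pk: "dderiv k x0 p \<noteq> 0"
    using nh nk linear_scale[OF C_inf_on_linear_dderiv[OF h x0]] linear_scale[OF C_inf_on_linear_dderiv[OF k x0]]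
    by (auto simp: p_def sgn_if)
  have lin: "((\<lambda>s. q (z + s *\<^sub>R p)) has_real_derivative dderiv q (z + s *\<^sub>R p) p) (at s)"
    if q: "C_inf_on U q" and z: "z + s *\<^sub>R p \<in> U" for q z s
  proof -
    have l: "((\<lambda>s. z + s *\<^sub>R p) has_derivative (\<lambda>s. s *\<^sub>R p)) (at s)" by (auto intro!: derivative_eq_intros)
    have "(\<lambda>r. dderiv q (z + s *\<^sub>R p) (r *\<^sub>R p)) = (*) (dderiv q (z + s *\<^sub>R p) p)"
      by (rule ext) (simp add: linear_scale[OF C_inf_on_linear_dderiv[OF q z]] mult.commute)
    then show ?thesis
      unfolding has_field_derivative_def using has_derivative_compose[OF l C_inf_on_has_derivative[OF q z]] by simp
  qed
  have cont: "continuous_on U (\<lambda>z. dderiv q z p)" if "C_inf_on U q" for q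
    by (intro C_inf_on_continuous_on C_inf_on_dderiv_const that)
  have "open (U \<inter> (\<lambda>z. dderiv h z p) -` {0<..})" "open (U \<inter> (\<lambda>z. dderiv k z p) -` (- {0}))"
    using continuous_on_open_vimage[OF oU] cont[OF h] cont[OF k]
    by (metis Int_commute open_Compl closed_singleton open_greaterThan)+
  then have "open ((U \<inter> (\<lambda>z. dderiv h z p) -` {0<..}) \<inter> (U \<inter> (\<lambda>z. dderiv k z p) -` (- {0})))"
    by (rule open_Int)
  moreover have "x0 \<in> (U \<inter> (\<lambda>z. dderiv h z p) -` {0<..}) \<inter> (U \<inter> (\<lambda>z. dderiv k z p) -` (- {0}))"
    using x0 ph pk by simp
  ultimately obtain r where r: "r > 0"
    "ball x0 r \<subseteq> (U \<inter> (\<lambda>z. dderiv h z p) -` {0<..}) \<inter> (U \<inter> (\<lambda>z. dderiv k z p) -` (- {0}))"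
    using open_contains_ball by metis
  then have rb: "z \<in> U" "dderiv h z p > 0" "dderiv k z p \<noteq> 0" if "z \<in> ball x0 r" for z
    using that by blast+
  \<comment> \<open>Points of the half-size ball can be moved by up to \<open>\<delta>\<close> along
    \<open>p\<close> without leaving the ball on which both derivatives are controlled.\<close>
  define \<delta> where "\<delta> = r / (2 * (norm p + 1))"
  have np: "norm p + 1 > 0" by (smt (verit) norm_ge_zero)
  have \<delta>: "\<delta> > 0" "\<delta> * norm p < r / 2"
  proof -
    show "\<delta> > 0" using r(1) np by (simp add: \<delta>_def)
    then have "\<delta> * norm p < \<delta> * (norm p + 1)" by simp
    also have "\<dots> = r / 2" using np by (simp add: \<delta>_def field_simps)
    finally show "\<delta> * norm p < r / 2" .
  qed
  have inb: "z + s *\<^sub>R p \<in> ball x0 r" if "z \<in> ball x0 (r/2)" "\<bar>s\<bar> \<le> \<delta>" for z s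
  proof -
    have "norm (x0 - (z + s *\<^sub>R p)) \<le> norm (x0 - z) + norm (s *\<^sub>R p)"
      by (metis diff_diff_eq norm_triangle_ineq4)
    also have "norm (s *\<^sub>R p) \<le> \<delta> * norm p" using that by (simp add: mult_right_mono)
    finally show ?thesis using that \<delta>(2) by (simp add: dist_norm)
  qed
  have x0b: "x0 \<in> ball x0 (r/2)" using r(1) by simp
  have dh: "((\<lambda>s. h (x0 + s *\<^sub>R p)) has_real_derivative dderiv h (x0 + s *\<^sub>R p) p) (at s)" if "\<bar>s\<bar> \<le> \<delta>" for s
    by (rule lin[OF h rb(1)[OF inb[OF x0b that]]])
  have inc: "\<exists>y. ((\<lambda>s. h (x0 + s *\<^sub>R p)) has_real_derivative y) (at s) \<and> 0 < y" if "\<bar>s\<bar> \<le> \<delta>" for s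
    using dh[OF that] rb(2)[OF inb[OF x0b that]] by blast
  have up: "h (x0 + 0 *\<^sub>R p) < h (x0 + \<delta> *\<^sub>R p)"
    by (rule DERIV_pos_imp_increasing[OF \<delta>(1), of "\<lambda>s. h (x0 + s *\<^sub>R p)"]) (rule inc, simp)
  have down: "h (x0 + (-\<delta>) *\<^sub>R p) < h (x0 + 0 *\<^sub>R p)"
    by (rule DERIV_pos_imp_increasing[of "-\<delta>" 0 "\<lambda>s. h (x0 + s *\<^sub>R p)"])
      (use \<delta>(1) in simp, rule inc, simp)
  have hc: "continuous_on (ball x0 (r/2)) (\<lambda>z. h (z + s *\<^sub>R p))" if "\<bar>s\<bar> \<le> \<delta>" for s
    by (rule continuous_on_compose2[OF C_inf_on_continuous_on[OF h]])
      (use inb that rb(1) in \<open>auto intro!: continuous_intros simp del: mem_ball\<close>)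
  \<comment> \<open>For points of \<open>W\<close> the segment along \<open>p\<close> runs from
    below the value \<open>h x0\<close> to above it, so it meets the level set of \<open>h\<close>.
    There \<open>k\<close> takes the value it has at \<open>z\<close>, and strict monotonicity
    forces the meeting point to be \<open>z\<close>.\<close>
  define W where "W = (ball x0 (r/2) \<inter> (\<lambda>z. h (z + \<delta> *\<^sub>R p)) -` {h x0<..}) \<inter> (ball x0 (r/2) \<inter> (\<lambda>z. h (z + (-\<delta>) *\<^sub>R p)) -` {..<h x0})"
  have "open W" unfolding W_def
    by (intro open_Int continuous_open_preimage hc) (use \<delta> in auto)
  moreover have "x0 \<in> W" using x0b up down by (simp add: W_def)
  moreover have "h z = h x0" if z: "z \<in> W" "k z = k x0" for z
  proof -
    have zb: "z \<in> ball x0 (r/2)" and zu: "h (z + \<delta> *\<^sub>R p) > h x0" and zd: "h (z + (-\<delta>) *\<^sub>R p) < h x0"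
      using z(1) by (auto simp: W_def)
    have "\<exists>s\<ge>-\<delta>. s \<le> \<delta> \<and> h (z + s *\<^sub>R p) = h x0"
    proof (rule IVT')
      show "continuous_on {-\<delta>..\<delta>} (\<lambda>s. h (z + s *\<^sub>R p))"
        by (rule DERIV_continuous_on[OF has_field_derivative_at_within[OF lin[OF h rb(1)[OF inb[OF zb]]]]]) auto
    qed (use zu zd \<delta> in auto)
    then obtain s where "- \<delta> \<le> s" "s \<le> \<delta>" and hs: "h (z + s *\<^sub>R p) = h x0" by blast
    then have s: "\<bar>s\<bar> \<le> \<delta>" "h (z + s *\<^sub>R p) = h x0" by simp_all
    have ks: "k (z + s *\<^sub>R p) = k (z + 0 *\<^sub>R p)" using hk[OF rb(1)[OF inb[OF zb s(1)]] s(2)] z(2) by simp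
    have dk: "((\<lambda>s. k (z + s *\<^sub>R p)) has_real_derivative dderiv k (z + r *\<^sub>R p) p) (at r)"
      if "\<bar>r\<bar> \<le> \<delta>" for r by (rule lin[OF k rb(1)[OF inb[OF zb that]]])
    have "s = 0"
    proof (rule ccontr)
      assume "s \<noteq> 0"
      then have lt: "min 0 s < max 0 s" by auto
      have "((\<lambda>s. k (z + s *\<^sub>R p)) has_real_derivative dderiv k (z + c *\<^sub>R p) p) (at c)"
        if "min 0 s \<le> c" "c \<le> max 0 s" for c by (rule dk) (use that s(1) in linarith)
      from MVT2[OF lt this] obtain c where c: "min 0 s < c" "c < max 0 s"
        "k (z + max 0 s *\<^sub>R p) - k (z + min 0 s *\<^sub>R p) = (max 0 s - min 0 s) * dderiv k (z + c *\<^sub>R p) p"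
        by blast
      then have "\<bar>c\<bar> \<le> \<delta>" "dderiv k (z + c *\<^sub>R p) p = 0"
        using ks s(1) by (auto simp: min_def max_def split: if_splits)
      then show False using rb(3)[OF inb[OF zb]] by blast
    qed
    then show ?thesis using s(2) by simp
  qed
  ultimately show thesis using that by blast
qed

section \<open>Calculus on a connected regular level set\<close>

locale isoparametric_level = isoparametric +
  fixes t0 :: real and M :: "r33 set"
  assumes f_pos: "f t0 > 0" and M_eq: "M = {x \<in> S2xS2. F x = t0}" and conn: "connected M"
begin

lemma M_reg: "x \<in> M \<Longrightarrow> x \<in> reg"
  using S2xS2_subset_off_axes f_pos by (auto simp: M_eq reg_def \<Omega>_def Ft_eq)

lemma MD: "x \<in> M \<Longrightarrow> x \<in> \<Omega>" "x \<in> M \<Longrightarrow> x \<in> S2xS2" "x \<in> M \<Longrightarrow> x \<in> off_axes" "x \<in> M \<Longrightarrow> F x = t0" "x \<in> M \<Longrightarrow> Ft x = t0"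
  using M_reg[of x] regD[of x] by (auto simp: M_eq Ft_eq)

lemma retract_in_M: "z \<in> \<Omega> \<Longrightarrow> Ft z = t0 \<Longrightarrow> sphere_retract z \<in> M"
  using sphere_retract_in[of z] \<Omega>_subset by (auto simp: M_eq Ft_def)

lemma flat_grad_Ft_nonzero: "x \<in> M \<Longrightarrow> flat_grad Ft x \<noteq> 0"
  using G_norm[of x] MD[of x] f_pos by (auto simp: G_def)

lemma Ft_kernel: "x \<in> M \<Longrightarrow> dderiv Ft x v = 0 \<longleftrightarrow> N x \<bullet> v = 0"
  using dFt[of x v] MD[of x] f_pos by auto

lemma retract_derivative: "z \<in> off_axes \<Longrightarrow> (sphere_retract has_derivative dderiv sphere_retract z) (at z)"
  by (rule C_inf_on_has_derivative[OF C_inf_on_sphere_retract])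

text \<open>Composed with the retraction, \<open>K\<close> becomes constant on a level set of
  \<open>Ft\<close> in the open set \<open>\<Omega>\<close>, where
  \<open>level_set_constant_derivative\<close> applies; on tangent vectors the retraction has the
  identity as derivative.\<close>

lemma M_constant_derivative:
  fixes K :: "r33 \<Rightarrow> 'b::real_normed_vector"
  assumes x: "x \<in> M" and K: "(K has_derivative K') (at x)" "\<And>y. y \<in> M \<Longrightarrow> K y = c"
    and v: "v \<in> tangent_space x" "N x \<bullet> v = 0"
  shows "K' v = 0"
proof -
  note xx = MD[OF x]
  have r: "sphere_retract x = x" by (rule sphere_retract_id[OF xx(2)])
  have "((\<lambda>z. K (sphere_retract z)) has_derivative (\<lambda>v. K' (dderiv sphere_retract x v))) (at x)"
    using has_derivative_compose[OF retract_derivative[OF xx(3)], of K K'] K(1) r by simp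
  then have "K' (dderiv sphere_retract x v) = 0"
  proof (rule level_set_constant_derivative[OF Ft_smooth_\<Omega> xx(1) flat_grad_Ft_nonzero[OF x]])
    fix z assume "z \<in> \<Omega>" "Ft z = Ft x"
    then show "K (sphere_retract z) = K (sphere_retract x)"
      using K(2)[OF retract_in_M[of z]] K(2)[OF x] xx(5) r by simp
  qed (use Ft_kernel[OF x] v(2) in simp)
  then show ?thesis using dderiv_sphere_retract_tangent[OF xx(2) v(1)] by simp
qed

text \<open>Since \<open>Ft\<close> is unchanged by the retraction, the derivative of the retraction
  maps the kernel of the derivative of \<open>Ft\<close> into the tangent space of \<open>M\<close>.
  Thus \<open>K\<close> after retraction is locally constant on the level set of \<open>Ft\<close>,
  and connectedness of \<open>M\<close> finishes.\<close>

lemma M_constant: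
  fixes K :: "r33 \<Rightarrow> 'b::real_normed_vector"
  assumes K: "\<And>x. x \<in> M \<Longrightarrow> \<exists>L. (K has_derivative L) (at x) \<and>
      (\<forall>v. v \<in> tangent_space x \<longrightarrow> N x \<bullet> v = 0 \<longrightarrow> L v = 0)"
    and xy: "x \<in> M" "y \<in> M"
  shows "K x = K y"
proof -
  have "K constant_on M"
  proof (rule locally_constant_imp_constant[OF conn])
    fix a assume a: "a \<in> M"
    note aa = MD[OF a]
    have "\<exists>L. ((\<lambda>z. K (sphere_retract z)) has_derivative L) (at z) \<and> (\<forall>v. dderiv Ft z v = 0 \<longrightarrow> L v = 0)"
      if z: "z \<in> \<Omega>" "Ft z = Ft a" for z
    proof -
      have zo: "z \<in> off_axes" using z(1) \<Omega>_subset by blast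
      have rM: "sphere_retract z \<in> M" using retract_in_M z aa(5) by simp
      obtain L where L: "(K has_derivative L) (at (sphere_retract z))"
        "\<And>v. v \<in> tangent_space (sphere_retract z) \<Longrightarrow> N (sphere_retract z) \<bullet> v = 0 \<Longrightarrow> L v = 0"
        using K[OF rM] by blast
      have "((\<lambda>y. Ft (sphere_retract y)) has_derivative (\<lambda>v. dderiv Ft (sphere_retract z) (dderiv sphere_retract z v))) (at z)"
        by (rule has_derivative_compose[OF retract_derivative[OF zo] Ft_derivative[OF MD(3)[OF rM]]])
      moreover have "((\<lambda>y. Ft (sphere_retract y)) has_derivative dderiv Ft z) (at z)"
        by (rule has_derivative_transform_within_open[OF Ft_derivative[OF zo] open_off_axes zo])
          (simp add: Ft_retract)
      ultimately have e: "(\<lambda>v. dderiv Ft (sphere_retract z) (dderiv sphere_retract z v)) = dderiv Ft z"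
        by (rule has_derivative_unique)
      have "L (dderiv sphere_retract z v) = 0" if "dderiv Ft z v = 0" for v
      proof (rule L(2)[OF dderiv_sphere_retract_in_tangent_space[OF zo]])
        show "N (sphere_retract z) \<bullet> dderiv sphere_retract z v = 0"
          using fun_cong[OF e, of v] that Ft_kernel[OF rM] by simp
      qed
      then show ?thesis
        using has_derivative_compose[OF retract_derivative[OF zo] L(1)] by blast
    qed
    from level_set_locally_constant[OF Ft_smooth_\<Omega> aa(1) flat_grad_Ft_nonzero[OF a] this]
    obtain W where W: "open W" "a \<in> W"
      "\<And>z. z \<in> W \<Longrightarrow> Ft z = Ft a \<Longrightarrow> K (sphere_retract z) = K (sphere_retract a)" by blast
    show "\<exists>T. openin (top_of_set M) T \<and> a \<in> T \<and> (\<forall>x\<in>T. K x = K a)"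
    proof (intro exI[of _ "M \<inter> W"] conjI ballI)
      fix x assume "x \<in> M \<inter> W"
      then show "K x = K a"
        using W(3)[of x] MD(5)[of x] aa(5) sphere_retract_id[OF MD(2)[of x]] sphere_retract_id[OF aa(2)] by simp
    qed (use W a in auto)
  qed
  then show ?thesis using xy unfolding constant_on_def by metis
qed

text \<open>Openness of \<open>M\<close> in the level set of \<open>u\<close> comes from
  \<open>level_set_contains\<close> in direction \<open>N a\<close>: both \<open>Ft\<close> and
  \<open>u\<close> after retraction have nonzero derivative there. This is the purpose of the
  condition on \<open>dderiv u\<close>.\<close>

lemma M_eq_level_set:
  fixes u :: "r33 \<Rightarrow> real"
  assumes u: "C_inf_on UNIV u" and M: "\<And>x. x \<in> M \<Longrightarrow> u x = t"
    and n: "\<And>x. x \<in> M \<Longrightarrow> dderiv u x (N x) \<noteq> 0"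
    and M': "connected {x \<in> S2xS2. u x = t}" and ne: "M \<noteq> {}"
  shows "M = {x \<in> S2xS2. u x = t}"
proof -
  let ?M = "{x \<in> S2xS2. u x = t}"
  have sub: "M \<subseteq> ?M" using M MD by blast
  have "closedin (top_of_set ?M) M"
  proof -
    have "closed (S2xS2 \<inter> Ft -` {t0})"
      by (rule continuous_closed_preimage)
        (auto intro!: continuous_on_subset[OF C_inf_on_continuous_on[OF Ft_smooth] S2xS2_subset_off_axes] closed_Times)
    then have "closedin (top_of_set ?M) (?M \<inter> (S2xS2 \<inter> Ft -` {t0}))"
      by (rule closedin_closed_Int)
    moreover have "?M \<inter> (S2xS2 \<inter> Ft -` {t0}) = M" using sub by (auto simp: M_eq Ft_eq)
    ultimately show ?thesis by (simp only:)
  qed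
  moreover have "openin (top_of_set ?M) M"
  proof (subst openin_subopen, intro ballI)
    fix a assume a: "a \<in> M"
    note aa = MD[OF a]
    have ra: "sphere_retract a = a" by (rule sphere_retract_id[OF aa(2)])
    have k: "C_inf_on \<Omega> (\<lambda>z. u (sphere_retract z))"
      using C_inf_on_compose[OF u C_inf_on_subset[OF C_inf_on_sphere_retract open_\<Omega> \<Omega>_subset]] by simp
    have "((\<lambda>z. u (sphere_retract z)) has_derivative (\<lambda>v. dderiv u a (dderiv sphere_retract a v))) (at a)"
      using has_derivative_compose[OF retract_derivative[OF aa(3)] C_inf_on_has_derivative[OF u]] ra by simp
    then have nk: "dderiv (\<lambda>z. u (sphere_retract z)) a (N a) \<noteq> 0"
      using n[OF a] dderiv_sphere_retract_tangent[OF aa(2) N_tangent[OF aa(1)]] by (simp add: dderiv_eq)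
    have nh: "dderiv Ft a (N a) \<noteq> 0"
      using Ft_kernel[OF a, of "N a"] N_unit[OF M_reg[OF a]] by simp
    have hk: "u (sphere_retract z) = u (sphere_retract a)" if "z \<in> \<Omega>" "Ft z = Ft a" for z
      using M[OF retract_in_M[of z]] M[OF a] aa(5) ra that by simp
    obtain W where W: "open W" "a \<in> W"
      "\<And>z. z \<in> W \<Longrightarrow> u (sphere_retract z) = u (sphere_retract a) \<Longrightarrow> Ft z = Ft a"
      using level_set_contains[OF Ft_smooth_\<Omega> k aa(1) nh nk hk] by blast
    show "\<exists>T. openin (top_of_set ?M) T \<and> a \<in> T \<and> T \<subseteq> M"
    proof (intro exI[of _ "?M \<inter> W"] conjI subsetI)
      fix x assume x: "x \<in> ?M \<inter> W"
      then have "sphere_retract x = x" using sphere_retract_id by blast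
      then show "x \<in> M" using W(3)[of x] x ra M[OF a] aa(5) by (auto simp: M_eq Ft_eq)
    qed (use W a sub in auto)
  qed
  ultimately show ?thesis using M' ne unfolding connected_clopen by blast
qed

end

section \<open>The case of a normal with two nonzero components\<close>

lemma double_cross:
  fixes p n :: "real^3"
  assumes "p \<bullet> p = 1" "p \<bullet> n = 0"
  shows "cross3 p (cross3 p n) = - n" "cross3 (cross3 p n) n = - (n \<bullet> n) *\<^sub>R p"
proof -
  have "cross3 p (cross3 p n) = (p \<bullet> n) *\<^sub>R p - (p \<bullet> p) *\<^sub>R n"
    "cross3 (cross3 p n) n = (p \<bullet> n) *\<^sub>R n - (n \<bullet> n) *\<^sub>R p"
    by (simp_all add: cross3_simps forall_3)
  then show "cross3 p (cross3 p n) = - n" "cross3 (cross3 p n) n = - (n \<bullet> n) *\<^sub>R p"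
    using assms by simp_all
qed

context isoparametric_level
begin

text \<open>Connectedness is used twice: first \<open>kap\<close> is constant, having finitely many
  values; then \<open>r1\<close> is a continuous root of \<open>4 s^2 - 4 s + k\<close>, hence
  constant as well.\<close>

lemma r1_constant:
  assumes "M \<noteq> {}" obtains \<rho> where "0 \<le> \<rho>" "\<rho> \<le> 1" "\<And>x. x \<in> M \<Longrightarrow> r1 x = \<rho> \<and> r2 x = 1 - \<rho>"
proof -
  have cN: "continuous_on M N"
    using C_inf_on_continuous_on[OF N_smooth] MD(1) continuous_on_subset by blast
  have c: "continuous_on M r1" "continuous_on M kap"
    unfolding kap_def r1_def r2_def by (intro continuous_intros cN)+
  have "kap ` M \<subseteq> kap ` {x \<in> reg. F x = t0}" using M_reg MD(4) by blast
  then have "kap constant_on M"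
    using continuous_finite_range_constant[OF conn c(2)] finite_subset kap_finite by blast
  then obtain k where k: "\<And>x. x \<in> M \<Longrightarrow> kap x = k" unfolding constant_on_def by blast
  have "r1 ` M \<subseteq> {s. poly [:k, -4, 4:] s = 0}"
  proof
    fix s assume "s \<in> r1 ` M"
    then obtain x where x: "x \<in> M" "s = r1 x" by blast
    have e: "r2 x = 1 - r1 x" using r_sum[OF M_reg[OF x(1)]] by simp
    show "s \<in> {s. poly [:k, -4, 4:] s = 0}"
      unfolding x(2) k[OF x(1), symmetric] by (simp add: kap_def e) (simp add: algebra_simps)
  qed
  moreover have "finite {s. poly [:k, -4, 4:] s = 0}" by (rule poly_roots_finite) simp
  ultimately have "r1 constant_on M"
    using continuous_finite_range_constant[OF conn c(1)] finite_subset by blast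
  then obtain \<rho> where r: "\<And>x. x \<in> M \<Longrightarrow> r1 x = \<rho>" unfolding constant_on_def by blast
  obtain x where x: "x \<in> M" using assms by blast
  show thesis
  proof (rule that[of \<rho>])
    show "0 \<le> \<rho>" "\<rho> \<le> 1" using r[OF x] r_nonneg[of x] r_sum[OF M_reg[OF x]] by linarith+
    show "r1 y = \<rho> \<and> r2 y = 1 - \<rho>" if "y \<in> M" for y
      using r[OF that] r_sum[OF M_reg[OF that]] by simp
  qed
qed

end

locale isoparametric_mixed = isoparametric_level +
  fixes \<rho> :: real
  assumes ne: "M \<noteq> {}" and \<rho>: "0 < \<rho>" "\<rho> < 1" and r: "\<And>x. x \<in> M \<Longrightarrow> r1 x = \<rho> \<and> r2 x = 1 - \<rho>"
begin

lemma M_reg': "x \<in> M \<Longrightarrow> x \<in> reg'"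
  using M_reg r \<rho> by (auto simp: reg'_def)

text \<open>These are half the derivatives of \<open>r1\<close> and \<open>r2\<close>, which vanish
  along \<open>M\<close> by constancy and along the normal by \<open>r_derivative_N\<close>.\<close>

lemma DN_N_components:
  assumes x: "x \<in> M" and v: "v \<in> tangent_space x"
  shows "fst (DN x v) \<bullet> N1 x = 0" "snd (DN x v) \<bullet> N2 x = 0"
proof -
  note xx = MD[OF x] and xr = M_reg[OF x]
  let ?w = "v - (N x \<bullet> v) *\<^sub>R N x"
  have w: "?w \<in> tangent_space x"
    using v N_tangent[OF xx(1)] subspace_tangent_space by (simp add: subspace_diff subspace_scale)
  have "N x \<bullet> ?w = 0" using N_unit[OF xr] by (simp add: inner_diff_right)
  from M_constant_derivative[OF x r1_derivative[OF xx(1)] _ w this, of \<rho>]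
    M_constant_derivative[OF x r2_derivative[OF xx(1)] _ w this, of "1 - \<rho>"]
  have "fst (DN x ?w) \<bullet> N1 x = 0" "snd (DN x ?w) \<bullet> N2 x = 0" using r by auto
  then show "fst (DN x v) \<bullet> N1 x = 0" "snd (DN x v) \<bullet> N2 x = 0"
    using r_derivative_N[OF xr]
    by (simp_all add: linear_diff[OF DN_linear[OF xx(1)]] linear_scale[OF DN_linear[OF xx(1)]] inner_diff_left)
qed

text \<open>By symmetry of \<open>DN x\<close>, the tangential part of \<open>DN x (N1 x, 0)\<close>
  paired with \<open>v\<close> is \<open>fst (DN x v) \<bullet> N1 x\<close>, which is zero. Only
  the radial part remains, so the two components of the normal are separately annihilated by the
  covariant derivative.\<close>

lemma DN_partial_N:
  assumes x: "x \<in> M"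
  shows "DN x (N1 x, 0) = (- \<rho> *\<^sub>R fst x, 0)" "DN x (0, N2 x) = (0, - (1 - \<rho>) *\<^sub>R snd x)"
proof -
  note xx = MD[OF x]
  have z: "w = 0" if "w \<in> tangent_space x" "\<And>v. v \<in> tangent_space x \<Longrightarrow> w \<bullet> v = 0" for w
    using that(2)[OF that(1)] by simp
  have u: "fst x \<bullet> fst x = 1" "snd x \<bullet> snd x = 1" using xx(2) by (auto simp: S2xS2_iff dot_square_norm)
  have "DN x (N1 x, 0) + (\<rho> *\<^sub>R fst x, 0) = 0"
  proof (rule z)
    show "DN x (N1 x, 0) + (\<rho> *\<^sub>R fst x, 0) \<in> tangent_space x"
      using DN_radial[OF xx(1)] r[OF x] u by (simp add: tangent_space_iff inner_add_left r1_def)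
    fix v assume v: "v \<in> tangent_space x"
    then show "(DN x (N1 x, 0) + (\<rho> *\<^sub>R fst x, 0)) \<bullet> v = 0"
      using DN_symmetric[OF xx(1), of "(N1 x, 0)" v] DN_N_components[OF x v]
      by (simp add: inner_add_left inner_add_right inner_prod_def tangent_space_iff inner_commute)
  qed
  then show "DN x (N1 x, 0) = (- \<rho> *\<^sub>R fst x, 0)" by (simp add: prod_eq_iff add_eq_0_iff2)
  moreover have "DN x (N x - (N1 x, 0)) = DN x (N x) - DN x (N1 x, 0)"
    by (rule linear_diff[OF DN_linear[OF xx(1)]])
  moreover have "N x - (N1 x, 0) = (0, N2 x)" by (simp add: prod_eq_iff)
  ultimately show "DN x (0, N2 x) = (0, - (1 - \<rho>) *\<^sub>R snd x)"
    using DN_N[OF M_reg[OF x]] r[OF x] by simp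
qed

lemma fr3_eq: "x \<in> M \<Longrightarrow> fr 3 x = (1 - \<rho>) *\<^sub>R (N1 x, 0) - \<rho> *\<^sub>R (0, N2 x)"
  using r by (simp add: fr_simps)

lemma DN_fr3: "x \<in> M \<Longrightarrow> DN x (fr 3 x) = (- ((1 - \<rho>) * \<rho>) *\<^sub>R fst x, ((1 - \<rho>) * \<rho>) *\<^sub>R snd x)"
  unfolding fr3_eq
  by (simp only: linear_diff[OF DN_linear[OF MD(1)]] linear_scale[OF DN_linear[OF MD(1)]] DN_partial_N)
    (simp add: algebra_simps)

lemma m3:
  assumes x: "x \<in> M" shows "m 3 i x = 0" "m i 3 x = 0"
proof -
  have t: "fr i x \<in> tangent_space x" by (rule fr_tangent[OF M_reg[OF x]])
  then have "DN x (fr 3 x) \<bullet> fr i x = 0"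
    unfolding DN_fr3[OF x] by (simp add: tangent_space_iff inner_prod_def inner_commute)
  then show "m 3 i x = 0" "m i 3 x = 0"
    using DN_symmetric[OF MD(1)[OF x], of "fr i x" "fr 3 x"] by (simp_all add: m_def)
qed

lemma fr_N: "x \<in> M \<Longrightarrow> N x \<bullet> fr i x = 0"
  using r[of x] by (auto simp: fr_def inner_prod_def dot_cross_self r1_def r2_def mult.commute)

lemma frn_M: "x \<in> M \<Longrightarrow> frn 1 x = \<rho>" "x \<in> M \<Longrightarrow> frn (Suc 0) x = \<rho>" "x \<in> M \<Longrightarrow> frn 2 x = 1 - \<rho>"
  using r[of x] by (simp_all add: frn_def)

text \<open>On \<open>fr 1\<close> and \<open>fr 2\<close> the flat and covariant derivatives of
  \<open>N\<close> agree, because each factor of these vectors is orthogonal to the corresponding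
  component of \<open>N\<close>; the \<open>fr 3\<close> coefficient is zero by
  \<open>m3\<close>.\<close>

lemma DN_fr:
  assumes x: "x \<in> M"
  shows "DN x (fr 1 x) = m 1 1 x *\<^sub>R fr 1 x + m 1 2 x *\<^sub>R fr 2 x"
    "DN x (fr 2 x) = m 2 1 x *\<^sub>R fr 1 x + m 2 2 x *\<^sub>R fr 2 x"
proof -
  note xr = M_reg[OF x]
  have "DN x (fr i x) = m i 1 x *\<^sub>R fr 1 x + m i 2 x *\<^sub>R fr 2 x" if i: "i = 1 \<or> i = 2" for i
  proof -
    have o: "N1 x \<bullet> fst (fr i x) = 0" "N2 x \<bullet> snd (fr i x) = 0"
      using i by (auto simp: fr_def dot_cross_self)
    then have e: "DNt x (fr i x) = DN x (fr i x)" by (simp add: DNt_def zero_prod_def[symmetric])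
    from tangent_expansion[OF M_reg'[OF x] DNt_tangent[OF xr] N_DNt[OF xr fr_tangent[OF xr]], of i,
        unfolded e, folded m_def]
    show ?thesis by (simp only: m3(2)[OF x] scaleR_zero_left add_0_right)
  qed
  then show "DN x (fr 1 x) = m 1 1 x *\<^sub>R fr 1 x + m 1 2 x *\<^sub>R fr 2 x"
    "DN x (fr 2 x) = m 2 1 x *\<^sub>R fr 1 x + m 2 2 x *\<^sub>R fr 2 x" by auto
qed

section \<open>The Codazzi equation in the direction of the kernel of the shape operator\<close>

lemma D2N_M:
  assumes x: "x \<in> M" and v: "v \<in> tangent_space x" "N x \<bullet> v = 0"
  shows "D2N x v (N1 x, 0) = - DN x (fst (DN x v), 0) - (\<rho> *\<^sub>R fst v, 0)"
    "D2N x v (0, N2 x) = - DN x (0, snd (DN x v)) - (0, (1 - \<rho>) *\<^sub>R snd v)"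
proof -
  note xx = MD[OF x]
  have d: "((\<lambda>y. (N1 y, 0::real^3)) has_derivative (\<lambda>u. (fst (DN x u), 0))) (at x)"
    "((\<lambda>y. (0::real^3, N2 y)) has_derivative (\<lambda>u. (0, snd (DN x u)))) (at x)"
    by (auto intro!: has_derivative_Pair N_fst_derivative N_snd_derivative xx)
  have 1: "((\<lambda>y. DN y (N1 y, 0) + (\<rho> *\<^sub>R fst y, 0)) has_derivative
     (\<lambda>u. (D2N x u (N1 x, 0) + DN x (fst (DN x u), 0)) + (\<rho> *\<^sub>R fst u, 0))) (at x)"
    by (intro has_derivative_add DN_field_derivative xx d has_derivative_Pair has_derivative_scaleR_right
        has_derivative_fst has_derivative_ident has_derivative_const)
  have 2: "((\<lambda>y. DN y (0, N2 y) + (0, (1 - \<rho>) *\<^sub>R snd y)) has_derivative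
     (\<lambda>u. (D2N x u (0, N2 x) + DN x (0, snd (DN x u))) + (0, (1 - \<rho>) *\<^sub>R snd u))) (at x)"
    by (intro has_derivative_add DN_field_derivative xx d has_derivative_Pair has_derivative_scaleR_right
        has_derivative_snd has_derivative_ident has_derivative_const)
  have sum0: "D = - A - B" if "D + A + B = 0" for D A B :: r33
    using that by (simp add: eq_diff_eq eq_neg_iff_add_eq_0 add_ac)
  have "D2N x v (N1 x, 0) + DN x (fst (DN x v), 0) + (\<rho> *\<^sub>R fst v, 0) = 0"
    by (rule M_constant_derivative[OF x 1 _ v]) (simp add: DN_partial_N zero_prod_def)
  then show "D2N x v (N1 x, 0) = - DN x (fst (DN x v), 0) - (\<rho> *\<^sub>R fst v, 0)"
    by (rule sum0)
  have "D2N x v (0, N2 x) + DN x (0, snd (DN x v)) + (0, (1 - \<rho>) *\<^sub>R snd v) = 0"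
    by (rule M_constant_derivative[OF x 2 _ v]) (simp add: DN_partial_N zero_prod_def algebra_simps)
  then show "D2N x v (0, N2 x) = - DN x (0, snd (DN x v)) - (0, (1 - \<rho>) *\<^sub>R snd v)"
    by (rule sum0)
qed

text \<open>Symmetry moves \<open>fr 3\<close> into the slot where \<open>D2N_M\<close> applies. The
  derivative of the shape operator along its kernel direction is thereby expressed algebraically
  through the shape operator itself.\<close>

lemma D2N_fr3:
  assumes x: "x \<in> M"
  shows "D2N x (fr 3 x) v = (1 - \<rho>) *\<^sub>R D2N x v (N1 x, 0) - \<rho> *\<^sub>R D2N x v (0, N2 x)"
proof -
  have lin: "linear (\<lambda>u. D2N x u v)"
    unfolding D2N_def DN_def
    by (rule C_inf_on_linear_dderiv[OF C_inf_on_dderiv_const[OF N_smooth] MD(1)[OF x]])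
  show ?thesis
    unfolding fr3_eq[OF x] D2N_symmetric[OF MD(1)[OF x], of v]
    by (simp only: linear_diff[OF lin] linear_scale[OF lin])
qed

text \<open>The numerator of \<open>m i j\<close>: symmetric in the indices on \<open>M\<close>, and
  differentiable without a quotient rule.\<close>

definition Bf :: "nat \<Rightarrow> nat \<Rightarrow> r33 \<Rightarrow> real" where "Bf i j x = DN x (fr i x) \<bullet> fr j x"

lemma Bf_m:
  assumes x: "x \<in> M"
  shows "Bf 1 1 x = \<rho> * m 1 1 x" "Bf 2 2 x = (1 - \<rho>) * m 2 2 x" "Bf 1 2 x = (1 - \<rho>) * m 1 2 x"
    "Bf 1 2 x = \<rho> * m 2 1 x" "Bf 2 1 x = Bf 1 2 x"
  using frn_M[OF x] \<rho> DN_symmetric[OF MD(1)[OF x], of "fr 2 x" "fr 1 x"] by (simp_all add: m_def Bf_def)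

text \<open>The vectors \<open>fr 1\<close> and \<open>fr 2\<close> have zero derivative along
  \<open>fr 3\<close>, so only the derivative of \<open>DN\<close> contributes, and
  \<open>D2N_fr3\<close> evaluates it.\<close>

lemma Bf_derivative:
  assumes x: "x \<in> M"
  shows "\<exists>L. (Bf 1 1 has_derivative L) (at x) \<and>
      L (fr 3 x) = \<rho> * (- (1 - \<rho>) * (m 1 1 x)\<^sup>2 - \<rho> * (1 - \<rho>) + \<rho> * (m 1 2 x * m 2 1 x))" (is ?A)
    and "\<exists>L. (Bf 1 2 has_derivative L) (at x) \<and>
      L (fr 3 x) = Bf 1 2 x * (\<rho> * m 2 2 x - (1 - \<rho>) * m 1 1 x)" (is ?B)
    and "\<exists>L. (Bf 2 2 has_derivative L) (at x) \<and>
      L (fr 3 x) = (1 - \<rho>) * (\<rho> * (1 - \<rho>) - (1 - \<rho>) * (m 1 2 x * m 2 1 x) + \<rho> * (m 2 2 x)\<^sup>2)" (is ?C)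
proof -
  note xx = MD[OF x] and xr = M_reg[OF x] and lin = DN_linear[OF MD(1)[OF x]]
  have par: "\<exists>Z'. (fr i has_derivative Z') (at x) \<and> Z' (fr 3 x) = 0" if "i = 1 \<or> i = 2" for i
  proof -
    have "?thesis" if "i = 1" unfolding that
      by (intro exI conjI, rule fr_derivative(1)[OF xx(1)], unfold DN_fr3[OF x])
        (simp add: fr_simps cross_mult_right cross_mult_left zero_prod_def)
    moreover have "?thesis" if "i = 2" unfolding that
      by (intro exI conjI, rule fr_derivative(2)[OF xx(1)], unfold DN_fr3[OF x])
        (simp add: fr_simps cross_mult_right cross_mult_left zero_prod_def)
    ultimately show ?thesis using \<open>i = 1 \<or> i = 2\<close> by blast
  qed
  have B: "\<exists>L. (Bf i j has_derivative L) (at x) \<and> L (fr 3 x) = D2N x (fr 3 x) (fr i x) \<bullet> fr j x"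
    if i: "i = 1 \<or> i = 2" and j: "j = 1 \<or> j = 2" for i j
  proof -
    obtain Z Y where Z: "(fr i has_derivative Z) (at x)" "Z (fr 3 x) = 0"
      and Y: "(fr j has_derivative Y) (at x)" "Y (fr 3 x) = 0" using par[OF i] par[OF j] by blast
    have "(Bf i j has_derivative (\<lambda>u. DN x (fr i x) \<bullet> Y u + (D2N x u (fr i x) + DN x (Z u)) \<bullet> fr j x)) (at x)"
      unfolding Bf_def[abs_def] by (intro has_derivative_inner DN_field_derivative xx Z Y)
    then show ?thesis
      by (intro exI conjI, assumption) (simp add: Z Y linear_0[OF lin])
  qed
  have p: "(fst (DN x (fr 1 x)), 0) = m 1 1 x *\<^sub>R fr 1 x" "(0, snd (DN x (fr 1 x))) = m 1 2 x *\<^sub>R fr 2 x"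
    "(fst (DN x (fr 2 x)), 0) = m 2 1 x *\<^sub>R fr 1 x" "(0, snd (DN x (fr 2 x))) = m 2 2 x *\<^sub>R fr 2 x"
    "(\<rho> *\<^sub>R fst (fr 1 x), 0) = \<rho> *\<^sub>R fr 1 x" "(0, (1 - \<rho>) *\<^sub>R snd (fr 1 x)) = 0"
    "(\<rho> *\<^sub>R fst (fr 2 x), 0) = 0" "(0, (1 - \<rho>) *\<^sub>R snd (fr 2 x)) = (1 - \<rho>) *\<^sub>R fr 2 x"
    unfolding DN_fr[OF x] by (simp_all add: fr_simps zero_prod_def)
  have D: "D2N x (fr 3 x) (fr 1 x) = (1 - \<rho>) *\<^sub>R (- m 1 1 x *\<^sub>R DN x (fr 1 x) - \<rho> *\<^sub>R fr 1 x) - \<rho> *\<^sub>R (- m 1 2 x *\<^sub>R DN x (fr 2 x))"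
    "D2N x (fr 3 x) (fr 2 x) = (1 - \<rho>) *\<^sub>R (- m 2 1 x *\<^sub>R DN x (fr 1 x)) - \<rho> *\<^sub>R (- m 2 2 x *\<^sub>R DN x (fr 2 x) - (1 - \<rho>) *\<^sub>R fr 2 x)"
    unfolding D2N_fr3[OF x] D2N_M[OF x fr_tangent[OF xr] fr_N[OF x]] p
    by (simp_all add: linear_scale[OF lin])
  have n: "fr 1 x \<bullet> fr 1 x = \<rho>" "fr 2 x \<bullet> fr 2 x = 1 - \<rho>" "fr 1 x \<bullet> fr 2 x = 0"
    using cross_inner_self[OF xr] r[OF x] by (simp_all add: fr_simps)
  have b: "DN x (fr 1 x) \<bullet> fr 1 x = \<rho> * m 1 1 x" "DN x (fr 2 x) \<bullet> fr 1 x = \<rho> * m 2 1 x"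
    "DN x (fr 1 x) \<bullet> fr 2 x = Bf 1 2 x" "DN x (fr 2 x) \<bullet> fr 2 x = (1 - \<rho>) * m 2 2 x"
    using Bf_m[OF x] by (simp_all add: Bf_def)
  have s: "(1 - \<rho>) * m 1 2 x = Bf 1 2 x" using Bf_m[OF x] by simp
  show ?A
  proof -
    have "D2N x (fr 3 x) (fr 1 x) \<bullet> fr 1 x = \<rho> * (- (1 - \<rho>) * (m 1 1 x)\<^sup>2 - \<rho> * (1 - \<rho>) + \<rho> * (m 1 2 x * m 2 1 x))"
      unfolding D by (simp only: inner_diff_left inner_scaleR_left b n) (simp add: algebra_simps power2_eq_square)
    then show ?thesis using B[of 1 1] by simp
  qed
  show ?B
  proof -
    have "D2N x (fr 3 x) (fr 1 x) \<bullet> fr 2 x = - (1 - \<rho>) * m 1 1 x * Bf 1 2 x + \<rho> * m 2 2 x * ((1 - \<rho>) * m 1 2 x)"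
      unfolding D by (simp only: inner_diff_left inner_scaleR_left b n) (simp add: algebra_simps)
    then have "D2N x (fr 3 x) (fr 1 x) \<bullet> fr 2 x = Bf 1 2 x * (\<rho> * m 2 2 x - (1 - \<rho>) * m 1 1 x)"
      unfolding s by (simp add: algebra_simps)
    then show ?thesis using B[of 1 2] by simp
  qed
  show ?C
  proof -
    have "D2N x (fr 3 x) (fr 2 x) \<bullet> fr 2 x = - (1 - \<rho>) * m 2 1 x * Bf 1 2 x + \<rho> * (m 2 2 x * ((1 - \<rho>) * m 2 2 x) + (1 - \<rho>) * (1 - \<rho>))"
      unfolding D by (simp only: inner_diff_left inner_scaleR_left b n) (simp add: algebra_simps)
    also have "\<dots> = (1 - \<rho>) * (\<rho> * (1 - \<rho>) - (1 - \<rho>) * (m 1 2 x * m 2 1 x) + \<rho> * (m 2 2 x)\<^sup>2)"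
      unfolding s[symmetric] by (simp add: algebra_simps power2_eq_square)
    finally show ?thesis using B[of 2 2] by simp
  qed
qed

text \<open>With all entries of index 3 zero, the functions of \<open>F\<close> given by
  \<open>H\<close>, \<open>qm\<close> and \<open>pm\<close> reduce to the trace, twice the
  determinant and minus twice a weighted trace of a 2 by 2 matrix.\<close>

lemma M_invariants:
  obtains c1 c2 c3 where "\<And>x. x \<in> M \<Longrightarrow> m 1 1 x + m 2 2 x = c1"
    "\<And>x. x \<in> M \<Longrightarrow> m 1 1 x * m 2 2 x - m 1 2 x * m 2 1 x = c2"
    "\<And>x. x \<in> M \<Longrightarrow> \<rho> * m 2 2 x + (1 - \<rho>) * m 1 1 x = c3"
proof -
  obtain a b where ab: "\<And>x. x \<in> reg' \<Longrightarrow> qm x = a (F x)" "\<And>x. x \<in> reg' \<Longrightarrow> pm x = b (F x)"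
    using isF_facts(1,2) unfolding isF_def by metis
  show thesis
  proof (rule that[of "\<eta> t0" "a t0 / 2" "- b t0 / 2"])
    fix x assume x: "x \<in> M"
    note z = m3[OF x]
    show "m 1 1 x + m 2 2 x = \<eta> t0"
      using H_eq[OF M_reg'[OF x]] z MD(4)[OF x] by simp
    show "m 1 1 x * m 2 2 x - m 1 2 x * m 2 1 x = a t0 / 2"
      using ab(1)[OF M_reg'[OF x]] z MD(4)[OF x] by (simp add: qm_def m12_def m13_def m23_def)
    show "\<rho> * m 2 2 x + (1 - \<rho>) * m 1 1 x = - b t0 / 2"
      using ab(2)[OF M_reg'[OF x]] z MD(4)[OF x] r[OF x] by (simp add: pm_def m123_def)
  qed
qed

text \<open>Here \<open>a\<close> and \<open>b\<close> are the derivatives of \<open>m 1 1\<close>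
  and \<open>m 2 2\<close> along \<open>fr 3\<close>, and the equations are the derivatives of the
  three constants of \<open>M_invariants\<close>. Each constant is first multiplied by
  \<open>\<rho> * (1 - \<rho>)\<close>, which turns it into a polynomial in
  \<open>Bf\<close>.\<close>

lemma invariants_derivative:
  assumes x: "x \<in> M"
  defines "z \<equiv> m 1 2 x * m 2 1 x"
  defines "a \<equiv> - (1 - \<rho>) * (m 1 1 x)\<^sup>2 - \<rho> * (1 - \<rho>) + \<rho> * z"
    and "b \<equiv> \<rho> * (1 - \<rho>) - (1 - \<rho>) * z + \<rho> * (m 2 2 x)\<^sup>2"
  shows "a + b = 0" "a * m 2 2 x + m 1 1 x * b - 2 * z * (\<rho> * m 2 2 x - (1 - \<rho>) * m 1 1 x) = 0"
    "\<rho> * b + (1 - \<rho>) * a = 0"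
proof -
  have v: "fr 3 x \<in> tangent_space x" "N x \<bullet> fr 3 x = 0"
    using fr_tangent[OF M_reg[OF x]] fr_N[OF x] by auto
  have nz: "\<rho> \<noteq> 0" "1 - \<rho> \<noteq> 0" using \<rho> by auto
  obtain L11 L12 L22 where L: "(Bf 1 1 has_derivative L11) (at x)" "L11 (fr 3 x) = \<rho> * a"
    "(Bf 1 2 has_derivative L12) (at x)" "L12 (fr 3 x) = Bf 1 2 x * (\<rho> * m 2 2 x - (1 - \<rho>) * m 1 1 x)"
    "(Bf 2 2 has_derivative L22) (at x)" "L22 (fr 3 x) = (1 - \<rho>) * b"
    using Bf_derivative[OF x] unfolding a_def b_def z_def by blast
  obtain c1 c2 c3 where c: "\<And>x. x \<in> M \<Longrightarrow> m 1 1 x + m 2 2 x = c1"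
    "\<And>x. x \<in> M \<Longrightarrow> m 1 1 x * m 2 2 x - m 1 2 x * m 2 1 x = c2"
    "\<And>x. x \<in> M \<Longrightarrow> \<rho> * m 2 2 x + (1 - \<rho>) * m 1 1 x = c3" using M_invariants by metis
  have 1: "((\<lambda>y. (1 - \<rho>) * Bf 1 1 y + \<rho> * Bf 2 2 y) has_derivative (\<lambda>u. (1 - \<rho>) * L11 u + \<rho> * L22 u)) (at x)"
    by (intro has_derivative_add has_derivative_mult_right L)
  have "(1 - \<rho>) * L11 (fr 3 x) + \<rho> * L22 (fr 3 x) = 0"
  proof (rule M_constant_derivative[OF x 1 _ v])
    show "(1 - \<rho>) * Bf 1 1 y + \<rho> * Bf 2 2 y = \<rho> * (1 - \<rho>) * c1" if "y \<in> M" for y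
      unfolding Bf_m[OF that] c(1)[OF that, symmetric] by (simp add: algebra_simps)
  qed
  then have "\<rho> * (1 - \<rho>) * (a + b) = 0" unfolding L(2,6) by algebra
  then show ab: "a + b = 0" using nz by simp
  have 3: "((\<lambda>y. (1 - \<rho>) * (1 - \<rho>) * Bf 1 1 y + \<rho> * \<rho> * Bf 2 2 y) has_derivative (\<lambda>u. (1 - \<rho>) * (1 - \<rho>) * L11 u + \<rho> * \<rho> * L22 u)) (at x)"
    by (intro has_derivative_add has_derivative_mult_right L)
  have "(1 - \<rho>) * (1 - \<rho>) * L11 (fr 3 x) + \<rho> * \<rho> * L22 (fr 3 x) = 0"
  proof (rule M_constant_derivative[OF x 3 _ v])
    show "(1 - \<rho>) * (1 - \<rho>) * Bf 1 1 y + \<rho> * \<rho> * Bf 2 2 y = \<rho> * (1 - \<rho>) * c3" if "y \<in> M" for y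
      unfolding Bf_m[OF that] c(3)[OF that, symmetric] by (simp add: algebra_simps)
  qed
  then have "\<rho> * (1 - \<rho>) * (\<rho> * b + (1 - \<rho>) * a) = 0" unfolding L(2,6) by algebra
  then show "\<rho> * b + (1 - \<rho>) * a = 0" using nz by simp
  have 2: "((\<lambda>y. Bf 1 1 y * Bf 2 2 y - Bf 1 2 y * Bf 1 2 y) has_derivative
     (\<lambda>u. (Bf 1 1 x * L22 u + L11 u * Bf 2 2 x) - (Bf 1 2 x * L12 u + L12 u * Bf 1 2 x))) (at x)"
    by (intro has_derivative_diff has_derivative_mult L)
  have "(Bf 1 1 x * L22 (fr 3 x) + L11 (fr 3 x) * Bf 2 2 x) - (Bf 1 2 x * L12 (fr 3 x) + L12 (fr 3 x) * Bf 1 2 x) = 0"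
  proof (rule M_constant_derivative[OF x 2 _ v])
    fix y assume y: "y \<in> M"
    have "Bf 1 2 y * Bf 1 2 y = ((1 - \<rho>) * m 1 2 y) * (\<rho> * m 2 1 y)" using Bf_m[OF y] by simp
    then show "Bf 1 1 y * Bf 2 2 y - Bf 1 2 y * Bf 1 2 y = \<rho> * (1 - \<rho>) * c2"
      unfolding Bf_m(1,2)[OF y] c(2)[OF y, symmetric] by (simp add: algebra_simps)
  qed
  moreover have "Bf 1 2 x * Bf 1 2 x = \<rho> * (1 - \<rho>) * z"
  proof -
    have "Bf 1 2 x * Bf 1 2 x = ((1 - \<rho>) * m 1 2 x) * (\<rho> * m 2 1 x)" using Bf_m[OF x] by simp
    then show ?thesis by (simp add: z_def algebra_simps)
  qed
  moreover have "(Bf 1 1 x * L22 (fr 3 x) + L11 (fr 3 x) * Bf 2 2 x) - (Bf 1 2 x * L12 (fr 3 x) + L12 (fr 3 x) * Bf 1 2 x)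
    = \<rho> * (1 - \<rho>) * (a * m 2 2 x + m 1 1 x * b) - 2 * (Bf 1 2 x * Bf 1 2 x) * (\<rho> * m 2 2 x - (1 - \<rho>) * m 1 1 x)"
    unfolding L Bf_m(1,2)[OF x] by (simp add: algebra_simps)
  ultimately have "\<rho> * (1 - \<rho>) * (a * m 2 2 x + m 1 1 x * b - 2 * z * (\<rho> * m 2 2 x - (1 - \<rho>) * m 1 1 x)) = 0"
    by algebra
  then show "a * m 2 2 x + m 1 1 x * b - 2 * z * (\<rho> * m 2 2 x - (1 - \<rho>) * m 1 1 x) = 0" using nz by simp
qed

lemma z_nonneg: "x \<in> M \<Longrightarrow> m 1 2 x * m 2 1 x \<ge> 0"
proof -
  assume x: "x \<in> M"
  have "\<rho> * (1 - \<rho>) * (m 1 2 x * m 2 1 x) = ((1 - \<rho>) * m 1 2 x) * (\<rho> * m 2 1 x)" by simp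
  also have "\<dots> = Bf 1 2 x * Bf 1 2 x" using Bf_m[OF x] by simp
  finally have "0 \<le> (\<rho> * (1 - \<rho>)) * (m 1 2 x * m 2 1 x)" by simp
  moreover have "\<rho> * (1 - \<rho>) > 0" using \<rho> by simp
  ultimately show ?thesis using zero_le_mult_iff[of "\<rho> * (1 - \<rho>)" "m 1 2 x * m 2 1 x"] by linarith
qed

text \<open>If the weights differ, the derivatives of the trace and the weighted trace force
  \<open>a = b = 0\<close>. Then \<open>z\<close> is nonzero and the determinant equation gives
  \<open>\<rho> * B = (1 - \<rho>) * A\<close>; eliminating \<open>z\<close> from
  \<open>a = 0\<close> and \<open>b = 0\<close> leaves
  \<open>\<rho> * (1 - \<rho>) * (1 - 2 * \<rho>) = 0\<close>.\<close>

lemma \<rho>_half: "\<rho> = 1 / 2"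
proof (rule ccontr)
  assume ne_half: "\<rho> \<noteq> 1 / 2"
  obtain x where x: "x \<in> M" using ne by blast
  define z where "z = m 1 2 x * m 2 1 x"
  define A where "A = m 1 1 x"
  define B where "B = m 2 2 x"
  define a where "a = - (1 - \<rho>) * A\<^sup>2 - \<rho> * (1 - \<rho>) + \<rho> * z"
  define b where "b = \<rho> * (1 - \<rho>) - (1 - \<rho>) * z + \<rho> * B\<^sup>2"
  note d = invariants_derivative[OF x, folded z_def A_def B_def, folded a_def b_def]
  have "(1 - 2 * \<rho>) * a = 0" using d(1,3) by algebra
  then have a0: "a = 0" and b0: "b = 0" using ne_half d(1) by auto
  have zpos: "\<rho> * z = (1 - \<rho>) * (\<rho> + A\<^sup>2)" using a0 by (simp add: a_def algebra_simps)
  have "(1 - \<rho>) * (\<rho> + A\<^sup>2) > 0" using \<rho> by (simp add: add_pos_nonneg)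
  then have "z \<noteq> 0" using zpos by auto
  then have e1: "\<rho> * B = (1 - \<rho>) * A" using d(2) a0 b0 by simp
  have e2: "(1 - \<rho>) * z = \<rho> * ((1 - \<rho>) + B\<^sup>2)" using b0 by (simp add: b_def algebra_simps)
  have "(1 - \<rho>) * ((1 - \<rho>) * (\<rho> + A\<^sup>2)) = \<rho> * (\<rho> * ((1 - \<rho>) + B\<^sup>2))"
    unfolding zpos[symmetric] e2[symmetric] by simp
  then have "(1 - \<rho>) * \<rho> * (1 - 2 * \<rho>) = (\<rho> * B)\<^sup>2 - ((1 - \<rho>) * A)\<^sup>2"
    by (simp add: algebra_simps power2_eq_square)
  then have "(1 - \<rho>) * \<rho> * (1 - 2 * \<rho>) = 0" unfolding e1 by simp
  then show False using \<rho> ne_half by auto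
qed

text \<open>For equal weights the trace equation says that the diagonal entries agree up to sign; if
  they are distinct and opposite, the determinant equation contradicts \<open>z_nonneg\<close>. So
  both are half the constant trace, and the vanishing derivative of \<open>m 1 1\<close> along
  \<open>fr 3\<close> then fixes the product of the off-diagonal entries.\<close>

lemma principal_constants:
  obtains \<alpha> b where "\<And>x. x \<in> M \<Longrightarrow> m 1 1 x = \<alpha> \<and> m 2 2 x = \<alpha> \<and> m 1 2 x = 2 * b \<and> m 2 1 x = 2 * b"
    "8 * b\<^sup>2 = 1 + 2 * \<alpha>\<^sup>2"
proof -
  have eq: "m 1 1 x = m 2 2 x" if x: "x \<in> M" for x
  proof (rule ccontr)
    define z where "z = m 1 2 x * m 2 1 x"
    define A where "A = m 1 1 x"
    define B where "B = m 2 2 x"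
    assume "m 1 1 x \<noteq> m 2 2 x"
    then have AB: "A \<noteq> B" by (simp add: A_def B_def)
    note d = invariants_derivative[OF x, folded z_def A_def B_def, unfolded \<rho>_half]
    have "(B - A) * (B + A) = 0" using d(1) by (simp add: power2_eq_square algebra_simps)
    then have "B = - A" using AB by auto
    have "(A - B) * (1 - 2 * (A * B - z)) = 0" using d(2) by (simp add: power2_eq_square algebra_simps)
    then have "1 - 2 * (A * B - z) = 0" using AB by simp
    then have "1 + 2 * A\<^sup>2 + 2 * z = 0" using \<open>B = - A\<close> by (simp add: power2_eq_square)
    then show False using z_nonneg[OF x] by (simp add: z_def) (smt (verit) zero_le_power2)
  qed
  obtain c1 where c1: "\<And>x. x \<in> M \<Longrightarrow> m 1 1 x + m 2 2 x = c1" using M_invariants by metis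
  define \<alpha> where "\<alpha> = c1 / 2"
  have \<alpha>: "m 1 1 x = \<alpha>" "m 2 2 x = \<alpha>" if "x \<in> M" for x
    using eq[OF that] c1[OF that] by (auto simp: \<alpha>_def)
  have z: "m 1 2 x * m 2 1 x = 1 / 2 + \<alpha>\<^sup>2" if x: "x \<in> M" for x
  proof -
    obtain L where L: "(Bf 1 1 has_derivative L) (at x)"
      "L (fr 3 x) = \<rho> * (- (1 - \<rho>) * (m 1 1 x)\<^sup>2 - \<rho> * (1 - \<rho>) + \<rho> * (m 1 2 x * m 2 1 x))"
      using Bf_derivative(1)[OF x] by blast
    have "L (fr 3 x) = 0"
      by (rule M_constant_derivative[OF x L(1) _ fr_tangent[OF M_reg[OF x]] fr_N[OF x]])
        (use Bf_m(1) \<alpha> in auto)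
    then show ?thesis unfolding L(2) \<rho>_half \<alpha>[OF x] by (simp add: field_simps)
  qed
  have m12: "m 1 2 x = 2 * Bf 1 2 x" "m 2 1 x = 2 * Bf 1 2 x" if "x \<in> M" for x
    using Bf_m(3,4)[OF that] by (simp_all add: \<rho>_half)
  have sq: "(Bf 1 2 x)\<^sup>2 = (1 / 2 + \<alpha>\<^sup>2) / 4" if "x \<in> M" for x
    using z[OF that] unfolding m12[OF that] by (simp add: power2_eq_square)
  \<comment> \<open>Only the sign of \<open>Bf 1 2\<close> is still open; two possible values and
    continuity on a connected set make it constant.\<close>
  have "Bf 1 2 ` M \<subseteq> {s. poly [:- ((1 / 2 + \<alpha>\<^sup>2) / 4), 0, 1:] s = 0}"
  proof
    fix s assume "s \<in> Bf 1 2 ` M"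
    then obtain x where x: "x \<in> M" "s = Bf 1 2 x" by blast
    show "s \<in> {s. poly [:- ((1 / 2 + \<alpha>\<^sup>2) / 4), 0, 1:] s = 0}"
      using sq[OF x(1)] unfolding x(2) by (simp add: power2_eq_square)
  qed
  moreover have "finite {s. poly [:- ((1 / 2 + \<alpha>\<^sup>2) / 4), 0, 1:] s = 0}" by (rule poly_roots_finite) simp
  moreover have "continuous_on M (Bf 1 2)"
  proof (intro continuous_at_imp_continuous_on ballI)
    fix x assume "x \<in> M"
    then show "isCont (Bf 1 2) x" using Bf_derivative(2) has_derivative_continuous by blast
  qed
  ultimately have "Bf 1 2 constant_on M"
    using continuous_finite_range_constant[OF conn] finite_subset by blast
  then obtain b where b: "\<And>x. x \<in> M \<Longrightarrow> Bf 1 2 x = b" unfolding constant_on_def by blast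
  obtain x where x: "x \<in> M" using ne by blast
  show thesis
  proof (rule that[of \<alpha> b])
    show "8 * b\<^sup>2 = 1 + 2 * \<alpha>\<^sup>2" using sq[OF x] b[OF x] by simp
  qed (use \<alpha> m12 b in auto)
qed

end

section \<open>Reconstruction of the orthogonal map from the frame\<close>

lemma frame_map_derivative:
  fixes P Q A B U W :: "r33 \<Rightarrow> real^3" and v :: "real^3"
  assumes "(P has_derivative P') (at x)" "(Q has_derivative Q') (at x)" "(A has_derivative A') (at x)"
    "(B has_derivative B') (at x)" "(U has_derivative U') (at x)" "(W has_derivative W') (at x)"
  shows "((\<lambda>y. (v \<bullet> Q y) *\<^sub>R (A y - \<alpha> *\<^sub>R P y) + (v \<bullet> B y) *\<^sub>R (P y + (2 * \<alpha>) *\<^sub>R A y)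
      + (4 * b * (v \<bullet> U y)) *\<^sub>R W y) has_derivative
    (\<lambda>u. (v \<bullet> Q' u) *\<^sub>R (A x - \<alpha> *\<^sub>R P x) + (v \<bullet> Q x) *\<^sub>R (A' u - \<alpha> *\<^sub>R P' u)
      + (v \<bullet> B' u) *\<^sub>R (P x + (2 * \<alpha>) *\<^sub>R A x) + (v \<bullet> B x) *\<^sub>R (P' u + (2 * \<alpha>) *\<^sub>R A' u)
      + (4 * b * (v \<bullet> U' u)) *\<^sub>R W x + (4 * b * (v \<bullet> U x)) *\<^sub>R W' u)) (at x)"
  by (auto intro!: derivative_eq_intros assms simp: algebra_simps)

context isoparametric_mixed
begin

text \<open>On the model \<open>fst x \<bullet> R (snd x) = t\<close> the map \<open>R\<close> sends \<open>snd x\<close> and \<open>N2 x\<close> to fixed combinations of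
  \<open>fst x\<close> and \<open>N1 x\<close>; up to a positive factor these combinations define \<open>frame_map\<close>.\<close>
definition frame_map :: "real \<Rightarrow> real \<Rightarrow> r33 \<Rightarrow> real^3 \<Rightarrow> real^3" where
  "frame_map \<alpha> b x v = (v \<bullet> snd x) *\<^sub>R (N1 x - \<alpha> *\<^sub>R fst x)
     + (v \<bullet> N2 x) *\<^sub>R (fst x + (2 * \<alpha>) *\<^sub>R N1 x)
     + (4 * b * (v \<bullet> W2 x)) *\<^sub>R W1 x"

text \<open>The derivative is checked on the three frame vectors. On \<open>fr 1\<close> and
  \<open>fr 2\<close> it is a multiple of \<open>1 + 2 * \<alpha>^2 - 8 * b^2\<close>, which is zero
  by the relation between the principal constants; on \<open>fr 3\<close> the terms cancel by
  themselves.\<close>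

lemma frame_map_constant:
  assumes c: "\<And>x. x \<in> M \<Longrightarrow> m 1 1 x = \<alpha> \<and> m 2 2 x = \<alpha> \<and> m 1 2 x = 2 * b \<and> m 2 1 x = 2 * b"
    and b: "8 * b\<^sup>2 = 1 + 2 * \<alpha>\<^sup>2" and xy: "x \<in> M" "y \<in> M"
  shows "frame_map \<alpha> b x v = frame_map \<alpha> b y v"
proof (rule M_constant[OF _ xy])
  fix x assume x: "x \<in> M"
  note xx = MD[OF x] and xr = M_reg[OF x] and lin = DN_linear[OF MD(1)[OF x]]
  let ?p = "fst x" and ?q = "snd x" and ?A = "N1 x" and ?B = "N2 x"
  let ?W = "cross3 ?p ?A" and ?U = "cross3 ?q ?B"
  define L where "L u = (v \<bullet> snd u) *\<^sub>R (?A - \<alpha> *\<^sub>R ?p) + (v \<bullet> ?q) *\<^sub>R (fst (DN x u) - \<alpha> *\<^sub>R fst u)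
      + (v \<bullet> snd (DN x u)) *\<^sub>R (?p + (2 * \<alpha>) *\<^sub>R ?A) + (v \<bullet> ?B) *\<^sub>R (fst u + (2 * \<alpha>) *\<^sub>R fst (DN x u))
      + (4 * b * (v \<bullet> (cross3 ?q (snd (DN x u)) + cross3 (snd u) ?B))) *\<^sub>R ?W
      + (4 * b * (v \<bullet> ?U)) *\<^sub>R (cross3 ?p (fst (DN x u)) + cross3 (fst u) ?A)" for u
  have L: "((\<lambda>y. frame_map \<alpha> b y v) has_derivative L) (at x)"
    unfolding frame_map_def[abs_def] L_def[abs_def]
    by (intro frame_map_derivative has_derivative_fst has_derivative_snd has_derivative_ident
        N_derivative xx bounded_bilinear.FDERIV[OF bounded_bilinear_cross3])
  have pp: "?p \<bullet> ?p = 1" "?q \<bullet> ?q = 1" using xx(2) by (auto simp: S2xS2_iff dot_square_norm)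
  have pA: "?p \<bullet> ?A = 0" "?q \<bullet> ?B = 0" using N_orthogonal_radial[OF xx(1)] by (simp_all add: inner_commute)
  have AA: "?A \<bullet> ?A = 1/2" "?B \<bullet> ?B = 1/2"
    using r[OF x] by (simp_all add: r1_def r2_def \<rho>_half)
  note dc = double_cross[OF pp(1) pA(1)] double_cross[OF pp(2) pA(2)]
  have D: "DN x (?W, 0) = (\<alpha> *\<^sub>R ?W, (2 * b) *\<^sub>R ?U)" "DN x (0, ?U) = ((2 * b) *\<^sub>R ?W, \<alpha> *\<^sub>R ?U)"
    using DN_fr[OF x] c[OF x] by (simp_all add: fr_simps)
  have bb: "8 * (b * b) = 1 + 2 * (\<alpha> * \<alpha>)" using b by (simp add: power2_eq_square)
  have L1: "L (fr 1 x) = 0"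
  proof -
    have "L (fr 1 x) = ((v \<bullet> ?B) * (1 + 2 * (\<alpha> * \<alpha>) - 8 * (b * b))) *\<^sub>R ?W"
      unfolding L_def fr_simps(1) D
      by (simp add: dc AA cross_mult_right algebra_simps)
    then show ?thesis by (simp add: bb)
  qed
  have L2: "L (fr 2 x) = 0"
  proof -
    have "L (fr 2 x) = ((v \<bullet> ?U) * (1 + 2 * (\<alpha> * \<alpha>) - 8 * (b * b))) *\<^sub>R ?A"
      unfolding L_def fr_simps(3) D
      by (simp add: dc AA cross_mult_right algebra_simps)
    then show ?thesis by (simp add: bb)
  qed
  have L3: "L (fr 3 x) = 0"
  proof -
    have "DN x (fr 3 x) = (- (1/4) *\<^sub>R ?p, (1/4) *\<^sub>R ?q)"
      unfolding DN_fr3[OF x] by (simp add: \<rho>_half)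
    moreover have "fr 3 x = ((1/2) *\<^sub>R ?A, - (1/2) *\<^sub>R ?B)"
      using r[OF x] by (simp add: fr_simps \<rho>_half)
    ultimately show ?thesis unfolding L_def by (simp add: cross_mult_right cross_mult_left algebra_simps)
  qed
  have linL: "linear L" using L by (rule has_derivative_linear)
  have "L w = 0" if w: "w \<in> tangent_space x" "N x \<bullet> w = 0" for w
    by (subst tangent_expansion[OF M_reg'[OF x] w])
      (simp add: linear_add[OF linL] linear_scale[OF linL] L1[simplified] L2 L3)
  then show "\<exists>L. ((\<lambda>y. frame_map \<alpha> b y v) has_derivative L) (at x) \<and>
      (\<forall>v. v \<in> tangent_space x \<longrightarrow> N x \<bullet> v = 0 \<longrightarrow> L v = 0)" using L by blast
qed

text \<open>The last clause is the derivative along \<open>N\<close> of the function that is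
  constant on \<open>M\<close>, in the form required by \<open>M_eq_level_set\<close>.\<close>

lemma M_subset_graph:
  obtains R :: "real^3 \<Rightarrow> real^3" and t where "orthogonal_transformation R" "-1 < t" "t < 1"
    "\<And>x. x \<in> M \<Longrightarrow> fst x \<bullet> R (snd x) = t"
    "\<And>x. x \<in> M \<Longrightarrow> N1 x \<bullet> R (snd x) + fst x \<bullet> R (N2 x) \<noteq> 0"
proof -
  obtain \<alpha> b where c: "\<And>x. x \<in> M \<Longrightarrow> m 1 1 x = \<alpha> \<and> m 2 2 x = \<alpha> \<and> m 1 2 x = 2 * b \<and> m 2 1 x = 2 * b"
    and b: "8 * b\<^sup>2 = 1 + 2 * \<alpha>\<^sup>2" using principal_constants by metis
  obtain x0 where x0: "x0 \<in> M" using ne by blast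
  have pos: "1 + 2 * \<alpha>\<^sup>2 > 0" by (simp add: add_pos_nonneg)
  \<comment> \<open>Chosen so that \<open>a\<close> times
    \<open>N1 - \<alpha> *\<^sub>R fst x\<close> is a unit vector, the image of
    \<open>snd x\<close>. The level is then \<open>t = - a * \<alpha>\<close> with
    \<open>t^2 = 1 - a^2 / 2\<close>. The sign of \<open>b\<close> decides whether \<open>R\<close>
    preserves orientation, so \<open>R\<close> is not restricted to rotations.\<close>
  define a where "a = sqrt (2 / (1 + 2 * \<alpha>\<^sup>2))"
  have apos: "a > 0" and a2: "a * a * (1 + 2 * \<alpha>\<^sup>2) = 2" using pos by (simp_all add: a_def field_simps)
  define R where "R v = a *\<^sub>R frame_map \<alpha> b x0 v" for v
  have Rx: "R v = a *\<^sub>R frame_map \<alpha> b x v" if "x \<in> M" for x v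
    unfolding R_def using frame_map_constant[OF c b x0 that] by simp
  have facts: "fst x \<bullet> fst x = 1" "snd x \<bullet> snd x = 1" "fst x \<bullet> N1 x = 0" "snd x \<bullet> N2 x = 0"
    "N1 x \<bullet> N1 x = 1/2" "N2 x \<bullet> N2 x = 1/2"
    "W1 x \<bullet> W1 x = 1/2"
    "W2 x \<bullet> W2 x = 1/2" if x: "x \<in> M" for x
    using MD(2)[OF x] N_orthogonal_radial[OF MD(1)[OF x]] r[OF x] cross_inner_self[OF M_reg[OF x]]
    by (simp_all add: S2xS2_iff dot_square_norm inner_commute r1_def r2_def \<rho>_half)
  have "linear R"
    unfolding R_def frame_map_def
    by (rule linearI) (simp_all add: inner_add_left algebra_simps)
  moreover have "norm (R v) = norm v" for v
  proof -
    let ?p = "fst x0" and ?q = "snd x0" and ?A = "N1 x0" and ?B = "N2 x0"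
    let ?W = "cross3 ?p ?A" and ?U = "cross3 ?q ?B"
    note f = facts[OF x0]
    have "(sqrt 2 *\<^sub>R ?B) \<bullet> (sqrt 2 *\<^sub>R ?B) = (sqrt 2 * sqrt 2) * (?B \<bullet> ?B)"
      by (simp only: inner_scaleR_left inner_scaleR_right mult.assoc)
    also have "\<dots> = 1" using f(6) by simp
    finally have s2: "norm (sqrt 2 *\<^sub>R ?B) = 1" by (simp only: norm_eq_1)
    have nq: "norm ?q = 1" using MD(2)[OF x0] by (simp add: S2xS2_iff)
    have "v = (v \<bullet> ?q) *\<^sub>R ?q + (v \<bullet> (sqrt 2 *\<^sub>R ?B)) *\<^sub>R (sqrt 2 *\<^sub>R ?B)
        + (v \<bullet> cross3 ?q (sqrt 2 *\<^sub>R ?B)) *\<^sub>R cross3 ?q (sqrt 2 *\<^sub>R ?B)"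
      by (rule cross_frame_expansion[OF nq s2]) (simp add: f)
    moreover have sq: "sqrt 2 * (sqrt 2 * z) = 2 * z" for z :: real by (simp flip: mult.assoc)
    ultimately have ve: "v = (v \<bullet> ?q) *\<^sub>R ?q + (2 * (v \<bullet> ?B)) *\<^sub>R ?B + (2 * (v \<bullet> ?U)) *\<^sub>R ?U"
      by (simp add: cross_mult_right mult.commute mult.left_commute sq)
    have "v \<bullet> v = v \<bullet> ((v \<bullet> ?q) *\<^sub>R ?q + (2 * (v \<bullet> ?B)) *\<^sub>R ?B + (2 * (v \<bullet> ?U)) *\<^sub>R ?U)"
      using ve by simp
    also have "\<dots> = (v \<bullet> ?q)\<^sup>2 + 2 * (v \<bullet> ?B)\<^sup>2 + 2 * (v \<bullet> ?U)\<^sup>2"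
      by (simp add: inner_add_right power2_eq_square)
    finally have vv: "v \<bullet> v = (v \<bullet> ?q)\<^sup>2 + 2 * (v \<bullet> ?B)\<^sup>2 + 2 * (v \<bullet> ?U)\<^sup>2" .
    have ip: "(x *\<^sub>R (?A - \<alpha> *\<^sub>R ?p) + y *\<^sub>R (?p + (2 * \<alpha>) *\<^sub>R ?A) + z *\<^sub>R ?W) \<bullet>
      (x *\<^sub>R (?A - \<alpha> *\<^sub>R ?p) + y *\<^sub>R (?p + (2 * \<alpha>) *\<^sub>R ?A) + z *\<^sub>R ?W)
      = x\<^sup>2 * (1/2 + \<alpha>\<^sup>2) + y\<^sup>2 * (1 + 2 * \<alpha>\<^sup>2) + z\<^sup>2 / 2" for x y z
      using f by (simp add: inner_simps dot_cross_self inner_commute)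
        (simp add: field_simps power2_eq_square)
    have "R v \<bullet> R v = a * a * ((v \<bullet> ?q)\<^sup>2 * (1/2 + \<alpha>\<^sup>2) + (v \<bullet> ?B)\<^sup>2 * (1 + 2 * \<alpha>\<^sup>2) + (4 * b * (v \<bullet> ?U))\<^sup>2 / 2)"
      unfolding R_def frame_map_def by (simp add: ip)
    also have "(4 * b * (v \<bullet> ?U))\<^sup>2 / 2 = (v \<bullet> ?U)\<^sup>2 * (8 * b\<^sup>2)" by (simp add: power_mult_distrib)
    also have "a * a * ((v \<bullet> ?q)\<^sup>2 * (1/2 + \<alpha>\<^sup>2) + (v \<bullet> ?B)\<^sup>2 * (1 + 2 * \<alpha>\<^sup>2) + (v \<bullet> ?U)\<^sup>2 * (8 * b\<^sup>2))
       = (a * a * (1 + 2 * \<alpha>\<^sup>2)) * ((v \<bullet> ?q)\<^sup>2 / 2 + (v \<bullet> ?B)\<^sup>2 + (v \<bullet> ?U)\<^sup>2)"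
      unfolding b by (simp add: field_simps)
    also have "\<dots> = v \<bullet> v" unfolding a2 vv by simp
    finally show ?thesis by (simp add: norm_eq_sqrt_inner)
  qed
  ultimately have orth: "orthogonal_transformation R" by (simp add: orthogonal_transformation)
  define t where "t = - a * \<alpha>"
  have "t\<^sup>2 < 1"
  proof -
    have "2 * t\<^sup>2 = 2 - a * a" using a2 by (simp add: t_def power2_eq_square algebra_simps)
    then show ?thesis using apos by (smt (verit) mult_pos_pos)
  qed
  then have t: "-1 < t" "t < 1" using abs_square_less_1[of t] by auto
  show thesis
  proof (rule that[OF orth t])
    fix x assume x: "x \<in> M"
    note f = facts[OF x]
    show "fst x \<bullet> R (snd x) = t"
      unfolding Rx[OF x] frame_map_def using f
      by (simp add: inner_add_right inner_diff_right dot_cross_self inner_commute t_def)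
    have "N1 x \<bullet> R (snd x) + fst x \<bullet> R (N2 x) = a"
      unfolding Rx[OF x] frame_map_def using f
      by (simp add: f(5,6) inner_add_right inner_diff_right dot_cross_self inner_commute)
    then show "N1 x \<bullet> R (snd x) + fst x \<bullet> R (N2 x) \<noteq> 0" using apos by simp
  qed
qed

end

section \<open>The case of a normal tangent to one factor\<close>

context isoparametric_level
begin

text \<open>\<open>P\<close> is the projection to the factor containing the normal, with section \<open>i\<close>.\<close>
lemma M_subset_slice:
  fixes P Q :: "r33 \<Rightarrow> real^3" and i j :: "real^3 \<Rightarrow> r33"
  assumes PQ: "P = fst \<and> Q = snd \<and> i = (\<lambda>u. (u, 0)) \<and> j = (\<lambda>u. (0, u))
      \<or> P = snd \<and> Q = fst \<and> i = (\<lambda>u. (0, u)) \<and> j = (\<lambda>u. (u, 0))"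
    and Q0: "\<And>x. x \<in> M \<Longrightarrow> Q (N x) = 0" and ne: "M \<noteq> {}"
  obtains \<xi> :: "real^3" and t where "norm \<xi> = 1" "-1 < t" "t < 1" "\<And>x. x \<in> M \<Longrightarrow> P x \<bullet> \<xi> = t"
    "\<And>x. x \<in> M \<Longrightarrow> P (N x) \<bullet> \<xi> \<noteq> 0"
proof -
  have ip: "v \<bullet> w = P v \<bullet> P w + Q v \<bullet> Q w" for v w
    using PQ by (auto simp: inner_prod_def)
  have eqI: "P v = P w \<Longrightarrow> Q v = Q w \<Longrightarrow> v = w" for v w
    using PQ by (auto simp: prod_eq_iff)
  have sec: "P (i u) = u" "Q (i u) = 0" "P (j u) = 0" "Q (j u) = u" for u using PQ by auto
  have bl: "bounded_linear P" "bounded_linear Q"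
    using PQ by (auto intro: bounded_linear_fst bounded_linear_snd)
  note linP = linear_add[OF bounded_linear.linear[OF bl(1)]] linear_scale[OF bounded_linear.linear[OF bl(1)]]
    linear_add[OF bounded_linear.linear[OF bl(2)]] linear_scale[OF bounded_linear.linear[OF bl(2)]]
    linear_0[OF bounded_linear.linear[OF bl(1)]] linear_0[OF bounded_linear.linear[OF bl(2)]]
  have tan: "v \<in> tangent_space x \<longleftrightarrow> P v \<bullet> P x = 0 \<and> Q v \<bullet> Q x = 0" for v x
    using PQ by (auto simp: tangent_space_iff)
  have rad: "P (N x) \<bullet> P x = 0" "P (DN x v) \<bullet> P x = - (P (N x) \<bullet> P v)" if "x \<in> M" for x v
    using PQ N_orthogonal_radial[OF MD(1)[OF that]] DN_radial[OF MD(1)[OF that], of v] by auto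
  have trace: "DN x (i n) \<bullet> i n + DN x (i (cross3 (P x) n)) \<bullet> i (cross3 (P x) n)
    + DN x (j k) \<bullet> j k + DN x (j (cross3 (Q x) k)) \<bullet> j (cross3 (Q x) k) = \<eta> t0"
    if "x \<in> M" "norm n = 1" "P x \<bullet> n = 0" "norm k = 1" "Q x \<bullet> k = 0" for x n k
    using PQ N_trace[OF M_reg[OF that(1)], of n k] N_trace[OF M_reg[OF that(1)], of k n] that(2-) MD(4)[OF that(1)]
    by auto
  \<comment> \<open>The only possibly nonzero principal curvature is \<open>y\<close>, and
    \<open>K\<close> is the axis of the circle up to the factor \<open>sqrt (1 + y^2)\<close>: along
    \<open>M\<close> the normal turns \<open>y\<close> times as fast as the position
    \<open>P x\<close>, so \<open>K\<close> does not move.\<close>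
  define y where "y = \<eta> t0"
  define K where "K x = P (N x) - y *\<^sub>R P x" for x
  have facts: "P (N x) \<bullet> P (N x) = 1" "P x \<bullet> P x = 1" "P x \<bullet> P (N x) = 0"
    "norm (P (N x)) = 1" "norm (P x) = 1" if x: "x \<in> M" for x
  proof -
    show "P (N x) \<bullet> P (N x) = 1" using N_unit[OF M_reg[OF x]] Q0[OF x] ip[of "N x"] by simp
    then show "norm (P (N x)) = 1" by (simp add: norm_eq_1)
    show "norm (P x) = 1" using PQ MD(2)[OF x] by (auto simp: S2xS2_iff)
    then show "P x \<bullet> P x = 1" by (simp add: norm_eq_1)
    show "P x \<bullet> P (N x) = 0" using rad(1)[OF x] by (simp add: inner_commute)
  qed
  have "\<exists>L. (K has_derivative L) (at x) \<and> (\<forall>v. v \<in> tangent_space x \<longrightarrow> N x \<bullet> v = 0 \<longrightarrow> L v = 0)"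
    if x: "x \<in> M" for x
  proof (intro exI conjI allI impI)
    note xx = MD[OF x] and f = facts[OF x] and xr = M_reg[OF x] and lin = DN_linear[OF MD(1)[OF x]]
    let ?W = "cross3 (P x) (P (N x))"
    show "(K has_derivative (\<lambda>v. P (DN x v) - y *\<^sub>R P v)) (at x)"
      unfolding K_def[abs_def] by (intro has_derivative_diff has_derivative_scaleR_right
        bounded_linear.has_derivative[OF bl(1)] N_derivative xx has_derivative_ident)
    have s: "Q (DN x v) = 0" if "v \<in> tangent_space x" "N x \<bullet> v = 0" for v
      by (rule M_constant_derivative[OF x bounded_linear.has_derivative[OF bl(2) N_derivative[OF xx(1)]] Q0 that])
    have ex: "u = (u \<bullet> P x) *\<^sub>R P x + (u \<bullet> P (N x)) *\<^sub>R P (N x) + (u \<bullet> ?W) *\<^sub>R ?W" for u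
      by (rule cross_frame_expansion[OF f(5,4,3)])
    have nv: "N x \<bullet> v = P (N x) \<bullet> P v" for v using ip[of "N x" v] Q0[OF x] by simp
    have ft: "P (DN x v) = (P (DN x v) \<bullet> ?W) *\<^sub>R ?W" if v: "v \<in> tangent_space x" "N x \<bullet> v = 0" for v
      using ex[of "P (DN x v)"] rad(2)[OF x, of v] N_DN[OF xr v(1)] v(2) unfolding nv
      by (simp add: inner_commute)
    have Wt: "i ?W \<in> tangent_space x" "N x \<bullet> i ?W = 0"
      by (simp_all add: tan nv sec dot_cross_self inner_commute)
    \<comment> \<open>The \<open>Q\<close> part vanishes because \<open>Q (N x)\<close> is zero on
      \<open>M\<close>. The \<open>P\<close> part can only point along \<open>?W\<close>, and by
      symmetry that coefficient is a \<open>Q\<close> part again.\<close>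
    have vert: "DN x (j w) = 0" if w: "w \<bullet> Q x = 0" for w
    proof (rule eqI)
      have t: "j w \<in> tangent_space x" "N x \<bullet> j w = 0" using w by (simp_all add: tan nv sec)
      have "P (DN x (j w)) \<bullet> ?W = Q (DN x (i ?W)) \<bullet> w"
        using DN_symmetric[OF xx(1), of "j w" "i ?W"] by (simp add: ip sec)
      then show "P (DN x (j w)) = P 0" using s[OF Wt] ft[OF t] by (simp add: linP)
      show "Q (DN x (j w)) = Q 0" using s[OF t] by (simp add: linP)
    qed
    obtain k where k: "norm k = 1" "Q x \<bullet> k = 0" using exists_unit_orthogonal by blast
    have "N x = i (P (N x))" by (rule eqI) (simp_all add: sec Q0[OF x])
    moreover have "DN x (N x) \<bullet> N x = 0" using N_DN[OF xr N_tangent[OF xx(1)]] by (simp add: inner_commute)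
    ultimately have "DN x (i (P (N x))) \<bullet> i (P (N x)) = 0" by metis
    \<comment> \<open>Three of the four diagonal entries are zero, so the trace is concentrated in
      the direction \<open>?W\<close>.\<close>
    then have "DN x (i ?W) \<bullet> i ?W = y"
      using trace[OF x f(4,3) k] vert[of k] vert[of "cross3 (Q x) k"] k
      by (simp add: inner_commute dot_cross_self y_def)
    then have DW: "P (DN x (i ?W)) = y *\<^sub>R ?W"
      using ft[OF Wt] by (simp add: ip sec)
    fix v assume v: "v \<in> tangent_space x" "N x \<bullet> v = 0"
    have v1: "P v = (P v \<bullet> ?W) *\<^sub>R ?W"
      using ex[of "P v"] v unfolding nv tan by (simp add: inner_commute)
    have "v = (P v \<bullet> ?W) *\<^sub>R i ?W + j (Q v)" by (rule eqI) (use v1 in \<open>simp_all add: linP sec\<close>)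
    then have "DN x v = (P v \<bullet> ?W) *\<^sub>R DN x (i ?W)"
      using linear_add[OF lin, of "(P v \<bullet> ?W) *\<^sub>R i ?W" "j (Q v)"] linear_scale[OF lin, of "P v \<bullet> ?W" "i ?W"]
        vert[of "Q v"] v(1) by (simp add: tan)
    then have "P (DN x v) = y *\<^sub>R ((P v \<bullet> ?W) *\<^sub>R ?W)" using DW by (simp add: linP)
    then show "P (DN x v) - y *\<^sub>R P v = 0" using v1 by simp
  qed
  then have const: "K x = K z" if "x \<in> M" "z \<in> M" for x z
    using M_constant that by blast
  obtain x0 where x0: "x0 \<in> M" using ne by blast
  have pos: "1 + y\<^sup>2 > 0" by (simp add: add_pos_nonneg)
  define a where "a = 1 / sqrt (1 + y\<^sup>2)"
  have a: "a > 0" "a * a * (1 + y\<^sup>2) = 1" using pos by (simp_all add: a_def)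
  define \<xi> where "\<xi> = a *\<^sub>R K x0"
  have \<xi>: "\<xi> = a *\<^sub>R K x" if "x \<in> M" for x unfolding \<xi>_def using const[OF x0 that] by simp
  have "\<xi> \<bullet> \<xi> = a * a * (1 + y\<^sup>2)" unfolding \<xi>_def K_def using facts[OF x0]
    by (simp add: inner_diff_left inner_diff_right inner_commute power2_eq_square)
  then have n: "norm \<xi> = 1" using a by (simp add: norm_eq_sqrt_inner)
  have "(- a * y)\<^sup>2 = 1 - a * a" using a(2) by (simp add: power2_eq_square algebra_simps)
  then have "(- a * y)\<^sup>2 < 1" using a(1) by simp
  then have t: "-1 < - a * y" "- a * y < 1" using abs_square_less_1[of "- a * y"] by auto
  show thesis
  proof (rule that[OF n t])
    fix x assume x: "x \<in> M"
    show "P x \<bullet> \<xi> = - a * y" "P (N x) \<bullet> \<xi> \<noteq> 0"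
      unfolding \<xi>[OF x] K_def using facts[OF x] a(1) by (simp_all add: inner_diff_right inner_commute)
  qed
qed

end

section \<open>Connectedness of the model hypersurfaces\<close>

text \<open>The slice is the image of the real line under the angle parametrisation of a circle; for
  \<open>t = 1\<close> and \<open>t = -1\<close> the radius \<open>s\<close> is zero and the circle
  is a point.\<close>

lemma connected_slice:
  fixes \<xi> :: "real^3"
  assumes \<xi>: "norm \<xi> = 1" and t: "-1 \<le> t" "t \<le> 1"
  shows "connected {p. norm p = 1 \<and> p \<bullet> \<xi> = t}"
proof -
  obtain k where k: "norm k = 1" "\<xi> \<bullet> k = 0" using exists_unit_orthogonal by blast
  let ?c = "cross3 \<xi> k"
  have f: "\<xi> \<bullet> \<xi> = 1" "k \<bullet> k = 1" "k \<bullet> \<xi> = 0" "?c \<bullet> \<xi> = 0" "?c \<bullet> k = 0" "?c \<bullet> ?c = 1"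
    using \<xi> k norm_cross_dot[of \<xi> k] by (simp_all add: dot_square_norm inner_commute dot_cross_self)
  have t2: "0 \<le> 1 - t\<^sup>2" using t by (simp add: abs_square_le_1 abs_le_iff)
  define s where "s = sqrt (1 - t\<^sup>2)"
  have s2: "s * s = 1 - t\<^sup>2" using t2 by (simp add: s_def)
  let ?h = "\<lambda>\<theta>. t *\<^sub>R \<xi> + (s * cos \<theta>) *\<^sub>R k + (s * sin \<theta>) *\<^sub>R ?c"
  have "{p. norm p = 1 \<and> p \<bullet> \<xi> = t} = range ?h"
  proof (intro equalityI subsetI)
    fix p assume "p \<in> {p. norm p = 1 \<and> p \<bullet> \<xi> = t}"
    then have p: "p \<bullet> p = 1" "p \<bullet> \<xi> = t" by (auto simp: dot_square_norm)
    have ex: "p = t *\<^sub>R \<xi> + (p \<bullet> k) *\<^sub>R k + (p \<bullet> ?c) *\<^sub>R ?c"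
      using cross_frame_expansion[OF \<xi> k, of p] p by simp
    have "p \<bullet> p = p \<bullet> (t *\<^sub>R \<xi> + (p \<bullet> k) *\<^sub>R k + (p \<bullet> ?c) *\<^sub>R ?c)" using ex by simp
    then have sq: "(p \<bullet> k)\<^sup>2 + (p \<bullet> ?c)\<^sup>2 = s * s"
      using p s2 by (simp add: inner_add_right power2_eq_square)
    show "p \<in> range ?h"
    proof (cases "s = 0")
      case True
      then have "p \<bullet> k = 0" "p \<bullet> ?c = 0" using sq by (simp_all add: sum_power2_eq_zero_iff)
      then have "p = ?h 0" using ex True by simp
      then show ?thesis by blast
    next
      case False
      then have "(p \<bullet> k / s)\<^sup>2 + (p \<bullet> ?c / s)\<^sup>2 = 1"
        using sq by (simp add: power_divide flip: add_divide_distrib) (simp add: power2_eq_square)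
      then obtain \<theta> where "p \<bullet> k / s = cos \<theta>" "p \<bullet> ?c / s = sin \<theta>" using sincos_total_2pi by blast
      then have "p = ?h \<theta>" using ex False by (simp add: field_simps)
      then show ?thesis by blast
    qed
  next
    fix p assume "p \<in> range ?h"
    then obtain \<theta> where p: "p = ?h \<theta>" by blast
    have "p \<bullet> p = t * t + ((s * s) * (cos \<theta> * cos \<theta>) + (s * s) * (sin \<theta> * sin \<theta>))"
      unfolding p using f by (simp add: inner_add_left inner_add_right inner_commute algebra_simps)
    also have "(s * s) * (cos \<theta> * cos \<theta>) + (s * s) * (sin \<theta> * sin \<theta>) = (s * s) * ((cos \<theta>)\<^sup>2 + (sin \<theta>)\<^sup>2)"
      by (simp only: power2_eq_square distrib_left)
    finally have "p \<bullet> p = 1" using s2 by (simp add: power2_eq_square)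
    then show "p \<in> {p. norm p = 1 \<and> p \<bullet> \<xi> = t}"
      using f unfolding p by (simp add: norm_eq_sqrt_inner inner_add_left)
  qed
  moreover have "connected (range ?h)"
    by (intro connected_continuous_image continuous_intros connected_UNIV)
  ultimately show ?thesis by simp
qed

text \<open>In three dimensions two first components have a common unit normal \<open>n\<close>. A
  pair is joined to another in three moves, each inside a great circle: turn the second component to
  \<open>n\<close>, then move the first, then turn the second away from \<open>n\<close>.\<close>

lemma connected_orthonormal_pairs:
  "connected {x :: r33. norm (fst x) = 1 \<and> norm (snd x) = 1 \<and> fst x \<bullet> snd x = 0}" (is "connected ?T")
proof (subst connected_iff_connected_component, intro ballI)
  fix x y assume x: "x \<in> ?T" and y: "y \<in> ?T"
  have "dim {fst x, fst y} \<le> card {fst x, fst y}" by (rule dim_le_card') simp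
  also have "\<dots> \<le> 2" by (simp add: card_insert_if)
  finally have "dim {fst x, fst y} < DIM(real^3)" by simp
  then obtain w where w: "w \<noteq> 0" "\<And>v. v \<in> span {fst x, fst y} \<Longrightarrow> orthogonal w v"
    using orthogonal_to_subspace_exists by blast
  define n where "n = w /\<^sub>R norm w"
  have n: "norm n = 1" "n \<bullet> fst x = 0" "n \<bullet> fst y = 0"
    using w(1) w(2)[OF span_base] by (auto simp: n_def orthogonal_def)
  have vert: "connected_component ?T (p, m) (p, m')"
    if "norm p = 1" "norm m = 1" "p \<bullet> m = 0" "norm m' = 1" "p \<bullet> m' = 0" for p m m'
    unfolding connected_component_def
  proof (intro exI conjI)
    show "connected ((\<lambda>m. (p, m)) ` {m. norm m = 1 \<and> m \<bullet> p = 0})"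
      by (intro connected_continuous_image connected_slice continuous_intros) (use that in auto)
  qed (use that in \<open>auto simp: inner_commute\<close>)
  have hor: "connected_component ?T (p, m) (p', m)"
    if "norm p = 1" "norm m = 1" "p \<bullet> m = 0" "norm p' = 1" "p' \<bullet> m = 0" for p p' m
    unfolding connected_component_def
  proof (intro exI conjI)
    show "connected ((\<lambda>p. (p, m)) ` {p. norm p = 1 \<and> p \<bullet> m = 0})"
      by (intro connected_continuous_image connected_slice continuous_intros) (use that in auto)
  qed (use that in auto)
  have "connected_component ?T x (fst x, n)"
    using vert[of "fst x" "snd x" n] x n by (simp add: inner_commute)
  moreover have "connected_component ?T (fst x, n) (fst y, n)"
    using hor[of "fst x" n "fst y"] x y n by (simp add: inner_commute)
  moreover have "connected_component ?T (fst y, n) y"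
    using vert[of "fst y" n "snd y"] y n by (simp add: inner_commute)
  ultimately show "connected_component ?T x y" by (meson connected_component_trans)
qed

text \<open>The level set is the continuous image of the orthonormal pairs: given
  \<open>fst x\<close>, the points \<open>R (snd x)\<close> are the
  \<open>t *\<^sub>R fst x + s *\<^sub>R k\<close> with \<open>k\<close> a unit vector orthogonal to
  \<open>fst x\<close>.\<close>

lemma connected_graph_level:
  fixes R :: "real^3 \<Rightarrow> real^3"
  assumes R: "orthogonal_transformation R" and t: "-1 < t" "t < 1"
  shows "connected {x \<in> S2xS2. fst x \<bullet> R (snd x) = t}"
proof -
  let ?T = "{x :: r33. norm (fst x) = 1 \<and> norm (snd x) = 1 \<and> fst x \<bullet> snd x = 0}"
  have t2: "0 < 1 - t\<^sup>2" using t abs_square_less_1[of t] by (simp add: abs_less_iff)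
  define s where "s = sqrt (1 - t\<^sup>2)"
  have s: "s * s = 1 - t\<^sup>2" "s \<noteq> 0" using t2 by (simp_all add: s_def)
  have R': "orthogonal_transformation (inv R)" by (rule orthogonal_transformation_inv[OF R])
  have RR: "R (inv R v) = v" "inv R (R v) = v" for v
    using orthogonal_transformation_bij[OF R] by (simp_all add: bij_is_surj surj_f_inv_f bij_is_inj)
  let ?h = "\<lambda>x :: r33. (fst x, inv R (t *\<^sub>R fst x + s *\<^sub>R snd x))"
  have "{x \<in> S2xS2. fst x \<bullet> R (snd x) = t} = ?h ` ?T"
  proof (intro equalityI subsetI)
    fix x assume "x \<in> {x \<in> S2xS2. fst x \<bullet> R (snd x) = t}"
    then have x: "norm (fst x) = 1" "norm (snd x) = 1" "fst x \<bullet> R (snd x) = t" by (auto simp: S2xS2_iff)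
    define k where "k = (1 / s) *\<^sub>R (R (snd x) - t *\<^sub>R fst x)"
    have n: "R (snd x) \<bullet> R (snd x) = 1" "fst x \<bullet> fst x = 1"
      using x R by (simp_all add: dot_square_norm orthogonal_transformation)
    have "k \<bullet> k = 1"
      unfolding k_def using x n s t2 by (simp add: inner_diff_left inner_diff_right inner_commute power2_eq_square)
    moreover have "fst x \<bullet> k = 0" unfolding k_def using x n by (simp add: inner_diff_right)
    ultimately have "(fst x, k) \<in> ?T" using x by (simp add: norm_eq_sqrt_inner)
    moreover have "x = ?h (fst x, k)" using s by (simp add: k_def RR)
    ultimately show "x \<in> ?h ` ?T" by blast
  next
    fix z assume "z \<in> ?h ` ?T"
    then obtain x where z: "z = ?h x" and x: "norm (fst x) = 1" "norm (snd x) = 1" "fst x \<bullet> snd x = 0" by auto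
    have ip: "fst x \<bullet> fst x = 1" "snd x \<bullet> snd x = 1" using x by (simp_all add: dot_square_norm)
    have "(t *\<^sub>R fst x + s *\<^sub>R snd x) \<bullet> (t *\<^sub>R fst x + s *\<^sub>R snd x) = 1"
      using x ip s by (simp add: inner_add_left inner_add_right inner_commute power2_eq_square)
    then have "norm (snd z) = 1"
      using R' by (simp add: z orthogonal_transformation norm_eq_sqrt_inner)
    then show "z \<in> {x \<in> S2xS2. fst x \<bullet> R (snd x) = t}"
      using x ip by (simp add: z S2xS2_iff RR inner_add_right del: mem_sphere_0 mem_Times_iff)
  qed
  moreover have "connected (?h ` ?T)"
    by (intro connected_continuous_image connected_orthonormal_pairs continuous_intros
        linear_continuous_on_compose[OF _ orthogonal_transformation_linear[OF R']])
  ultimately show ?thesis by simp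
qed

section \<open>Congruence\<close>

text \<open>A linear map is its own differential, and the ambient maps serve as smooth extensions.
  \<open>inv_into\<close> agrees with \<open>\<Psi>\<close> only on the product of spheres, which is
  all that \<open>smooth_on\<close> looks at.\<close>

lemma congruent_by_linear:
  fixes \<Phi> \<Psi> :: "r33 \<Rightarrow> r33"
  assumes lin: "linear \<Phi>" "linear \<Psi>" and inv: "\<And>x. \<Psi> (\<Phi> x) = x" "\<And>x. \<Phi> (\<Psi> x) = x"
    and dot: "\<And>u v. \<Phi> u \<bullet> \<Phi> v = u \<bullet> v"
    and S: "\<And>x. x \<in> S2xS2 \<Longrightarrow> \<Phi> x \<in> S2xS2" "\<And>x. x \<in> S2xS2 \<Longrightarrow> \<Psi> x \<in> S2xS2"
    and M: "\<And>x. x \<in> M \<Longrightarrow> \<Phi> x \<in> M'" "\<And>x. x \<in> M' \<Longrightarrow> \<Psi> x \<in> M"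
  shows "congruent_S2xS2 M M'"
proof -
  have bl: "bounded_linear \<Phi>" "bounded_linear \<Psi>" using lin by (auto simp: linear_conv_bounded_linear)
  have bij: "bij_betw \<Phi> S2xS2 S2xS2"
    by (rule bij_betw_byWitness[of _ \<Psi>])
      (use inv in simp, use inv in simp, rule image_subsetI, erule S, rule image_subsetI, erule S)
  have inv_into: "inv_into S2xS2 \<Phi> y = \<Psi> y" if "y \<in> S2xS2" for y
    using inv_into_f_f[OF bij_betw_imp_inj_on[OF bij] S(2)[OF that]] inv(2) by simp
  have sm: "smooth_on S2xS2 L" if "bounded_linear \<Theta>" "\<And>y. y \<in> S2xS2 \<Longrightarrow> \<Theta> y = L y" for L \<Theta> :: "r33 \<Rightarrow> r33"
    unfolding smooth_on_def
    by (intro ballI exI[of _ UNIV] exI[of _ \<Theta>]) (use that in \<open>auto intro: C_k_on_linear\<close>)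
  have d: "differential \<Phi> x u = \<Phi> u" if "x \<in> S2xS2" "u \<in> tangent_space x" for x u
    by (rule differential_eq[OF that bounded_linear.has_derivative[OF bl(1) has_derivative_ident]]) simp
  have "isometry_S2xS2 \<Phi>"
    unfolding isometry_S2xS2_def
    using bij sm[OF bl(1)] sm[OF bl(2), of "inv_into S2xS2 \<Phi>"] inv_into dot d by simp
  moreover have "\<Phi> ` M = M'" using M inv by (metis (no_types, lifting) image_subset_iff subsetI subset_antisym imageI)
  ultimately show ?thesis unfolding congruent_S2xS2_def by blast
qed

lemma orthogonal_pair:
  fixes A B :: "real^3 \<Rightarrow> real^3"
  assumes A: "orthogonal_transformation A" and B: "orthogonal_transformation B"
  shows "linear (\<lambda>x :: r33. (A (fst x), B (snd x)))" "linear (\<lambda>x :: r33. (A (snd x), B (fst x)))"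
    "A (inv A p) = p" "inv A (A p) = p" "A u \<bullet> A v = u \<bullet> v" "norm (A u) = norm u" "norm (inv A u) = norm u"
proof -
  have l: "linear A" "linear B" using A B by (auto intro: orthogonal_transformation_linear)
  show "linear (\<lambda>x :: r33. (A (fst x), B (snd x)))" "linear (\<lambda>x :: r33. (A (snd x), B (fst x)))"
    by (rule linearI; simp add: linear_add[OF l(1)] linear_add[OF l(2)] linear_scale[OF l(1)] linear_scale[OF l(2)])+
  show "A (inv A p) = p" "inv A (A p) = p"
    using orthogonal_transformation_bij[OF A] by (simp_all add: bij_is_surj surj_f_inv_f bij_is_inj)
  show "A u \<bullet> A v = u \<bullet> v" using A by (simp add: orthogonal_transformation_def)
  show "norm (A u) = norm u" "norm (inv A u) = norm u"
    using A orthogonal_transformation_inv[OF A] by (simp_all add: orthogonal_transformation)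
qed

lemma congruent_graph:
  assumes R: "orthogonal_transformation R"
  shows "congruent_S2xS2 {x \<in> S2xS2. fst x \<bullet> R (snd x) = t} (M_level t)"
proof -
  have I: "orthogonal_transformation (\<lambda>x :: real^3. x)" by (rule orthogonal_transformation_id)
  note R' = orthogonal_transformation_inv[OF R]
  note f = orthogonal_pair[OF R R]
  show ?thesis
    by (rule congruent_by_linear[OF orthogonal_pair(1)[OF I R] orthogonal_pair(1)[OF I R']])
      (auto simp: M_level_def f inner_prod_def)
qed

lemma congruent_slice:
  fixes \<xi> :: "real^3"
  assumes \<xi>: "norm \<xi> = 1" and t: "-1 < t" "t < 1"
  shows "\<exists>r. 0 < r \<and> r \<le> 1 \<and> congruent_S2xS2 {x \<in> S2xS2. fst x \<bullet> \<xi> = t} (S1 r \<times> S2)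
    \<and> congruent_S2xS2 {x \<in> S2xS2. snd x \<bullet> \<xi> = t} (S1 r \<times> S2)"
proof -
  \<comment> \<open>The circles \<open>S1 r\<close> lie at nonnegative height, so for negative
    \<open>t\<close> the axis is reversed before it is rotated to the third coordinate axis.\<close>
  define \<zeta> where "\<zeta> = (if 0 \<le> t then \<xi> else - \<xi>)"
  have \<zeta>: "norm \<zeta> = 1" "p \<bullet> \<xi> = t \<longleftrightarrow> p \<bullet> \<zeta> = \<bar>t\<bar>" for p using \<xi> by (auto simp: \<zeta>_def)
  have "norm (axis 3 1 :: real^3) = 1" by simp
  from orthogonal_transformation_exists_1[OF \<zeta>(1) this]
  obtain A :: "real^3 \<Rightarrow> real^3" where A: "orthogonal_transformation A" "A \<zeta> = axis 3 1" .
  define r where "r = sqrt (1 - t\<^sup>2)"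
  have t2: "t\<^sup>2 < 1" using t abs_square_less_1[of t] by (simp add: abs_less_iff)
  then have r: "0 < r" "r \<le> 1" "sqrt (1 - r\<^sup>2) = \<bar>t\<bar>" by (simp_all add: r_def)
  have I: "orthogonal_transformation (\<lambda>x :: real^3. x)" by (rule orthogonal_transformation_id)
  note A' = orthogonal_transformation_inv[OF A(1)]
  note f = orthogonal_pair[OF A(1) A(1)]
  have ax: "(A p) $ 3 = p \<bullet> \<zeta>" for p
    using f(5)[of p \<zeta>] by (simp add: A(2) inner_axis)
  have ax': "inv A p \<bullet> \<zeta> = p $ 3" for p
    using ax[of "inv A p"] by (simp add: f)
  have 1: "congruent_S2xS2 {x \<in> S2xS2. fst x \<bullet> \<xi> = t} (S1 r \<times> S2)"
    by (rule congruent_by_linear[OF orthogonal_pair(1)[OF A(1) I] orthogonal_pair(1)[OF A' I]])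
      (auto simp: S1_def r(3) \<zeta>(2) f ax ax' inner_prod_def)
  have 2: "congruent_S2xS2 {x \<in> S2xS2. snd x \<bullet> \<xi> = t} (S1 r \<times> S2)"
    by (rule congruent_by_linear[OF orthogonal_pair(2)[OF A(1) I] orthogonal_pair(2)[OF I A']])
      (auto simp: S1_def r(3) \<zeta>(2) f ax ax' inner_prod_def)
  show ?thesis using r 1 2 by blast
qed

text \<open>Regularity at one point of \<open>M\<close> gives a nonzero gradient there, hence
  \<open>f t > 0\<close>; as the squared length depends only on the value of \<open>F\<close>, this
  covers the whole level.\<close>

lemma isoparametric_hypersurface_level:
  assumes "isoparametric_hypersurface M" "connected M"
  obtains F f g t where "isoparametric_level F f g t M"
proof -
  obtain F t where ne: "M \<noteq> {}" and F: "isoparametric_function F" and rv: "regular_value F t"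
    and M: "M = {x \<in> S2xS2. F x = t}"
    using assms(1) unfolding isoparametric_hypersurface_def by blast
  obtain f g where fg: "smooth_on UNIV f" "smooth_on UNIV g"
      "\<And>x. x \<in> S2xS2 \<Longrightarrow> (norm (gradient F x))\<^sup>2 = f (F x)"
      "\<And>x. x \<in> S2xS2 \<Longrightarrow> laplacian F x = g (F x)" and sF: "smooth_on S2xS2 F"
    using F unfolding isoparametric_function_def by blast
  interpret isoparametric F f g by unfold_locales (use fg sF in auto)
  obtain x where x: "x \<in> S2xS2" "F x = t" using ne M by blast
  have o: "x \<in> off_axes" using x S2xS2_subset_off_axes by blast
  have "(1::real) \<in> differential F x ` tangent_space x"
    using rv x unfolding regular_value_def by auto
  then obtain v where v: "v \<in> tangent_space x" "differential F x v = 1" by auto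
  have "G x \<bullet> v = 1"
    using differential_eq[OF x(1) v(1) Ft_derivative[OF o], of F] Ft_eq v(2) G_inner[OF o] by simp
  then have "G x \<noteq> 0" by auto
  then have "f t > 0" using G_norm[OF x(1)] x(2) by (metis inner_gt_zero_iff)
  then have "isoparametric_level F f g t M"
    by unfold_locales (use M assms(2) in auto)
  then show thesis by (rule that)
qed

theorem corollary3:
  fixes M :: "((real^3) \<times> (real^3)) set"
  assumes "isoparametric_hypersurface M"
    and "connected M"
  shows "(\<exists>r. 0 < r \<and> r \<le> 1 \<and> congruent_S2xS2 M (S1 r \<times> S2)) \<or>
         (\<exists>t. -1 < t \<and> t < 1 \<and> congruent_S2xS2 M (M_level t))"
proof -
  have ne: "M \<noteq> {}" using assms(1) by (simp add: isoparametric_hypersurface_def)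
  obtain F f g t0 where "isoparametric_level F f g t0 M"
    using isoparametric_hypersurface_level[OF assms] by blast
  then interpret isoparametric_level F f g t0 M .
  obtain \<rho> where \<rho>: "0 \<le> \<rho>" "\<rho> \<le> 1" "\<And>x. x \<in> M \<Longrightarrow> r1 x = \<rho> \<and> r2 x = 1 - \<rho>"
    using r1_constant[OF ne] by metis
  \<comment> \<open>Stated for an abstract pair of projections, so that a normal tangent to the
    first factor and one tangent to the second are handled by the same argument.\<close>
  have slice: "\<exists>r. 0 < r \<and> r \<le> 1 \<and> congruent_S2xS2 M (S1 r \<times> S2)"
    if PQ: "P = fst \<and> Q = snd \<and> i = (\<lambda>u. (u, 0)) \<and> j = (\<lambda>u. (0, u))
      \<or> P = snd \<and> Q = fst \<and> i = (\<lambda>u. (0, u)) \<and> j = (\<lambda>u. (u, 0))"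
    and Q0: "\<And>x. x \<in> M \<Longrightarrow> Q (N x) = 0"
    for P Q :: "r33 \<Rightarrow> real^3" and i j :: "real^3 \<Rightarrow> r33"
  proof -
    obtain \<xi> :: "real^3" and t where x: "norm \<xi> = 1" "-1 < t" "t < 1" "\<And>x. x \<in> M \<Longrightarrow> P x \<bullet> \<xi> = t"
      "\<And>x. x \<in> M \<Longrightarrow> P (N x) \<bullet> \<xi> \<noteq> 0"
      using M_subset_slice[OF PQ Q0 ne] by auto
    have "bounded_linear P" using PQ by (auto intro: bounded_linear_fst bounded_linear_snd)
    then have u: "bounded_linear (\<lambda>x :: r33. P x \<bullet> \<xi>)"
      by (rule bounded_linear_compose[OF bounded_linear_inner_left])
    let ?C = "{p. norm p = 1 \<and> p \<bullet> \<xi> = t}"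
    have "{x \<in> S2xS2. P x \<bullet> \<xi> = t} = ?C \<times> S2 \<or> {x \<in> S2xS2. P x \<bullet> \<xi> = t} = S2 \<times> ?C"
      using PQ by auto
    moreover have "connected ?C" "connected S2"
      using connected_slice[OF x(1)] x(2,3) connected_sphere[of "0 :: real^3" 1] by simp_all
    ultimately have "connected {x \<in> S2xS2. P x \<bullet> \<xi> = t}"
      by (elim disjE) (simp_all only: connected_Times)
    then have eq: "M = {x \<in> S2xS2. P x \<bullet> \<xi> = t}"
      using M_eq_level_set[OF C_inf_on_linear[OF u open_UNIV] x(4) _ _ ne] x(5)
        dderiv_eq[OF bounded_linear.has_derivative[OF u has_derivative_ident]] by simp
    obtain r where r: "0 < r" "r \<le> 1" "congruent_S2xS2 {x \<in> S2xS2. fst x \<bullet> \<xi> = t} (S1 r \<times> S2)"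
      "congruent_S2xS2 {x \<in> S2xS2. snd x \<bullet> \<xi> = t} (S1 r \<times> S2)"
      using congruent_slice[OF x(1-3)] by blast
    have "congruent_S2xS2 {x \<in> S2xS2. P x \<bullet> \<xi> = t} (S1 r \<times> S2)"
      using PQ by (elim disjE conjE) (simp_all only: r)
    then show ?thesis unfolding eq[symmetric] using r(1,2) by blast
  qed
  consider "\<rho> = 1" | "\<rho> = 0" | "0 < \<rho>" "\<rho> < 1" using \<rho> by linarith
  then show ?thesis
  proof cases
    case 1
    then show ?thesis
      using slice[of fst snd "\<lambda>u. (u, 0)" "\<lambda>u. (0, u)"] \<rho>(3) by (auto simp: r2_def)
  next
    case 2
    then show ?thesis
      using slice[of snd fst "\<lambda>u. (0, u)" "\<lambda>u. (u, 0)"] \<rho>(3) by (auto simp: r1_def)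
  next
    case 3
    interpret isoparametric_mixed F f g t0 M \<rho>
      by unfold_locales (use ne 3 \<rho>(3) in auto)
    obtain R :: "real^3 \<Rightarrow> real^3" and t where R: "orthogonal_transformation R" "-1 < t" "t < 1"
      "\<And>x. x \<in> M \<Longrightarrow> fst x \<bullet> R (snd x) = t"
      "\<And>x. x \<in> M \<Longrightarrow> N1 x \<bullet> R (snd x) + fst x \<bullet> R (N2 x) \<noteq> 0"
      using M_subset_graph by metis
    have bR: "bounded_linear R"
      using orthogonal_transformation_linear[OF R(1)] by (simp add: linear_conv_bounded_linear)
    have u: "C_inf_on UNIV (\<lambda>x :: r33. fst x \<bullet> R (snd x))"
      by (intro C_inf_on_bilinear[OF bounded_bilinear_inner] C_inf_on_bounded_linear[OF bR]
          C_inf_on_fst C_inf_on_snd C_inf_on_ident open_UNIV)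
    have d: "dderiv (\<lambda>x :: r33. fst x \<bullet> R (snd x)) x v = fst x \<bullet> R (snd v) + fst v \<bullet> R (snd x)" for x v
      using dderiv_eq[OF has_derivative_inner[OF has_derivative_fst[OF has_derivative_ident]
          bounded_linear.has_derivative[OF bR has_derivative_snd[OF has_derivative_ident]]], of x] by simp
    have eq: "M = {x \<in> S2xS2. fst x \<bullet> R (snd x) = t}"
      using M_eq_level_set[OF u R(4) _ connected_graph_level[OF R(1-3)] ne] R(5) by (simp add: d add.commute)
    have "congruent_S2xS2 M (M_level t)" by (subst eq) (rule congruent_graph[OF R(1)])
    then show ?thesis using R(2,3) by blast
  qed
qed

end
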